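(* There are absolute constants $c,C>0$ such that, for all sufficiently large $n$, \[ c\sqrt{n\log n}\le \vec{a}(n)\le C\sqrt{n\log n} \] and \[ c\sqrt{\frac n{\log n}}\le \vec{t}(n)\le C\sqrt{\frac n{\log n}}. \]
   Context: $\log$ is the natural logarithm. An oriented graph is an orientation of a finite simple graph; it is called triangle-free when its underlying undirected graph is triangle-free. A vertex set of an oriented graph $D$ is acyclic if it induces no directed cycle. The acyclic number $\vec{\alpha}(D)$ is the maximum size of an acyclic vertex set, and the dichromatic number $\vec{\chi}(D)$ is the minimum number of acyclic sets in a partition of $V(D)$. For $n\in\mathbb{N}$, $\vec{a}(n):=\min\{\vec{\alpha}(D): D \text{ is an } n\text{-vertex oriented triangle-free graph}\}$ and $\vec{t}(n):=\max\{\vec{\chi}(D): D \text{ is an } n\text{-vertex oriented triangle-free graph}\}$. *)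

theory Defs
  imports
    Complex_Main
    "HOL-Library.Disjoint_Sets"
    "Graph_Theory.Graph_Theory"
begin

text \<open>
  Following the Graph_Theory library, a finite simple graph \<open>G\<close> is a \<open>pair_graph\<close>, i.e. a finite,
  loop-free, symmetric digraph; the edge \<open>uv\<close> is represented by the two arcs \<open>(u, v)\<close> and \<open>(v, u)\<close>.
  An orientation keeps exactly one of them.
\<close>

definition is_orientation_of :: "'a pair_pre_digraph \<Rightarrow> 'a pair_pre_digraph \<Rightarrow> bool" where
  "is_orientation_of D G \<longleftrightarrow>
     pverts D = pverts G \<and> parcs D \<subseteq> parcs G \<and>
     (\<forall>u v. (u, v) \<in> parcs G \<longrightarrow> ((u, v) \<in> parcs D) \<noteq> ((v, u) \<in> parcs D))"

definition oriented_graph :: "'a pair_pre_digraph \<Rightarrow> bool" where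
  "oriented_graph D \<longleftrightarrow> (\<exists>G. pair_graph G \<and> is_orientation_of D G)"

definition triangle_free :: "'a pair_pre_digraph \<Rightarrow> bool" where
  "triangle_free G \<longleftrightarrow>
     \<not> (\<exists>u v w. (u, v) \<in> parcs G \<and> (v, w) \<in> parcs G \<and> (w, u) \<in> parcs G)"

text \<open>\<^const>\<open>mk_symmetric\<close> yields the underlying undirected graph of a digraph.\<close>

definition oriented_triangle_free :: "'a pair_pre_digraph \<Rightarrow> bool" where
  "oriented_triangle_free D \<longleftrightarrow>
     oriented_graph D \<and> triangle_free (mk_symmetric (with_proj D))"

definition acyclic_set :: "'a pair_pre_digraph \<Rightarrow> 'a set \<Rightarrow> bool" where
  "acyclic_set D S \<longleftrightarrow>
     S \<subseteq> pverts D \<and> \<not> (\<exists>p. pre_digraph.cycle (with_proj D \<restriction> S) p)"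

definition acyclic_number :: "'a pair_pre_digraph \<Rightarrow> nat" where
  "acyclic_number D = Max {card S | S. acyclic_set D S}"

definition dichromatic_number :: "'a pair_pre_digraph \<Rightarrow> nat" where
  "dichromatic_number D =
     Min {card P | P. partition_on (pverts D) P \<and> (\<forall>S\<in>P. acyclic_set D S)}"

text \<open>
  Vertices are taken from \<^typ>\<open>nat\<close>; every finite digraph is isomorphic to one of this kind.
  The extrema below are over finite nonempty sets of numbers, see the lemmas at the end.
\<close>

definition oriented_triangle_free_graphs :: "nat \<Rightarrow> nat pair_pre_digraph set" where
  "oriented_triangle_free_graphs n = {D. oriented_triangle_free D \<and> card (pverts D) = n}"

definition min_acyclic_number :: "nat \<Rightarrow> nat" where
  "min_acyclic_number n = Min (acyclic_number ` oriented_triangle_free_graphs n)"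

definition max_dichromatic_number :: "nat \<Rightarrow> nat" where
  "max_dichromatic_number n = Max (dichromatic_number ` oriented_triangle_free_graphs n)"

lemma orientation_underlying:
  assumes "pair_graph G" "is_orientation_of D G"
  shows "mk_symmetric (with_proj D) = G"
proof -
  interpret pair_graph G by fact
  have sym: "(u, v) \<in> parcs G \<Longrightarrow> (v, u) \<in> parcs G" for u v
    using pair_sym_arcs unfolding symmetric_def with_proj_simps by (rule symD)
  have "parcs (mk_symmetric (with_proj D)) = parcs G"
  proof (intro equalityI subrelI)
    fix u v assume "(u, v) \<in> parcs (mk_symmetric (with_proj D))"
    hence "(u, v) \<in> parcs D \<or> (v, u) \<in> parcs D" by (auto simp: parcs_mk_symmetric)
    thus "(u, v) \<in> parcs G" using assms(2) sym unfolding is_orientation_of_def by blast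
  next
    fix u v assume "(u, v) \<in> parcs G"
    hence "(u, v) \<in> parcs D \<or> (v, u) \<in> parcs D"
      using assms(2) unfolding is_orientation_of_def by blast
    thus "(u, v) \<in> parcs (mk_symmetric (with_proj D))"
    proof
      assume "(u, v) \<in> parcs D"
      thus ?thesis unfolding parcs_mk_symmetric with_proj_simps by (rule UN_I) simp
    next
      assume "(v, u) \<in> parcs D"
      thus ?thesis unfolding parcs_mk_symmetric with_proj_simps by (rule UN_I) simp
    qed
  qed
  moreover have "pverts (mk_symmetric (with_proj D)) = pverts G"
    using assms(2) by (simp add: is_orientation_of_def)
  ultimately show ?thesis by simp
qed

lemma oriented_graph_iff:
  "oriented_graph D \<longleftrightarrow> pair_digraph D \<and> (\<forall>u v. (u, v) \<in> parcs D \<longrightarrow> (v, u) \<notin> parcs D)"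
proof
  assume "oriented_graph D"
  then obtain G where G: "pair_graph G" "is_orientation_of D G"
    by (auto simp: oriented_graph_def)
  interpret pair_graph G by fact
  have sub: "parcs D \<subseteq> parcs G" and v: "pverts D = pverts G"
    using G(2) by (auto simp: is_orientation_of_def)
  have "pair_digraph D"
  proof unfold_locales
    fix e assume "e \<in> parcs D"
    hence e: "e \<in> parcs G" using sub by blast
    show "fst e \<in> pverts D" "snd e \<in> pverts D" "fst e \<noteq> snd e"
      unfolding v using e by (fact arc_fst_in_verts arc_snd_in_verts pair_no_loops)+
  next
    show "finite (pverts D)" unfolding v by (fact pair_finite_verts)
    show "finite (parcs D)" using sub pair_finite_arcs by (rule finite_subset)
  qed
  thus "pair_digraph D \<and> (\<forall>u v. (u, v) \<in> parcs D \<longrightarrow> (v, u) \<notin> parcs D)"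
    using G(2) sub unfolding is_orientation_of_def by blast
next
  assume A: "pair_digraph D \<and> (\<forall>u v. (u, v) \<in> parcs D \<longrightarrow> (v, u) \<notin> parcs D)"
  then interpret pair_digraph D by blast
  interpret M: pair_digraph "mk_symmetric (with_proj D)" by (rule digraph_mk_symmetric)
  have "pair_graph (mk_symmetric (with_proj D))"
    by unfold_locales (rule symmetric_mk_symmetric)
  moreover have "is_orientation_of D (mk_symmetric (with_proj D))"
    using A by (auto simp: is_orientation_of_def parcs_mk_symmetric)
  ultimately show "oriented_graph D" by (auto simp: oriented_graph_def)
qed

lemma oriented_graph_finite_verts:
  assumes "oriented_graph D"
  shows "finite (pverts D)"
proof -
  interpret pair_digraph D using assms by (simp add: oriented_graph_iff)
  show ?thesis by (rule pair_finite_verts)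
qed

lemma acyclic_set_empty: "acyclic_set D {}"
  by (auto simp: acyclic_set_def pre_digraph.cycle_def pre_digraph.awalk_def)

lemma acyclic_set_singleton:
  assumes "oriented_graph D" "v \<in> pverts D"
  shows "acyclic_set D {v}"
proof -
  have "(v, v) \<notin> parcs D" using assms(1) by (auto simp: oriented_graph_iff)
  hence "set p \<subseteq> arcs (with_proj D \<restriction> {v}) \<Longrightarrow> p = []" for p by (cases p) auto
  thus ?thesis using assms(2)
    by (auto simp: acyclic_set_def pre_digraph.cycle_def pre_digraph.awalk_def)
qed

lemma acyclic_number_set:
  assumes "finite (pverts D)"
  shows "finite {card S | S. acyclic_set D S}" "{card S | S. acyclic_set D S} \<noteq> {}"
proof -
  have "{card S | S. acyclic_set D S} \<subseteq> card ` Pow (pverts D)"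
    by (auto simp: acyclic_set_def)
  thus "finite {card S | S. acyclic_set D S}"
    by (rule finite_subset) (simp add: assms)
  show "{card S | S. acyclic_set D S} \<noteq> {}" using acyclic_set_empty[of D] by auto
qed

lemma dichromatic_number_set:
  assumes "oriented_graph D"
  defines "X \<equiv> {card P | P. partition_on (pverts D) P \<and> (\<forall>S\<in>P. acyclic_set D S)}"
  shows "finite X" "card (pverts D) \<in> X"
proof -
  have fin: "finite (pverts D)" using assms(1) by (rule oriented_graph_finite_verts)
  have "X \<subseteq> card ` Pow (Pow (pverts D))"
  proof
    fix k assume "k \<in> X"
    then obtain P where "k = card P" "\<forall>S\<in>P. acyclic_set D S" unfolding X_def by blast
    moreover from this have "P \<in> Pow (Pow (pverts D))" unfolding acyclic_set_def by blast
    ultimately show "k \<in> card ` Pow (Pow (pverts D))" by blast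
  qed
  thus "finite X" by (rule finite_subset) (simp add: fin)
  let ?P = "(\<lambda>v. {v}) ` pverts D"
  have "partition_on (pverts D) ?P" by (rule partition_onI) (auto simp: disjnt_def)
  moreover have "card ?P = card (pverts D)" by (simp add: card_image)
  moreover have "\<forall>S\<in>?P. acyclic_set D S" using acyclic_set_singleton[OF assms(1)] by auto
  ultimately show "card (pverts D) \<in> X" unfolding X_def by (intro CollectI exI[of _ ?P]) simp
qed

lemma oriented_triangle_free_graphs_nonempty: "oriented_triangle_free_graphs n \<noteq> {}"
proof -
  let ?D = "\<lparr>pverts = {..<n}, parcs = {}\<rparr>"
  have "pair_digraph ?D" by unfold_locales auto
  hence "?D \<in> oriented_triangle_free_graphs n"
    by (auto simp: oriented_triangle_free_graphs_def oriented_triangle_free_def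
        oriented_graph_iff triangle_free_def parcs_mk_symmetric)
  thus ?thesis by blast
qed

lemma acyclic_number_le:
  assumes "finite (pverts D)"
  shows "acyclic_number D \<le> card (pverts D)"
proof -
  have "acyclic_number D \<in> {card S | S. acyclic_set D S}"
    unfolding acyclic_number_def by (rule Max_in) (fact acyclic_number_set[OF assms])+
  thus ?thesis using assms by (auto simp: acyclic_set_def intro: card_mono)
qed

lemma dichromatic_number_le:
  assumes "oriented_graph D"
  shows "dichromatic_number D \<le> card (pverts D)"
  unfolding dichromatic_number_def
  by (rule Min_le[OF dichromatic_number_set(1)[OF assms] dichromatic_number_set(2)[OF assms]])

lemma finite_acyclic_numbers: "finite (acyclic_number ` oriented_triangle_free_graphs n)"
proof (rule finite_subset)
  show "acyclic_number ` oriented_triangle_free_graphs n \<subseteq> {..n}"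
    by (auto simp: oriented_triangle_free_graphs_def oriented_triangle_free_def
        intro!: acyclic_number_le oriented_graph_finite_verts)
qed simp

lemma finite_dichromatic_numbers: "finite (dichromatic_number ` oriented_triangle_free_graphs n)"
proof (rule finite_subset)
  show "dichromatic_number ` oriented_triangle_free_graphs n \<subseteq> {..n}"
    by (auto simp: oriented_triangle_free_graphs_def oriented_triangle_free_def
        intro!: dichromatic_number_le)
qed simp

end

theory Submission
  imports Defs "HOL-Library.FuncSet" "HOL-Real_Asymp.Real_Asymp"
begin

text \<open>
  Independent sets are acyclic, so the lower bound on \<open>\<alpha>\<close> and the upper bound on \<open>\<chi>\<close> follow from
  Shearer's argument: in a triangle-free graph of maximum degree \<open>\<le> D\<close>, a uniformly random independent
  set meets the closed neighbourhood of every vertex often enough to force an independent set of size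
  \<open>n log D / (8 D)\<close>; take \<open>D = sqrt (n ln n)\<close>, and peel off independent sets greedily to colour.

  For the other two bounds we need a triangle-free graph in which every set of \<open>k\<close>, of order
  \<open>sqrt (n ln n)\<close>, vertices spans more than \<open>k log\<^sub>2 n\<close> edges; then a random orientation has no acyclic
  \<open>k\<close>-set, by a union bound over all orderings of all \<open>k\<close>-sets. The graph is a variant of the
  ``two bites'' construction for \<open>R(3,k)\<close>. Each vertex is a random point of a grid \<open>[m]\<^sup>2\<close> with \<open>m\<close> about
  \<open>n powr (4/5)\<close>, and each axis carries an independent random graph \<open>G\<^sub>i\<close> of density \<open>p = sqrt (ln n / n)\<close>, made
  triangle-free by deleting a maximal edge-disjoint family of triangles. Since \<open>m p\<^sup>2\<close> is polynomially
  small, this costs few edges. Two points are joined in colour 2 if their second coordinates are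
  adjacent in \<open>G\<^sub>2\<close> and their first coordinates are distinct without common \<open>G\<^sub>1\<close>-neighbour, and
  symmetrically in colour 1. Of the three edges of a triangle two have the same colour, so there are
  no triangles. As the points are sparse in the grid, every \<open>k\<close>-set has \<open>\<ge> k / 80\<close> distinct
  coordinates on one axis, where the random edges are then plentiful.
\<close>

text \<open>A single random graph on n vertices with this density has about n p^2 = ln n common
  neighbours per pair: a typical edge lies in many triangles and deletion would ruin the graph. With
  m coordinates the count drops to m p^2 = n^(-1/5) ln n, but a set of points may now sit on few
  coordinates of an axis. The second axis exists to catch such sets; its price is the clause about
  common neighbours, and much of the work goes into showing that this clause excludes few pairs.
  Quantities to be bounded from above must beat union bounds over all vertex sets of size t or s.
  They are therefore measured by packings of disjoint sets, where each packed set contributes a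
  factor q. Stars, triangles and points in subgrids have expectations below the permitted number by
  a factor of about n^(1/10) or more, up to logarithms. This makes q = n^(-1/20) available, and 40 t
  disjoint sets then pay for m^t choices.\<close>

section \<open>Random subsets\<close>

text \<open>The probability that the random subset of \<open>E\<close> containing each element independently with
  probability \<open>p\<close> satisfies \<open>Q\<close>.\<close>

definition prb :: "'a set \<Rightarrow> real \<Rightarrow> ('a set \<Rightarrow> bool) \<Rightarrow> real" where
  "prb E p Q = (\<Sum>G | G \<subseteq> E \<and> Q G. p ^ card G * (1 - p) ^ card (E - G))"

text \<open>Independence in generating-function form: a product weight over the elements has a
  product as its expectation. Indicator weights give probabilities of events, and the weight 1/2
  gives a Chernoff bound.\<close>

lemma prb_weight_sum:
  fixes a b :: "'a \<Rightarrow> real"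
  assumes "finite E"
  shows "(\<Sum>G\<in>Pow E. p ^ card G * (1 - p) ^ card (E - G) * (\<Prod>e\<in>E. if e \<in> G then a e else b e))
    = (\<Prod>e\<in>E. p * a e + (1 - p) * b e)"
proof -
  have "(\<Prod>e\<in>E. if e \<in> G then a e else b e) = prod a G * prod b (E - G)" if "G \<subseteq> E" for G
  proof -
    have "(\<Prod>e\<in>E. if e \<in> G then a e else b e)
       = (\<Prod>e\<in>E - G. if e \<in> G then a e else b e) * (\<Prod>e\<in>G. if e \<in> G then a e else b e)"
      by (rule prod.subset_diff[OF that assms])
    also have "\<dots> = prod b (E - G) * prod a G"
      by (intro arg_cong2[where f="(*)"] prod.cong) auto
    finally show ?thesis by simp
  qed
  hence "(\<Sum>G\<in>Pow E. p ^ card G * (1 - p) ^ card (E - G) * (\<Prod>e\<in>E. if e \<in> G then a e else b e))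
    = (\<Sum>G\<in>Pow E. (\<Prod>e\<in>G. p * a e) * (\<Prod>e\<in>E - G. (1 - p) * b e))"
    by (intro sum.cong) (auto simp: prod.distrib)
  also have "\<dots> = (\<Prod>e\<in>E. p * a e + (1 - p) * b e)"
    using assms by (simp add: prod_add)
  finally show ?thesis .
qed

locale prb_space =
  fixes E :: "'a set" and p :: real
  assumes finE: "finite E" and p01: "0 \<le> p" "p \<le> 1"
begin

lemma fin_events: "finite {G. G \<subseteq> E \<and> Q G}"
  using finE by simp

lemma prb_mono:
  assumes "\<And>G. G \<subseteq> E \<Longrightarrow> Q G \<Longrightarrow> R G"
  shows "prb E p Q \<le> prb E p R"
  unfolding prb_def using p01 assms fin_events by (intro sum_mono2) auto

lemma prb_True: "prb E p (\<lambda>_. True) = 1"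
  using prb_weight_sum[OF finE, of p "\<lambda>_. 1" "\<lambda>_. 1"] unfolding prb_def Pow_def by simp

lemma prb_disj: "prb E p (\<lambda>G. Q G \<or> R G) \<le> prb E p Q + prb E p R"
proof -
  have "{G. G \<subseteq> E \<and> (Q G \<or> R G)} = {G. G \<subseteq> E \<and> Q G} \<union> {G. G \<subseteq> E \<and> R G}" by auto
  hence "prb E p (\<lambda>G. Q G \<or> R G) + (\<Sum>G\<in>{G. G \<subseteq> E \<and> Q G} \<inter> {G. G \<subseteq> E \<and> R G}. p ^ card G * (1 - p) ^ card (E - G))
     = prb E p Q + prb E p R"
    unfolding prb_def by (simp only:) (rule sum.union_inter[OF fin_events fin_events])
  moreover have "0 \<le> (\<Sum>G\<in>{G. G \<subseteq> E \<and> Q G} \<inter> {G. G \<subseteq> E \<and> R G}. p ^ card G * (1 - p) ^ card (E - G))"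
    using p01 by (intro sum_nonneg) auto
  ultimately show ?thesis by linarith
qed

lemma prb_Bex:
  assumes "finite I"
  shows "prb E p (\<lambda>G. \<exists>i\<in>I. Q i G) \<le> (\<Sum>i\<in>I. prb E p (Q i))"
  using assms
proof (induction I)
  case empty
  then show ?case by (simp add: prb_def)
next
  case (insert i I)
  have "prb E p (\<lambda>G. \<exists>j\<in>insert i I. Q j G) = prb E p (\<lambda>G. Q i G \<or> (\<exists>j\<in>I. Q j G))" by simp
  also have "\<dots> \<le> prb E p (Q i) + prb E p (\<lambda>G. \<exists>j\<in>I. Q j G)" by (rule prb_disj)
  finally show ?case using insert by simp
qed

lemma prb_Bex_le:
  assumes "finite I" "\<And>i. i \<in> I \<Longrightarrow> prb E p (Q i) \<le> c" "real (card I) \<le> M" "0 \<le> c"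
  shows "prb E p (\<lambda>G. \<exists>i\<in>I. Q i G) \<le> M * c"
proof -
  have "prb E p (\<lambda>G. \<exists>i\<in>I. Q i G) \<le> (\<Sum>i\<in>I. c)"
    by (rule order_trans[OF prb_Bex[OF assms(1)] sum_mono]) (use assms in auto)
  also have "\<dots> = real (card I) * c" by simp
  also have "\<dots> \<le> M * c" using assms by (intro mult_right_mono) auto
  finally show ?thesis .
qed

lemma prb_superset:
  assumes "S \<subseteq> E"
  shows "prb E p (\<lambda>G. S \<subseteq> G) = p ^ card S"
proof -
  \<comment> \<open>Weight 0 for the absence of an element of \<open>S\<close> turns the product
    into the indicator of \<open>S \<subseteq> G\<close>.\<close>
  let ?b = "\<lambda>e. if e \<in> S then 0 else 1 :: real"
  have *: "(\<Prod>e\<in>E. if e \<in> G then 1 else ?b e) = of_bool (S \<subseteq> G)" if "G \<subseteq> E" for G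
  proof (cases "S \<subseteq> G")
    case False
    then obtain e where "e \<in> S" "e \<notin> G" by auto
    hence "(\<Prod>e\<in>E. if e \<in> G then 1 else ?b e) = 0"
      using assms by (intro prod_zero[OF finE] bexI[of _ e]) auto
    thus ?thesis using False by simp
  qed (auto intro!: prod.neutral)
  have "prb E p (\<lambda>G. S \<subseteq> G) = (\<Sum>G\<in>Pow E. if S \<subseteq> G then p ^ card G * (1 - p) ^ card (E - G) else 0)"
    unfolding prb_def using finE by (intro sum.mono_neutral_cong_left) auto
  also have "\<dots> = (\<Sum>G\<in>Pow E. p ^ card G * (1 - p) ^ card (E - G) *
      (\<Prod>e\<in>E. if e \<in> G then 1 else ?b e))"
    by (intro sum.cong) (auto simp: *)
  also have "\<dots> = (\<Prod>e\<in>E. p * 1 + (1 - p) * ?b e)"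
    by (rule prb_weight_sum[OF finE])
  also have "\<dots> = (\<Prod>e\<in>E. if e \<in> S then p else 1)"
    by (intro prod.cong) auto
  also have "\<dots> = p ^ card S"
    using assms finE by (simp add: prod.If_cases Int_absorb1)
  finally show ?thesis .
qed

text \<open>Exponential Markov inequality with the weight 2^(-card (G \<inter> S)). With M the mean,
  its expectation is (1 - p/2)^card S, at most exp (-M/2), and a count of at most M/4 costs a factor
  2^(M/4), at most exp (M/4).\<close>

lemma prb_few:
  assumes "S \<subseteq> E"
  shows "prb E p (\<lambda>G. real (card (G \<inter> S)) \<le> p * card S / 4) \<le> exp (- p * card S / 4)"
proof -
  define M where "M = p * card S"
  let ?a = "\<lambda>e. if e \<in> S then 1/2 else 1 :: real"
  have pr: "(\<Prod>e\<in>E. if e \<in> G then ?a e else 1) = (1/2) ^ card (G \<inter> S)" if "G \<subseteq> E" for G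
  proof -
    have "(\<Prod>e\<in>E. if e \<in> G then ?a e else 1) = (\<Prod>e\<in>E. if e \<in> G \<inter> S then 1/2 else 1)"
      by (intro prod.cong) auto
    also have "\<dots> = (1/2) ^ card (E \<inter> (G \<inter> S))" using finE by (simp add: prod.If_cases Int_def)
    also have "E \<inter> (G \<inter> S) = G \<inter> S" using that by auto
    finally show ?thesis .
  qed
  have "prb E p (\<lambda>G. real (card (G \<inter> S)) \<le> M / 4)
     \<le> (\<Sum>G | G \<subseteq> E \<and> real (card (G \<inter> S)) \<le> M / 4.
          p ^ card G * (1 - p) ^ card (E - G) * (2 powr (M/4) * (1/2) ^ card (G \<inter> S)))"
    unfolding prb_def
  proof (intro sum_mono)
    fix G assume "G \<in> {G. G \<subseteq> E \<and> real (card (G \<inter> S)) \<le> M / 4}"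
    hence "2 powr (card (G \<inter> S)) \<le> 2 powr (M/4)" by simp
    hence "1 \<le> 2 powr (M/4) * (1/2) ^ card (G \<inter> S)"
      by (simp add: powr_realpow field_simps)
    thus "p ^ card G * (1 - p) ^ card (E - G)
      \<le> p ^ card G * (1 - p) ^ card (E - G) * (2 powr (M/4) * (1/2) ^ card (G \<inter> S))"
      using p01 mult_left_mono[of 1 "2 powr (M/4) * (1/2) ^ card (G \<inter> S)" "p ^ card G * (1 - p) ^ card (E - G)"]
      by simp
  qed
  also have "\<dots> \<le> (\<Sum>G\<in>Pow E.
          p ^ card G * (1 - p) ^ card (E - G) * (2 powr (M/4) * (1/2) ^ card (G \<inter> S)))"
    using finE p01 by (intro sum_mono2) auto
  also have "\<dots> = 2 powr (M/4) * (\<Sum>G\<in>Pow E.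
          p ^ card G * (1 - p) ^ card (E - G) * (\<Prod>e\<in>E. if e \<in> G then ?a e else 1))"
    by (subst sum_distrib_left, intro sum.cong) (auto simp: pr)
  also have "(\<Sum>G\<in>Pow E.
          p ^ card G * (1 - p) ^ card (E - G) * (\<Prod>e\<in>E. if e \<in> G then ?a e else 1)) 
      = (\<Prod>e\<in>E. p * ?a e + (1 - p) * 1)"
    by (rule prb_weight_sum[OF finE])
  also have "\<dots> = (\<Prod>e\<in>E. if e \<in> S then 1 - p / 2 else 1)"
    by (intro prod.cong) auto
  also have "\<dots> = (1 - p / 2) ^ card S"
    using assms finE by (simp add: prod.If_cases Int_absorb1)
  also have "\<dots> \<le> exp (- p / 2) ^ card S"
    using p01 exp_ge_add_one_self[of "-p/2"] by (intro power_mono) auto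
  also have "\<dots> = exp (- M / 2)" by (simp add: M_def flip: exp_of_nat2_mult)
  also have "2 powr (M/4) \<le> exp (M / 4)"
  proof -
    have "0 \<le> M" using p01 by (simp add: M_def)
    moreover have "ln 2 < (1::real)" using ln_2_less_1 .
    ultimately have "M / 4 * ln 2 \<le> M / 4 * 1" by (intro mult_left_mono) auto
    thus ?thesis by (simp add: powr_def)
  qed
  finally have "prb E p (\<lambda>G. real (card (G \<inter> S)) \<le> M / 4) \<le> exp (M/4) * exp (- M / 2)" by simp
  also have "\<dots> = exp (- M / 4)" by (simp flip: exp_add)
  finally show ?thesis by (simp add: M_def)
qed

end

section \<open>Packings of disjoint sets inside a random set\<close>

text \<open>N^N / N! is one term of the series of exp N. In this form it turns M^N / N! into (e M /
  N)^N.\<close>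

lemma power_le_fact_exp: "real N ^ N \<le> exp 1 ^ N * fact N"
proof -
  have "real N ^ N / fact N \<le> exp (real N)"
    using sum_le_suminf[OF sums_summable[OF exp_converges[of "real N"]], of "{N}"]
    by (simp add: exp_def divide_inverse mult.commute)
  thus ?thesis using exp_of_nat_mult[of N "1::real"] by (simp add: field_simps)
qed

text \<open>Unlike the number of members of \<open>F\<close> inside a random set, the size of a disjoint subfamily has
  a trivial upper tail bound.\<close>

definition packs :: "'a set set \<Rightarrow> nat \<Rightarrow> 'a set \<Rightarrow> bool" where
  "packs F N G \<longleftrightarrow> (\<exists>D. D \<subseteq> F \<and> card D = N \<and> finite D \<and> disjoint D \<and> \<Union>D \<subseteq> G)"

text \<open>Union bound over the subfamilies of \<open>F\<close> with N members, at most M^N / N! in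
  number. A disjoint one has a union of j N elements, so it lies in the random set with probability
  p^(j N), and no correlations have to be estimated. The hypothesis on \<open>q\<close> says e M p^j
  / N \<le> q.\<close>

lemma (in prb_space) prb_packs:
  assumes F: "\<And>f. f \<in> F \<Longrightarrow> f \<subseteq> E \<and> card f = j" and M: "real (card F) \<le> M"
    and q: "exp 1 * M * p ^ j \<le> q * real N" and N: "N > 0"
  shows "prb E p (packs F N) \<le> q ^ N"
proof -
  have "F \<subseteq> Pow E" using F by blast
  hence finF: "finite F" using finE finite_subset by auto
  let ?I = "{D. D \<subseteq> F \<and> card D = N \<and> disjoint D}"
  have "?I \<subseteq> Pow F" by auto
  hence finI: "finite ?I" using finF finite_subset by blast
  have "prb E p (packs F N) = prb E p (\<lambda>G. \<exists>D\<in>?I. \<Union>D \<subseteq> G)"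
  proof -
    have "packs F N G \<longleftrightarrow> (\<exists>D\<in>?I. \<Union>D \<subseteq> G)" for G
      unfolding packs_def using finite_subset[OF _ finF] by auto
    thus ?thesis by presburger
  qed
  also have "\<dots> \<le> (real (card F) ^ N / fact N) * p ^ (j * N)"
  proof (rule prb_Bex_le[OF finI])
    fix D assume D: "D \<in> ?I"
    have "card (\<Union>D) = (\<Sum>f\<in>D. card f)"
      using D F finite_subset[OF _ finE] by (intro card_Union_disjoint) (auto simp: disjoint_def pairwise_def disjnt_def)
    also have "\<dots> = j * N" using D F by (subst sum.cong[OF refl, of _ _ "\<lambda>_. j"]) auto
    finally have "card (\<Union>D) = j * N" .
    moreover have "\<Union>D \<subseteq> E" using D F by blast
    ultimately show "prb E p (\<lambda>G. \<Union>D \<subseteq> G) \<le> p ^ (j * N)" by (simp add: prb_superset)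
  next
    have "card ?I \<le> card {D. D \<subseteq> F \<and> card D = N}"
      using finF by (intro card_mono) auto
    also have "\<dots> = card F choose N" using finF by (rule n_subsets)
    finally have "card ?I \<le> card F choose N" .
    hence "real (card ?I) \<le> real (card F choose N)" by simp
    also have "\<dots> \<le> real (card F) ^ N / fact N"
    proof -
      have "real ((card F choose N) * fact N) \<le> real (card F ^ N)"
        using binomial_fact_pow[of "card F" N] by (intro of_nat_mono)
      thus ?thesis by (simp add: field_simps)
    qed
    finally show "real (card ?I) \<le> real (card F) ^ N / fact N" .
  qed (use p01 in auto)
  also have "\<dots> \<le> (M ^ N / fact N) * p ^ (j * N)"
    using p01 M by (intro mult_right_mono divide_right_mono power_mono) auto
  also have "\<dots> = (M * p ^ j) ^ N / fact N" by (simp add: power_mult_distrib power_mult)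
  also have "\<dots> \<le> (q * real N / exp 1) ^ N / fact N"
    using q p01 M by (intro divide_right_mono power_mono) (auto simp: field_simps)
  also have "\<dots> = q ^ N * (real N ^ N / (exp 1 ^ N * fact N))"
    by (simp add: power_mult_distrib power_divide)
  also have "\<dots> \<le> q ^ N * 1"
  proof (rule mult_left_mono)
    show "real N ^ N / (exp 1 ^ N * fact N) \<le> 1"
      using power_le_fact_exp[of N] by (simp add: field_simps)
    have "0 \<le> exp 1 * M * p ^ j" using M p01 by auto
    hence "0 \<le> q * real N" using q by linarith
    hence "0 \<le> q" using N by (simp add: zero_le_mult_iff)
    thus "0 \<le> q ^ N" by simp
  qed
  finally show ?thesis by simp
qed

text \<open>A maximal disjoint subfamily of the members inside \<open>G\<close> has fewer than N
  members, and by maximality its union meets all members inside \<open>G\<close>.\<close>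

lemma not_packs_hitting:
  assumes "\<not> packs F N G" "finite F" "\<And>f. f \<in> F \<Longrightarrow> finite f \<and> card f = j \<and> f \<noteq> {}"
  shows "\<exists>Z\<subseteq>G. card Z \<le> j * N \<and> (\<forall>f\<in>F. f \<subseteq> G \<longrightarrow> f \<inter> Z \<noteq> {})"
proof -
  let ?A = "{D. D \<subseteq> F \<and> disjoint D \<and> \<Union>D \<subseteq> G}"
  have "?A \<subseteq> Pow F" by auto
  hence "finite ?A" using assms(2) finite_subset by blast
  moreover have "{} \<in> ?A" by auto
  ultimately obtain D where D: "D \<in> ?A" "\<And>D'. D' \<in> ?A \<Longrightarrow> D \<subseteq> D' \<Longrightarrow> D = D'"
    using finite_has_maximal[of ?A] by (metis (lifting) empty_iff)
  have finD: "finite D" using D(1) assms(2) finite_subset by blast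
  have "card D < N"
  proof (rule ccontr)
    assume "\<not> card D < N"
    then obtain D' where D': "D' \<subseteq> D" "card D' = N"
      by (meson not_less obtain_subset_with_card_n)
    have "\<Union>D' \<subseteq> \<Union>D" "disjoint D'" "finite D'"
      using D'(1) D(1) finD by (auto intro: pairwise_subset finite_subset)
    hence "packs F N G" unfolding packs_def
      using D(1) D' by (intro exI[of _ D'] conjI) (assumption | blast)+
    thus False using assms(1) by simp
  qed
  have "card (\<Union>D) = (\<Sum>f\<in>D. card f)"
    using D(1) assms(3) by (intro card_Union_disjoint) (auto simp: disjoint_def pairwise_def disjnt_def)
  also have "\<dots> = j * card D" using D(1) assms(3) by (subst sum.cong[OF refl, of _ _ "\<lambda>_. j"]) auto
  finally have "card (\<Union>D) \<le> j * N" using \<open>card D < N\<close> by simp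
  moreover have "f \<inter> \<Union>D \<noteq> {}" if f: "f \<in> F" "f \<subseteq> G" for f
  proof
    assume *: "f \<inter> \<Union>D = {}"
    hence "insert f D \<in> ?A"
      using D(1) f by (auto simp: disjoint_def)
    hence "f \<in> D" using D(2)[of "insert f D"] by auto
    thus False using * assms(3)[OF f(1)] by auto
  qed
  ultimately show ?thesis using D(1) by (intro exI[of _ "\<Union>D"] conjI ballI impI) auto
qed

text \<open>The quadratic form of \<open>R\<close>, with \<open>2\<close> added on the diagonal, is strictly convex in every direction
  \<open>e\<^sub>a - e\<^sub>b\<close>. Hence a maximiser under \<open>0 \<le> w \<le> F\<close> and a fixed total weight has at most one entry
  different from \<open>0\<close> and \<open>F\<close>, which reduces weights to sets.\<close>

lemma weighted_pairs_le:
  fixes w :: "'a \<Rightarrow> nat" and R :: "'a \<Rightarrow> 'a \<Rightarrow> bool" and F t :: nat and q :: real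
  assumes X: "finite X" and sym: "\<And>a b. R a b \<Longrightarrow> R b a" and irr: "\<And>a. \<not> R a a"
    and wF: "\<And>a. a \<in> X \<Longrightarrow> w a \<le> F" and ws: "sum w X \<le> t * F"
    and q: "\<And>A. A \<subseteq> X \<Longrightarrow> card A \<le> t \<Longrightarrow> real (card {(a, b). a \<in> A \<and> b \<in> A \<and> R a b}) \<le> q"
  shows "(\<Sum>a\<in>X. \<Sum>b\<in>X. of_bool (R a b) * real (w a) * real (w b)) \<le> real F ^ 2 * (q + 2 * real t)"
proof -
  define N :: "'a \<Rightarrow> 'a \<Rightarrow> real" where "N a b = (if a = b then 2 else of_bool (R a b))" for a b
  define phi where "phi v = (\<Sum>a\<in>X. \<Sum>b\<in>X. N a b * v a * v b)" for v :: "'a \<Rightarrow> real"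
  \<comment> \<open>Integer weights, so that a maximiser exists by finiteness; moving one unit from
    one vertex to another stays inside \<open>Ws\<close>.\<close>
  define Ws where "Ws = {v \<in> X \<rightarrow>\<^sub>E {..F}. sum v X = sum w X}"
  have "finite (X \<rightarrow>\<^sub>E {..F})" using X by (intro finite_PiE) auto
  hence finWs: "finite Ws" unfolding Ws_def by simp
  have wWs: "restrict w X \<in> Ws" using wF by (auto simp: Ws_def)
  define mx where "mx = Max ((\<lambda>v. phi (\<lambda>x. real (v x))) ` Ws)"
  have "mx \<in> (\<lambda>v. phi (\<lambda>x. real (v x))) ` Ws"
    unfolding mx_def using finWs wWs by (intro Max_in) auto
  then obtain v where v: "v \<in> Ws" "phi (\<lambda>x. real (v x)) = mx" by auto
  have mx: "phi (\<lambda>x. real (u x)) \<le> mx" if "u \<in> Ws" for u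
    unfolding mx_def using finWs that by (intro Max_ge) auto
  have uniq: False if ab: "a \<in> X" "b \<in> X" "a \<noteq> b" "0 < v a" "v a < F" "0 < v b" "v b < F" for a b
  proof -
    define d :: "'a \<Rightarrow> real" where "d x = of_bool (x = a) - of_bool (x = b)" for x
    have move: "phi (\<lambda>x. real (v x) + (of_bool (x = i) - of_bool (x = j))) \<le> mx"
      if ij: "i \<in> X" "j \<in> X" "i \<noteq> j" "v i < F" "0 < v j" for i j
    proof -
      define u where "u = v(i := v i + 1, j := v j - 1)"
      have "sum u X + 1 = sum v X + 1"
      proof -
        have "sum u X = u i + (u j + sum u (X - {i} - {j}))"
          using sum.remove[OF X ij(1), of u] sum.remove[of "X - {i}" j u] X ij by simp
        also have "sum u (X - {i} - {j}) = sum v (X - {i} - {j})"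
          by (intro sum.cong) (auto simp: u_def)
        also have "u i + (u j + sum v (X - {i} - {j})) + 1 = (v i + (v j + sum v (X - {i} - {j}))) + 1"
          using ij by (simp add: u_def)
        also have "v i + (v j + sum v (X - {i} - {j})) = sum v X"
          using sum.remove[OF X ij(1), of v] sum.remove[of "X - {i}" j v] X ij by simp
        finally show ?thesis .
      qed
      hence "u \<in> Ws" using v(1) ij by (auto simp: Ws_def u_def PiE_iff extensional_def)
      moreover have "real (u x) = real (v x) + (of_bool (x = i) - of_bool (x = j))" for x
        using ij by (auto simp: u_def)
      ultimately show ?thesis using mx[of u] by simp
    qed
    have 1: "phi (\<lambda>x. real (v x) + d x) \<le> mx"
      using move[of a b] ab by (simp add: d_def)
    have 2: "phi (\<lambda>x. real (v x) - d x) \<le> mx"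
      using move[of b a] ab by (simp add: d_def algebra_simps)
    \<comment> \<open>Second difference of the quadratic form along \<open>d\<close>: the two
      shifted weights have average value phi v + phi d with phi d at least 2, so one of them exceeds
      the maximum.\<close>
    have "phi (\<lambda>x. real (v x) + d x) + phi (\<lambda>x. real (v x) - d x)
        = 2 * phi (\<lambda>x. real (v x)) + 2 * phi d"
      unfolding phi_def sum_distrib_left sum.distrib[symmetric]
      by (intro sum.cong refl) (simp add: algebra_simps)
    moreover have "phi d = (N a a - N a b) - (N b a - N b b)"
    proof -
      have "(\<Sum>y\<in>X. N x y * d x * d y) = d x * (N x a - N x b)" for x
      proof -
        have "(\<Sum>y\<in>X. N x y * d x * d y)
           = d x * ((\<Sum>y\<in>X. if y = a then N x y else 0) - (\<Sum>y\<in>X. if y = b then N x y else 0))"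
          unfolding sum_subtractf[symmetric] sum_distrib_left
          by (intro sum.cong refl) (auto simp: d_def)
        thus ?thesis using X ab by simp
      qed
      hence "phi d = (\<Sum>x\<in>X. d x * (N x a - N x b))" by (simp add: phi_def)
      also have "\<dots> = (\<Sum>x\<in>X. if x = a then N x a - N x b else 0) - (\<Sum>x\<in>X. if x = b then N x a - N x b else 0)"
        unfolding sum_subtractf[symmetric] by (intro sum.cong refl) (auto simp: d_def)
      finally show ?thesis using X ab by simp
    qed
    moreover have "(N a a - N a b) - (N b a - N b b) \<ge> 2"
      using ab by (simp add: N_def)
    ultimately show False using 1 2 v(2) by linarith
  qed
  define A where "A = {x \<in> X. 0 < v x}"
  have AX: "A \<subseteq> X" "finite A" using X by (auto simp: A_def)
  have vF: "v x \<le> F" if "x \<in> X" for x using v(1) that by (auto simp: Ws_def PiE_iff)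
  have vs: "sum v A \<le> t * F"
  proof -
    have "sum v A = sum v X" using X by (intro sum.mono_neutral_left) (auto simp: A_def)
    thus ?thesis using v(1) ws by (simp add: Ws_def)
  qed
  have "card A \<le> t"
  proof (cases "\<exists>a\<in>A. v a < F")
    case True
    then obtain a where a: "a \<in> A" "v a < F" by auto
    \<comment> \<open>All other entries equal F while \<open>v a\<close> is positive; this
      strictness gives the bound t instead of t + 1.\<close>
    have "sum v A = v a + sum v (A - {a})" by (rule sum.remove[OF AX(2) a(1)])
    also have "sum v (A - {a}) = (\<Sum>x\<in>A-{a}. F)"
    proof (intro sum.cong refl)
      fix x assume "x \<in> A - {a}"
      hence x: "x \<in> X" "0 < v x" "a \<noteq> x" by (auto simp: A_def)
      have "\<not> v x < F" using uniq[of a x] a x by (auto simp: A_def)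
      thus "v x = F" using vF[OF x(1)] by simp
    qed
    finally have "sum v A = v a + (card A - 1) * F" using AX a by simp
    moreover have "0 < v a" using a by (simp add: A_def)
    ultimately have "(card A - 1) * F < t * F" using vs by linarith
    hence "card A - 1 < t" by simp
    thus ?thesis by simp
  next
    case False
    hence "sum v A = (\<Sum>x\<in>A. F)" using vF by (intro sum.cong refl) (fastforce simp: A_def not_less)
    hence "card A * F \<le> t * F" using vs by simp
    moreover have "F > 0" if "A \<noteq> {}"
      using that vF by (fastforce simp: A_def)
    ultimately show ?thesis by (cases "A = {}") auto
  qed
  have "(\<Sum>a\<in>X. \<Sum>b\<in>X. of_bool (R a b) * real (w a) * real (w b)) \<le> phi (\<lambda>x. real (restrict w X x))"
    unfolding phi_def N_def using irr by (intro sum_mono) auto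
  also have "\<dots> \<le> phi (\<lambda>x. real (v x))" using mx[OF wWs] v(2) by simp
  also have "\<dots> = (\<Sum>a\<in>A. \<Sum>b\<in>A. N a b * real (v a) * real (v b))"
  proof -
    have "phi (\<lambda>x. real (v x)) = (\<Sum>a\<in>A. \<Sum>b\<in>X. N a b * real (v a) * real (v b))"
      unfolding phi_def using X by (intro sum.mono_neutral_right) (auto simp: A_def)
    also have "\<dots> = (\<Sum>a\<in>A. \<Sum>b\<in>A. N a b * real (v a) * real (v b))"
      using X by (intro sum.cong refl sum.mono_neutral_right) (auto simp: A_def)
    finally show ?thesis .
  qed
  also have "\<dots> \<le> (\<Sum>a\<in>A. \<Sum>b\<in>A. of_bool (R a b) * real F ^ 2 + (if b = a then 2 * real F * v a else 0))"
  proof (intro sum_mono)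
    fix a b assume ab: "a \<in> A" "b \<in> A"
    have "real (v a) \<le> real F" "real (v b) \<le> real F" using ab vF by (auto simp: A_def)
    hence "real (v a) * real (v b) \<le> real F * real F" "real (v a) * real (v a) \<le> real F * v a"
      by (intro mult_mono mult_right_mono; simp)+
    thus "N a b * real (v a) * real (v b) \<le> of_bool (R a b) * real F ^ 2 + (if b = a then 2 * real F * v a else 0)"
      using irr by (auto simp: N_def power2_eq_square)
  qed
  also have "\<dots> = real F ^ 2 * (\<Sum>a\<in>A. \<Sum>b\<in>A. of_bool (R a b)) + 2 * real F * real (sum v A)"
    using AX(2) by (simp add: sum.distrib sum_distrib_left mult.commute)
  also have "(\<Sum>a\<in>A. \<Sum>b\<in>A. of_bool (R a b)) = real (card {(a, b). a \<in> A \<and> b \<in> A \<and> R a b})"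
  proof -
    have "{(a, b). a \<in> A \<and> b \<in> A \<and> R a b} = (SIGMA a:A. A \<inter> Collect (R a))" by auto
    thus ?thesis using AX(2) by simp
  qed
  also have "real F ^ 2 * real (card {(a, b). a \<in> A \<and> b \<in> A \<and> R a b}) + 2 * real F * real (sum v A)
     \<le> real F ^ 2 * q + 2 * real F * (real t * real F)"
  proof (intro add_mono mult_left_mono)
    have "real (sum v A) \<le> real (t * F)" using vs of_nat_mono by blast
    thus "real (sum v A) \<le> real t * real F" by simp
  qed (use q[OF AX(1) \<open>card A \<le> t\<close>] in auto)
  also have "\<dots> = real F ^ 2 * (q + 2 * real t)" by (simp add: algebra_simps power2_eq_square)
  finally show ?thesis .
qed

section \<open>Independent sets in triangle-free graphs\<close>

text \<open>Pairing each subset with its complement gives mean size card X / 2.\<close>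

lemma sum_card_Pow:
  assumes "finite X"
  shows "(\<Sum>Y\<in>Pow X. real (card Y)) = real (card X) * 2 ^ card X / 2"
proof -
  have "(\<Sum>Y\<in>Pow X. real (card Y)) = (\<Sum>Y\<in>Pow X. real (card (X - Y)))"
    by (rule sum.reindex_bij_witness[of _ "\<lambda>Y. X - Y" "\<lambda>Y. X - Y"]) (auto simp: double_diff)
  hence "2 * (\<Sum>Y\<in>Pow X. real (card Y)) = (\<Sum>Y\<in>Pow X. real (card Y) + real (card (X - Y)))"
    by (simp add: sum.distrib)
  also have "\<dots> = (\<Sum>Y\<in>Pow X. real (card X))"
    using assms by (intro sum.cong refl) (auto simp: card_Diff_subset finite_subset card_mono simp flip: of_nat_add)
  also have "\<dots> = real (card X) * 2 ^ card X" using assms by (simp add: card_Pow)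
  finally show ?thesis by simp
qed

lemma half_le_ln2: "1 / 2 \<le> ln (2 :: real)"
  using ln_le_minus_one[of "1/2"] by (simp add: ln_div)

text \<open>Here \<open>x\<close> counts the neighbours of a vertex v that are free to join. An
  independent set outside the closed neighbourhood of v extends by v alone or by any of the 2^x sets
  of free neighbours; the right side is the total weight of these 2^x + 1 extensions, with v
  weighing D and each neighbour weighing 1. If 2^x \<le> sqrt D, the weight of v suffices. Otherwise
  the mean number x/2 of free neighbours exceeds log 2 D / 4.\<close>

lemma neighbourhood_average:
  fixes D :: real
  assumes "D \<ge> 1"
  shows "log 2 D / 4 * (2 ^ x + 1) \<le> D + real x * 2 ^ x / 2"
proof -
  define l where "l = log 2 D"
  have l0: "l \<ge> 0" using assms by (simp add: l_def)
  have D: "D = 2 powr l" using assms by (simp add: l_def)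
  show ?thesis
  proof (cases "real x \<le> l / 2")
    case True
    define r where "r = sqrt D"
    have r: "r \<ge> 1" "r * r = D" using assms by (auto simp: r_def)
    have "2 ^ x = 2 powr real x" by (simp add: powr_realpow)
    also have "\<dots> \<le> 2 powr (l / 2)" using True by simp
    also have "\<dots> = r" unfolding r_def D by (simp add: powr_half_sqrt_powr)
    finally have 1: "(2::real) ^ x \<le> r" .
    have "l / 2 = log 2 r" using r(1) unfolding l_def r(2)[symmetric] by (simp add: log_mult)
    also have "\<dots> \<le> r"
    proof -
      have "ln (r / 2) \<le> r / 2 - 1" using r by (intro ln_le_minus_one) auto
      hence "ln r \<le> r * (1 / 2)" using r ln_2_less_1 by (simp add: ln_div)
      also have "\<dots> \<le> r * ln 2" using r half_le_ln2 by (intro mult_left_mono) auto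
      finally show ?thesis by (simp add: log_def field_simps)
    qed
    finally have 2: "l / 2 \<le> r" .
    have "l / 4 * (2 ^ x + 1) \<le> l / 4 * (2 * r)"
      using 1 r l0 by (intro mult_left_mono) auto
    also have "\<dots> = (l / 2) * r" by simp
    also have "\<dots> \<le> r * r" using 2 r by (intro mult_right_mono) auto
    also have "\<dots> \<le> D + real x * 2 ^ x / 2" using r by simp
    finally show ?thesis by (simp add: l_def)
  next
    case False
    have "l / 4 \<le> D"
    proof -
      have "l * ln 2 \<le> D - 1"
        using ln_le_minus_one[of D] assms by (simp add: l_def log_def)
      moreover have "l * (1/2) \<le> l * ln 2" using l0 half_le_ln2 by (intro mult_left_mono) auto
      ultimately show ?thesis using l0 by linarith
    qed
    moreover have "l / 4 * 2 ^ x \<le> real x / 2 * 2 ^ x"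
      using False by (intro mult_right_mono) auto
    moreover have "l / 4 * (2 ^ x + 1) = l / 4 * 2 ^ x + l / 4" by (simp add: algebra_simps)
    ultimately show ?thesis unfolding l_def by linarith
  qed
qed

definition indep :: "('a \<Rightarrow> 'a \<Rightarrow> bool) \<Rightarrow> 'a set \<Rightarrow> bool" where
  "indep E S \<longleftrightarrow> (\<forall>u\<in>S. \<forall>v\<in>S. \<not> E u v)"

definition triangle_free_rel :: "('a \<Rightarrow> 'a \<Rightarrow> bool) \<Rightarrow> bool" where
  "triangle_free_rel E \<longleftrightarrow> (\<forall>u v. E u v \<longrightarrow> E v u) \<and> (\<forall>u. \<not> E u u) \<and>
    (\<forall>u v w. E u v \<longrightarrow> E v w \<longrightarrow> \<not> E u w)"

lemma triangle_free_relD: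
  assumes "triangle_free_rel E"
  shows "E u v \<Longrightarrow> E v u" "\<not> E u u" "E u v \<Longrightarrow> E v w \<Longrightarrow> \<not> E u w"
  using assms unfolding triangle_free_rel_def by blast+

text \<open>Independent sets are grouped by their trace \<open>H\<close> outside the closed
  neighbourhood \<open>B\<close> of v. Triangle-freeness makes the neighbourhood independent, so the
  neighbours of v without a neighbour in \<open>H\<close> join in arbitrary combinations, and each
  group is an instance of \<open>neighbourhood_average\<close>.\<close>

lemma triangle_free_indep_average:
  fixes D :: real
  assumes V: "finite V" and E: "triangle_free_rel E" and D: "D \<ge> 1" and v: "v \<in> V"
  defines "I \<equiv> {W. W \<subseteq> V \<and> indep E W}"
  shows "log 2 D / 4 * real (card I) \<le> (\<Sum>W\<in>I. D * of_bool (v \<in> W) + real (card {u\<in>W. E v u}))"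
proof -
  note sym = triangle_free_relD(1)[OF E] and irr = triangle_free_relD(2)[OF E] and tf = triangle_free_relD(3)[OF E]
  define B where "B = insert v {u\<in>V. E v u}"
  have finI: "finite I" using V by (simp add: I_def)
  have fib: "log 2 D / 4 * real (card {W\<in>I. W - B = H})
      \<le> (\<Sum>W | W \<in> I \<and> W - B = H. D * of_bool (v \<in> W) + real (card {u\<in>W. E v u}))"
    if H: "H \<in> (\<lambda>W. W - B) ` I" for H
  proof -
    have Hp: "H \<subseteq> V" "indep E H" "H \<inter> B = {}" using H by (auto simp: I_def indep_def)
    define X where "X = {u\<in>V. E v u \<and> (\<forall>h\<in>H. \<not> E u h)}"
    have finX: "finite X" using V by (simp add: X_def)
    have XB: "X \<subseteq> B" "v \<notin> X" using irr by (auto simp: X_def B_def)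
    have eq: "{W\<in>I. W - B = H} = insert (insert v H) ((\<union>) H ` Pow X)"
    proof (intro equalityI subsetI)
      fix W assume W: "W \<in> {W\<in>I. W - B = H}"
      hence HW: "H \<subseteq> W" "indep E W" "W \<subseteq> V" by (auto simp: I_def)
      show "W \<in> insert (insert v H) ((\<union>) H ` Pow X)"
      proof (cases "v \<in> W")
        case True
        hence "W = insert v H" using W HW by (auto simp: B_def indep_def)
        thus ?thesis by simp
      next
        case False
        hence "W = H \<union> (W \<inter> B)" "W \<inter> B \<subseteq> X" using W HW by (auto simp: B_def X_def indep_def)
        thus ?thesis by blast
      qed
    next
      fix W assume W: "W \<in> insert (insert v H) ((\<union>) H ` Pow X)"
      show "W \<in> {W\<in>I. W - B = H}"
      proof (cases "W = insert v H")
        case True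
        have "\<not> E v h \<and> \<not> E h v" if "h \<in> H" for h using that Hp sym by (auto simp: B_def)
        thus ?thesis using True Hp irr v by (auto simp: I_def indep_def B_def)
      next
        case False
        then obtain Y where Y: "W = H \<union> Y" "Y \<subseteq> X" using W by auto
        have "indep E Y" using Y(2) tf sym unfolding indep_def X_def by blast
        moreover have "\<not> E y h \<and> \<not> E h y" if "y \<in> Y" "h \<in> H" for y h using that Y sym by (auto simp: X_def)
        ultimately have "indep E W" using Y Hp by (auto simp: indep_def)
        thus ?thesis using Y Hp XB by (auto simp: I_def X_def)
      qed
    qed
    have inj: "inj_on ((\<union>) H) (Pow X)" using Hp(3) XB(1) by (intro inj_onI) blast
    have notin: "insert v H \<notin> (\<union>) H ` Pow X" using XB Hp(3) by (auto simp: B_def)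
    have "card {W\<in>I. W - B = H} = Suc (2 ^ card X)"
      unfolding eq using finX notin inj by (simp add: card_image card_Pow)
    moreover have "(\<Sum>W | W \<in> I \<and> W - B = H. D * of_bool (v \<in> W) + real (card {u\<in>W. E v u}))
       = D + real (card X) * 2 ^ card X / 2"
    proof -
      have "(\<Sum>W | W \<in> I \<and> W - B = H. D * of_bool (v \<in> W) + real (card {u\<in>W. E v u}))
        = (D + real (card {u\<in>insert v H. E v u})) + (\<Sum>Y\<in>Pow X. D * of_bool (v \<in> H \<union> Y) + real (card {u\<in>H \<union> Y. E v u}))"
        unfolding eq using finX notin inj by (simp add: sum.reindex)
      also have "{u\<in>insert v H. E v u} = {}" using Hp irr by (auto simp: B_def)
      also have "(\<Sum>Y\<in>Pow X. D * of_bool (v \<in> H \<union> Y) + real (card {u\<in>H \<union> Y. E v u})) = (\<Sum>Y\<in>Pow X. real (card Y))"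
      proof (intro sum.cong refl)
        fix Y assume Y: "Y \<in> Pow X"
        have "{u\<in>H \<union> Y. E v u} = Y" using Y Hp by (auto simp: B_def X_def)
        moreover have "v \<notin> H \<union> Y" using Y XB Hp by (auto simp: B_def)
        ultimately show "D * of_bool (v \<in> H \<union> Y) + real (card {u\<in>H \<union> Y. E v u}) = real (card Y)" by simp
      qed
      finally show ?thesis using sum_card_Pow[OF finX] by simp
    qed
    ultimately show ?thesis using neighbourhood_average[OF D, of "card X"] by (simp add: add.commute)
  qed
  have "log 2 D / 4 * real (card I) = (\<Sum>H\<in>(\<lambda>W. W - B) ` I. log 2 D / 4 * real (card {W\<in>I. W - B = H}))"
    using sum.image_gen[OF finI, of "\<lambda>_. log 2 D / 4" "\<lambda>W. W - B"] by (simp add: mult.commute)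
  also have "\<dots> \<le> (\<Sum>H\<in>(\<lambda>W. W - B) ` I. \<Sum>W | W \<in> I \<and> W - B = H. D * of_bool (v \<in> W) + real (card {u\<in>W. E v u}))"
    by (intro sum_mono fib)
  also have "\<dots> = (\<Sum>W\<in>I. D * of_bool (v \<in> W) + real (card {u\<in>W. E v u}))"
    by (rule sum.image_gen[OF finI, symmetric])
  finally show ?thesis .
qed

text \<open>Sum the local bound over v and exchange the sums: an independent set W collects D card W
  from its own vertices and, by the degree bound, at most D card W from the edges meeting it. So 2 D
  card W is on average at least card V log 2 D / 4, whence the 8.\<close>

lemma triangle_free_large_indep:
  fixes D :: real
  assumes V: "finite V" and E: "triangle_free_rel E" and D: "D \<ge> 1"
    and deg: "\<And>v. v \<in> V \<Longrightarrow> real (card {u\<in>V. E v u}) \<le> D"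
  shows "\<exists>S\<subseteq>V. indep E S \<and> real (card V) * log 2 D / (8 * D) \<le> real (card S)"
proof -
  note sym = triangle_free_relD(1)[OF E]
  define I where "I = {W. W \<subseteq> V \<and> indep E W}"
  have finI: "finite I" using V by (simp add: I_def)
  have "{} \<in> I" by (simp add: I_def indep_def)
  have "real (card V) * (log 2 D / 4 * real (card I))
      \<le> (\<Sum>v\<in>V. \<Sum>W\<in>I. D * of_bool (v \<in> W) + real (card {u\<in>W. E v u}))"
    using sum_mono[of V "\<lambda>_. log 2 D / 4 * real (card I)"]
      triangle_free_indep_average[OF V E D] unfolding I_def by simp
  also have "\<dots> = (\<Sum>W\<in>I. \<Sum>v\<in>V. D * of_bool (v \<in> W) + real (card {u\<in>W. E v u}))"
    by (rule sum.swap)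
  also have "\<dots> \<le> (\<Sum>W\<in>I. 2 * D * real (card W))"
  proof (rule sum_mono)
    fix W assume "W \<in> I"
    hence WV: "W \<subseteq> V" by (simp add: I_def)
    hence finW: "finite W" using V finite_subset by blast
    have "(\<Sum>v\<in>V. D * of_bool (v \<in> W)) = D * real (card W)"
      using V WV by (simp add: Int_absorb1 flip: sum_distrib_left)
    moreover have "(\<Sum>v\<in>V. real (card {u\<in>W. E v u})) \<le> D * real (card W)"
    proof -
      have "(\<Sum>v\<in>V. real (card {u\<in>W. E v u})) = (\<Sum>v\<in>V. \<Sum>u\<in>W. of_bool (E v u))"
        using finW by (simp add: Int_def)
      also have "\<dots> = (\<Sum>u\<in>W. \<Sum>v\<in>V. of_bool (E v u))" by (rule sum.swap)
      also have "\<dots> \<le> (\<Sum>u\<in>W. D)"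
      proof (rule sum_mono)
        fix u assume "u \<in> W"
        moreover have "(\<Sum>v\<in>V. of_bool (E v u)) = real (card {v\<in>V. E u v})"
          using V sym by (simp add: Int_def) (metis sym)
        ultimately show "(\<Sum>v\<in>V. of_bool (E v u)) \<le> D" using deg[of u] WV by auto
      qed
      finally show ?thesis by (simp add: mult.commute)
    qed
    ultimately show "(\<Sum>v\<in>V. D * of_bool (v \<in> W) + real (card {u\<in>W. E v u})) \<le> 2 * D * real (card W)"
      by (simp add: sum.distrib)
  qed
  finally have *: "real (card V) * (log 2 D / 4 * real (card I)) \<le> (\<Sum>W\<in>I. 2 * D * real (card W))" .
  have "\<exists>W\<in>I. real (card V) * log 2 D / (8 * D) \<le> real (card W)"
  proof (rule ccontr)
    assume "\<not> ?thesis"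
    hence "(\<Sum>W\<in>I. 2 * D * real (card W)) < (\<Sum>W\<in>I. 2 * D * (real (card V) * log 2 D / (8 * D)))"
      using finI \<open>{} \<in> I\<close> D by (intro sum_strict_mono mult_strict_left_mono) (auto simp: not_le)
    also have "\<dots> = real (card V) * (log 2 D / 4 * real (card I))" using D by simp
    finally show False using * by simp
  qed
  thus ?thesis by (auto simp: I_def)
qed

section \<open>Stars and triangles in random graphs\<close>

definition pairs :: "'a set \<Rightarrow> 'a set set" where
  "pairs X = {e. e \<subseteq> X \<and> card e = 2}"

lemma finite_pairs: "finite X \<Longrightarrow> finite (pairs X)"
  unfolding pairs_def by (rule finite_subset[of _ "Pow X"]) auto

lemma pairs_iff: "{x, y} \<in> pairs X \<longleftrightarrow> x \<in> X \<and> y \<in> X \<and> x \<noteq> y"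
  by (auto simp: pairs_def card_2_iff doubleton_eq_iff)

lemma singleton_notin_pairs: "{x} \<notin> pairs X"
  by (simp add: pairs_def)

lemma card_subsets_le: "finite X \<Longrightarrow> card {A. A \<subseteq> X \<and> card A = t} \<le> card X ^ t"
proof -
  assume "finite X"
  have "card X choose t \<le> (card X choose t) * fact t" by simp
  also have "\<dots> \<le> card X ^ t" by (rule binomial_fact_pow)
  finally show ?thesis using n_subsets[OF \<open>finite X\<close>] by simp
qed

text \<open>Stars are edge sets, so a packing of them is an edge-disjoint family. Leaves lie in
  \<open>A\<close>, while the centre is any vertex of \<open>X\<close>: it is the common neighbour
  that joins the leaves.\<close>

definition stars :: "'a set \<Rightarrow> 'a set \<Rightarrow> nat \<Rightarrow> 'a set set set" where
  "stars X A j = {(\<lambda>a. {x, a}) ` B | x B. x \<in> X \<and> B \<subseteq> A \<and> card B = j \<and> x \<notin> B}"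

lemma star_pairs:
  assumes "f \<in> stars X A j" "A \<subseteq> X"
  shows "f \<subseteq> pairs X" "card f = j"
proof -
  obtain x B where f: "f = (\<lambda>a. {x, a}) ` B" "x \<in> X" "B \<subseteq> A" "card B = j" "x \<notin> B"
    using assms by (auto simp: stars_def)
  show "f \<subseteq> pairs X" using f assms(2) by (auto simp: pairs_iff)
  have "inj_on (\<lambda>a. {x, a}) B" by (auto simp: inj_on_def doubleton_eq_iff)
  thus "card f = j" using f by (simp add: card_image)
qed

lemma card_stars:
  assumes "finite X" "A \<subseteq> X"
  shows "card (stars X A j) \<le> card X * card A ^ j"
proof -
  have finA: "finite A" using assms finite_subset by blast
  let ?S = "{B. B \<subseteq> A \<and> card B = j}"
  have fin: "finite (X \<times> ?S)" using assms finA by simp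
  have "stars X A j \<subseteq> (\<lambda>(x, B). (\<lambda>a. {x, a}) ` B) ` (X \<times> ?S)"
    by (auto simp: stars_def)
  hence "card (stars X A j) \<le> card (X \<times> ?S)"
    by (rule surj_card_le[OF fin])
  also have "\<dots> \<le> card X * card A ^ j"
    using card_subsets_le[OF finA] by (simp add: card_cartesian_product)
  finally show ?thesis .
qed

definition joined :: "'a set set \<Rightarrow> 'a \<Rightarrow> 'a \<Rightarrow> bool" where
  "joined G a b \<longleftrightarrow> a \<noteq> b \<and> (\<exists>x. {x, a} \<in> G \<and> {x, b} \<in> G)"

lemma incidences_le:
  assumes "finite X" "Z \<subseteq> pairs X"
  shows "(\<Sum>x\<in>X. card {e\<in>Z. x \<in> e}) \<le> 2 * card Z"
proof -
  have finZ: "finite Z" using assms finite_pairs finite_subset by blast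
  have "(\<Sum>x\<in>X. card {e\<in>Z. x \<in> e}) = (\<Sum>x\<in>X. \<Sum>e\<in>Z. of_bool (x \<in> e))"
    using finZ by (simp add: Int_def)
  also have "\<dots> = (\<Sum>e\<in>Z. \<Sum>x\<in>X. of_bool (x \<in> e))" by (rule sum.swap)
  also have "\<dots> \<le> (\<Sum>e\<in>Z. 2)"
  proof (rule sum_mono)
    fix e assume "e \<in> Z"
    hence "card e = 2" "X \<inter> e = e" using assms by (auto simp: pairs_def)
    thus "(\<Sum>x\<in>X. of_bool (x \<in> e)) \<le> (2::nat)" using assms(1) by simp
  qed
  finally show ?thesis by (simp add: mult.commute)
qed

text \<open>Vertices with at least three neighbours in \<open>A\<close> are so rare that all 3-stars centred at them can be
  hit by few edges; the others contribute one pair each, and are counted by the 2-stars.\<close>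

lemma card_joined_le:
  assumes X: "finite X" and G: "G \<subseteq> pairs X" and A: "A \<subseteq> X"
    and deg: "\<And>x. x \<in> X \<Longrightarrow> card {a\<in>X. {x, a} \<in> G} \<le> D"
    and Z2: "Z2 \<subseteq> pairs X" "\<And>f. f \<in> stars X A 2 \<Longrightarrow> f \<subseteq> G \<Longrightarrow> f \<inter> Z2 \<noteq> {}"
    and Z3: "Z3 \<subseteq> pairs X" "\<And>f. f \<in> stars X A 3 \<Longrightarrow> f \<subseteq> G \<Longrightarrow> f \<inter> Z3 \<noteq> {}"
  shows "card {(a, b). a \<in> A \<and> b \<in> A \<and> joined G a b} \<le> 4 * card Z2 + 6 * D * card Z3"
proof -
  define N where "N x = {a\<in>A. {x, a} \<in> G}" for x
  define z2 where "z2 x = card {e\<in>Z2. x \<in> e}" for x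
  define z3 where "z3 x = card {e\<in>Z3. x \<in> e}" for x
  have finA: "finite A" using A X finite_subset by blast
  have finN: "finite (N x)" for x using finA by (simp add: N_def)
  have xN: "x \<notin> N x" "N x \<noteq> {} \<Longrightarrow> x \<in> X" for x
    using G singleton_notin_pairs[of x X] by (auto simp: N_def pairs_iff)
  have finZ: "finite Z2" "finite Z3" using Z2(1) Z3(1) finite_pairs[OF X] finite_subset by blast+
  have loc: "card (N x) * (card (N x) - 1) \<le> 2 * z2 x + 3 * D * z3 x" if x: "x \<in> X" for x
  proof -
    have star: "(\<lambda>a. {x, a}) ` B \<in> stars X A (card B) \<and> (\<lambda>a. {x, a}) ` B \<subseteq> G" if "B \<subseteq> N x" for B
    proof -
      have "B \<subseteq> A" "x \<notin> B" using that xN(1)[of x] by (auto simp: N_def)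
      hence "(\<lambda>a. {x, a}) ` B \<in> stars X A (card B)" unfolding stars_def using x by blast
      thus ?thesis using that by (auto simp: N_def)
    qed
    have dD: "card (N x) \<le> D"
    proof -
      have "card (N x) \<le> card {a\<in>X. {x, a} \<in> G}" using A X by (intro card_mono) (auto simp: N_def)
      thus ?thesis using deg[OF x] by simp
    qed
    have 2: "z2 x \<ge> 1" if d: "card (N x) \<ge> 2"
    proof -
      obtain B where B: "B \<subseteq> N x" "card B = 2" using d by (meson obtain_subset_with_card_n)
      have "(\<lambda>a. {x, a}) ` B \<inter> Z2 \<noteq> {}" using star[OF B(1)] B(2) Z2(2) by auto
      hence "{e\<in>Z2. x \<in> e} \<noteq> {}" by auto
      thus ?thesis using finZ by (simp add: z2_def Suc_le_eq card_gt_0_iff)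
    qed
    \<comment> \<open>Dropping the neighbours reached through \<open>Z3\<close> removes at most
      \<open>z3 x\<close> of them; three remaining ones would form a 3-star in \<open>G\<close> that
      misses \<open>Z3\<close>.\<close>
    have 3: "card (N x) \<le> z3 x + 2"
    proof (rule ccontr)
      assume *: "\<not> ?thesis"
      let ?C = "{a \<in> N x. {x, a} \<in> Z3}"
      have "card ?C = card ((\<lambda>a. {x, a}) ` ?C)"
        by (intro card_image[symmetric]) (auto simp: inj_on_def doubleton_eq_iff)
      also have "\<dots> \<le> z3 x" unfolding z3_def using finZ by (intro card_mono) auto
      finally have "card (N x - ?C) \<ge> 3"
        using * finN[of x] by (subst card_Diff_subset) auto
      then obtain B where B: "B \<subseteq> N x - ?C" "card B = 3" by (meson obtain_subset_with_card_n)
      have "(\<lambda>a. {x, a}) ` B \<inter> Z3 \<noteq> {}" using star[of B] B Z3(2) by auto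
      thus False using B(1) by auto
    qed
    consider "card (N x) \<le> 1" | "card (N x) = 2" | "card (N x) \<ge> 3" by linarith
    thus ?thesis
    proof cases
      case 3
      \<comment> \<open>Now \<open>z3 x\<close> is at least 1, so \<open>z3 x + 2\<close> is at most
        \<open>3 * z3 x\<close>. The other factor is bounded by the degree.\<close>
      have "card (N x) \<le> 3 * z3 x" using 3 \<open>card (N x) \<le> z3 x + 2\<close> by linarith
      hence "card (N x) * (card (N x) - 1) \<le> (3 * z3 x) * D"
        using dD by (intro mult_mono) auto
      also have "\<dots> = 3 * D * z3 x" by (simp add: ac_simps)
      finally show ?thesis by simp
    qed (use 2 in auto)
  qed
  let ?P = "\<lambda>x. {(a, b). a \<in> N x \<and> b \<in> N x \<and> a \<noteq> b}"
  have cP: "card (?P x) = card (N x) * (card (N x) - 1)" for x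
  proof -
    have "?P x = (SIGMA a:N x. N x - {a})" by auto
    thus ?thesis using finN by simp
  qed
  have "{(a, b). a \<in> A \<and> b \<in> A \<and> joined G a b} \<subseteq> (\<Union>x\<in>X. ?P x)"
    using G by (fastforce simp: joined_def N_def pairs_iff)
  moreover have "finite (\<Union>x\<in>X. ?P x)"
  proof (rule finite_UN_I[OF X])
    fix x
    show "finite (?P x)" by (rule finite_subset[of _ "N x \<times> N x"]) (use finN in auto)
  qed
  ultimately have "card {(a, b). a \<in> A \<and> b \<in> A \<and> joined G a b} \<le> card (\<Union>x\<in>X. ?P x)"
    by (rule card_mono[rotated])
  also have "\<dots> \<le> (\<Sum>x\<in>X. card (?P x))" by (rule card_UN_le[OF X])
  also have "\<dots> \<le> (\<Sum>x\<in>X. 2 * z2 x + 3 * D * z3 x)" unfolding cP by (intro sum_mono loc)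
  also have "\<dots> = 2 * (\<Sum>x\<in>X. z2 x) + 3 * D * (\<Sum>x\<in>X. z3 x)" by (simp add: sum.distrib sum_distrib_left)
  also have "\<dots> \<le> 2 * (2 * card Z2) + 3 * D * (2 * card Z3)"
    unfolding z2_def z3_def using incidences_le[OF X] Z2(1) Z3(1) by (intro add_mono mult_left_mono) auto
  finally show ?thesis by simp
qed

section \<open>Triangles and their deletion\<close>

text \<open>The apex z ranges over \<open>X\<close>: these are the triangles whose deletion can cost
  an edge inside \<open>S\<close>.\<close>

definition triangles_at :: "'a set \<Rightarrow> 'a set \<Rightarrow> 'a set set set" where
  "triangles_at X S = {{{x, y}, {y, z}, {x, z}} | x y z.
     x \<in> S \<and> y \<in> S \<and> z \<in> X \<and> x \<noteq> y \<and> y \<noteq> z \<and> x \<noteq> z}"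

lemma triangle_pairs:
  assumes "f \<in> triangles_at X S" "S \<subseteq> X"
  shows "f \<subseteq> pairs X" "card f = 3"
proof -
  obtain x y z where f: "f = {{x, y}, {y, z}, {x, z}}" "x \<in> S" "y \<in> S" "z \<in> X" "x \<noteq> y" "y \<noteq> z" "x \<noteq> z"
    using assms by (auto simp: triangles_at_def)
  show "f \<subseteq> pairs X" using f assms(2) by (auto simp: pairs_iff)
  have "{x, y} \<noteq> {y, z}" "{x, y} \<noteq> {x, z}" "{y, z} \<noteq> {x, z}"
    using f by (auto simp: doubleton_eq_iff)
  thus "card f = 3" using f by simp
qed

lemma card_triangles_at:
  assumes "finite X" "S \<subseteq> X"
  shows "card (triangles_at X S) \<le> card S ^ 2 * card X"
proof -
  have finS: "finite S" using assms finite_subset by blast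
  have "triangles_at X S \<subseteq> (\<lambda>(x, y, z). {{x, y}, {y, z}, {x, z}}) ` (S \<times> S \<times> X)"
  proof
    fix f assume "f \<in> triangles_at X S"
    then obtain x y z where "f = {{x, y}, {y, z}, {x, z}}" "(x, y, z) \<in> S \<times> S \<times> X"
      unfolding triangles_at_def by blast
    thus "f \<in> (\<lambda>(x, y, z). {{x, y}, {y, z}, {x, z}}) ` (S \<times> S \<times> X)" by (metis (lifting) case_prod_conv image_eqI)
  qed
  hence "card (triangles_at X S) \<le> card (S \<times> S \<times> X)"
    using finS assms(1) by (intro surj_card_le) auto
  thus ?thesis by (simp add: card_cartesian_product power2_eq_square ac_simps)
qed

definition no_triangle :: "'a set set \<Rightarrow> bool" where
  "no_triangle G \<longleftrightarrow> (\<forall>x y z. {x, y} \<in> G \<longrightarrow> {y, z} \<in> G \<longrightarrow> {x, z} \<notin> G)"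

text \<open>One maximal edge-disjoint family of triangles serves all \<open>S\<close> at once: its
  members with an edge inside \<open>S\<close> form a packing of \<open>triangles_at X S\<close>, so
  there are fewer than N of them, each accounting for at most three deleted edges.\<close>

lemma triangle_deletion:
  assumes X: "finite X" and G: "G \<subseteq> pairs X"
    and T: "\<And>S. S \<subseteq> X \<Longrightarrow> card S = s \<Longrightarrow> \<not> packs (triangles_at X S) N G"
  shows "\<exists>G'\<subseteq>G. no_triangle G' \<and> (\<forall>S\<subseteq>X. card S = s \<longrightarrow> card {e\<in>G - G'. e \<subseteq> S} \<le> 3 * N)"
proof -
  let ?F = "triangles_at X X"
  let ?A = "{D. D \<subseteq> ?F \<and> disjoint D \<and> \<Union>D \<subseteq> G}"
  have finF: "finite ?F"
    using triangle_pairs(1)[of _ X X] finite_pairs[OF X]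
    by (intro finite_subset[of ?F "Pow (pairs X)"]) auto
  have "?A \<subseteq> Pow ?F" by auto
  hence "finite ?A" using finF by (meson finite_Pow_iff finite_subset)
  moreover have "{} \<in> ?A" by auto
  ultimately obtain D where D: "D \<in> ?A" "\<And>D'. D' \<in> ?A \<Longrightarrow> D \<subseteq> D' \<Longrightarrow> D = D'"
    using finite_has_maximal[of ?A] by (metis (lifting) empty_iff)
  have finD: "finite D" using D(1) finF finite_subset by blast
  have nt: "{x, z} \<notin> G - \<Union>D" if e: "{x, y} \<in> G - \<Union>D" "{y, z} \<in> G - \<Union>D" for x y z
  proof
    assume e3: "{x, z} \<in> G - \<Union>D"
    let ?f = "{{x, y}, {y, z}, {x, z}}"
    have "{x, y} \<in> pairs X" "{y, z} \<in> pairs X" "{x, z} \<in> pairs X" using e e3 G by blast+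
    hence "?f \<in> ?F" unfolding triangles_at_def pairs_iff by blast
    moreover have "?f \<inter> \<Union>D = {}" using e e3 by auto
    ultimately have "insert ?f D \<in> ?A" using D(1) e e3 by (auto simp: disjoint_def)
    hence "?f \<in> D" using D(2)[of "insert ?f D"] by auto
    thus False using e by auto
  qed
  have few: "card {e\<in>G - (G - \<Union>D). e \<subseteq> S} \<le> 3 * N" if S: "S \<subseteq> X" "card S = s" for S
  proof -
    let ?DS = "D \<inter> triangles_at X S"
    have "card ?DS < N"
    proof (rule ccontr)
      assume "\<not> ?thesis"
      then obtain D' where D': "D' \<subseteq> ?DS" "card D' = N" by (meson not_less obtain_subset_with_card_n)
      have "\<Union>D' \<subseteq> \<Union>D" "disjoint D'" "finite D'" "D' \<subseteq> triangles_at X S"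
        using D'(1) D(1) finD by (auto intro: pairwise_subset finite_subset)
      hence "packs (triangles_at X S) N G" unfolding packs_def
        using D(1) D'(2) by (intro exI[of _ D'] conjI) (assumption | blast)+
      thus False using T[OF S] by simp
    qed
    have sub: "{e\<in>G - (G - \<Union>D). e \<subseteq> S} \<subseteq> \<Union>?DS"
    proof
      fix e assume e: "e \<in> {e\<in>G - (G - \<Union>D). e \<subseteq> S}"
      then obtain f where f: "f \<in> D" "e \<in> f" by auto
      then obtain x y z where xyz: "f = {{x, y}, {y, z}, {x, z}}" "x \<in> X" "y \<in> X" "z \<in> X" "x \<noteq> y" "y \<noteq> z" "x \<noteq> z"
        using D(1) by (auto simp: triangles_at_def)
      have mem: "{{x, y}, {y, z}, {x, z}} \<in> triangles_at X S"
        if "x \<in> S" "y \<in> S" "z \<in> X" "x \<noteq> y" "y \<noteq> z" "x \<noteq> z" for x y z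
        using that unfolding triangles_at_def by blast
      \<comment> \<open>The vertices are renamed so that the deleted edge \<open>e\<close> takes the
        place of {x, y}.\<close>
      have "f \<in> triangles_at X S"
      proof -
        consider "e = {x, y}" | "e = {y, z}" | "e = {x, z}" using f(2) xyz(1) by auto
        thus ?thesis
        proof cases
          case 1 thus ?thesis using mem[of x y z] xyz e by auto
        next
          case 2
          moreover have "f = {{y, z}, {z, x}, {y, x}}" using xyz(1) by (auto simp: insert_commute)
          ultimately show ?thesis using mem[of y z x] xyz e by auto
        next
          case 3
          moreover have "f = {{x, z}, {z, y}, {x, y}}" using xyz(1) by (auto simp: insert_commute)
          ultimately show ?thesis using mem[of x z y] xyz e by auto
        qed
      qed
      thus "e \<in> \<Union>?DS" using f by auto
    qed
    have c3: "f \<in> ?DS \<Longrightarrow> card f = 3" for f using triangle_pairs(2)[of f X S] S by auto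
    have "finite (\<Union>?DS)"
      using finD c3 by (intro finite_Union) (auto intro: card_ge_0_finite)
    hence "card {e\<in>G - (G - \<Union>D). e \<subseteq> S} \<le> card (\<Union>?DS)" using sub by (rule card_mono)
    also have "\<dots> \<le> (\<Sum>f\<in>?DS. card f)" by (rule card_Union_le_sum_card)
    also have "\<dots> = (\<Sum>f\<in>?DS. 3)" by (intro sum.cong refl c3)
    also have "\<dots> \<le> 3 * N" using \<open>card ?DS < N\<close> by simp
    finally show ?thesis .
  qed
  show ?thesis
    by (rule exI[of _ "G - \<Union>D"]) (unfold no_triangle_def, intro conjI Diff_subset allI impI nt few)
qed

section \<open>Pseudorandomness of one axis graph\<close>

text \<open>The first clause limits the pairs that this graph withholds from the other colour; the
  second makes \<open>triangle_deletion\<close> cheap on s-sets.\<close>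

definition sparse_graph :: "'a set \<Rightarrow> nat \<Rightarrow> nat \<Rightarrow> nat \<Rightarrow> nat \<Rightarrow> 'a set set \<Rightarrow> bool" where
  "sparse_graph X t q s N G \<longleftrightarrow>
    (\<forall>A. A \<subseteq> X \<longrightarrow> card A \<le> t \<longrightarrow> card {(a, b). a \<in> A \<and> b \<in> A \<and> joined G a b} \<le> q) \<and>
    (\<forall>S. S \<subseteq> X \<longrightarrow> card S = s \<longrightarrow> \<not> packs (triangles_at X S) N G)"

text \<open>Degree as a packing of one-edge sets, so that \<open>prb_packs\<close> with j = 1 also
  controls degrees.\<close>

lemma high_degree_packs:
  assumes "x \<in> X" "D \<le> card {a\<in>X. {x, a} \<in> G}" "finite X" "G \<subseteq> pairs X"
  shows "packs ((\<lambda>a. {{x, a}}) ` (X - {x})) D G"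
proof -
  obtain B where B: "B \<subseteq> {a\<in>X. {x, a} \<in> G}" "card B = D"
    using assms(2) by (meson obtain_subset_with_card_n)
  have finB: "finite B" using B(1) assms(3) by (auto intro: finite_subset)
  have "x \<notin> B" using B(1) assms(4) singleton_notin_pairs[of x X] by auto
  let ?D = "(\<lambda>a. {{x, a}}) ` B"
  have "?D \<subseteq> (\<lambda>a. {{x, a}}) ` (X - {x})" using B(1) \<open>x \<notin> B\<close> by auto
  moreover have "inj_on (\<lambda>a. {{x, a}}) B" by (auto simp: inj_on_def doubleton_eq_iff)
  hence "card ?D = D" using B(2) by (simp add: card_image)
  moreover have "disjoint ?D" by (auto simp: disjoint_def)
  moreover have "\<Union>?D \<subseteq> G" using B(1) by auto
  ultimately show ?thesis unfolding packs_def using finB by (intro exI[of _ ?D]) simp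
qed

lemma stars_mono: "A \<subseteq> B \<Longrightarrow> stars X A j \<subseteq> stars X B j"
  unfolding stars_def by blast

lemma card_joined_le_of_packs:
  assumes X: "finite X" and G: "G \<subseteq> pairs X" and A: "A \<subseteq> X" "card A \<le> t" and t: "t \<le> card X"
    and deg: "\<And>x. x \<in> X \<Longrightarrow> \<not> packs ((\<lambda>a. {{x, a}}) ` (X - {x})) D G"
    and s2: "\<And>A. A \<subseteq> X \<Longrightarrow> card A = t \<Longrightarrow> \<not> packs (stars X A 2) N2 G"
    and s3: "\<And>A. A \<subseteq> X \<Longrightarrow> card A = t \<Longrightarrow> \<not> packs (stars X A 3) N3 G"
  shows "card {(a, b). a \<in> A \<and> b \<in> A \<and> joined G a b} \<le> 8 * N2 + 18 * D * N3"
proof -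
  \<comment> \<open>The packing bounds are available for sets of exactly t vertices, so
    \<open>A\<close> is first enlarged.\<close>
  have "\<exists>A'. A \<subseteq> A' \<and> A' \<subseteq> X \<and> card A' = t"
  proof -
    have finA: "finite A" using A X finite_subset by blast
    have "t - card A \<le> card (X - A)" using t A finA by (subst card_Diff_subset) auto
    then obtain B where B: "B \<subseteq> X - A" "card B = t - card A" by (meson obtain_subset_with_card_n)
    have "finite B" using B(1) X finite_subset by blast
    hence "card (A \<union> B) = t" using B A finA by (subst card_Un_disjoint) auto
    thus ?thesis using B A by (intro exI[of _ "A \<union> B"]) auto
  qed
  then obtain A' where A': "A \<subseteq> A'" "A' \<subseteq> X" "card A' = t" by blast
  have finP: "finite (pairs X)" by (rule finite_pairs[OF X])
  have hit: "\<exists>Z. Z \<subseteq> pairs X \<and> card Z \<le> j * N \<and> (\<forall>f\<in>stars X A j. f \<subseteq> G \<longrightarrow> f \<inter> Z \<noteq> {})"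
    if np: "\<not> packs (stars X A' j) N G" "j > 0" for j N
  proof -
    have props: "finite f \<and> card f = j \<and> f \<noteq> {}" if "f \<in> stars X A' j" for f
    proof -
      have "card f = j" using star_pairs[OF that A'(2)] by simp
      thus ?thesis using np(2) card_gt_0_iff[of f] by auto
    qed
    have fin: "finite (stars X A' j)"
    proof (rule finite_subset)
      show "stars X A' j \<subseteq> Pow (pairs X)" using star_pairs(1)[of _ X A' j] A'(2) by blast
    qed (simp add: finP)
    from not_packs_hitting[OF np(1) fin props]
    obtain Z where "Z \<subseteq> G" "card Z \<le> j * N" "\<forall>f\<in>stars X A' j. f \<subseteq> G \<longrightarrow> f \<inter> Z \<noteq> {}"
      by blast
    thus ?thesis using G stars_mono[OF A'(1), of X j] by (intro exI[of _ Z] conjI) auto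
  qed
  obtain Z2 where Z2: "Z2 \<subseteq> pairs X" "card Z2 \<le> 2 * N2" "\<forall>f\<in>stars X A 2. f \<subseteq> G \<longrightarrow> f \<inter> Z2 \<noteq> {}"
    using hit[OF s2[OF A'(2,3)]] by auto
  obtain Z3 where Z3: "Z3 \<subseteq> pairs X" "card Z3 \<le> 3 * N3" "\<forall>f\<in>stars X A 3. f \<subseteq> G \<longrightarrow> f \<inter> Z3 \<noteq> {}"
    using hit[OF s3[OF A'(2,3)]] by auto
  have "card {a\<in>X. {x, a} \<in> G} \<le> D" if "x \<in> X" for x
    using high_degree_packs[OF that _ X G, of D] deg[OF that] by linarith
  hence "card {(a, b). a \<in> A \<and> b \<in> A \<and> joined G a b} \<le> 4 * card Z2 + 6 * D * card Z3"
    using Z2 Z3 by (intro card_joined_le[OF X G A(1)]) auto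
  also have "\<dots> \<le> 4 * (2 * N2) + 6 * D * (3 * N3)"
    using Z2(2) Z3(2) by (intro add_mono mult_left_mono) auto
  finally show ?thesis by simp
qed

text \<open>One term per cause of failure: a large degree, many disjoint 2-stars on a t-set, many
  disjoint 3-stars on a t-set, many disjoint triangles over an s-set. \<open>q1\<close> to
  \<open>q4\<close> bound the ratios of e times the expectation to the threshold.\<close>

lemma prb_not_sparse:
  fixes p q1 q2 q3 q4 :: real
  assumes X: "finite X" "card X = m" "t \<le> m" and p: "0 \<le> p" "p \<le> 1"
    and pos: "D > 0" "N2 > 0" "N3 > 0" "N > 0" and q0: "0 \<le> q1" "0 \<le> q2" "0 \<le> q3" "0 \<le> q4"
    and q1: "exp 1 * real m * p \<le> q1 * real D"
    and q2: "exp 1 * (real m * real t ^ 2) * p ^ 2 \<le> q2 * real N2"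
    and q3: "exp 1 * (real m * real t ^ 3) * p ^ 3 \<le> q3 * real N3"
    and q4: "exp 1 * (real s ^ 2 * real m) * p ^ 3 \<le> q4 * real N"
  shows "prb (pairs X) p (\<lambda>G. \<not> sparse_graph X t (8 * N2 + 18 * D * N3) s N G)
    \<le> real m * q1 ^ D + real m ^ t * q2 ^ N2 + real m ^ t * q3 ^ N3 + real m ^ s * q4 ^ N"
proof -
  interpret prb_space "pairs X" p using finite_pairs[OF X(1)] p by unfold_locales
  let ?At = "{A. A \<subseteq> X \<and> card A = t}" and ?As = "{A. A \<subseteq> X \<and> card A = s}"
  let ?E1 = "\<lambda>G. \<exists>x\<in>X. packs ((\<lambda>a. {{x, a}}) ` (X - {x})) D G"
  let ?E2 = "\<lambda>G. \<exists>A\<in>?At. packs (stars X A 2) N2 G"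
  let ?E3 = "\<lambda>G. \<exists>A\<in>?At. packs (stars X A 3) N3 G"
  let ?E4 = "\<lambda>G. \<exists>S\<in>?As. packs (triangles_at X S) N G"
  have fin: "finite ?At" "finite ?As" using X(1) by simp_all
  have cnt: "real (card {A. A \<subseteq> X \<and> card A = j}) \<le> real m ^ j" for j
    using card_subsets_le[OF X(1), of j] X(2) by (simp flip: of_nat_power)
  have E1: "prb (pairs X) p ?E1 \<le> real m * q1 ^ D"
  proof (rule prb_Bex_le[OF X(1)])
    fix x assume x: "x \<in> X"
    show "prb (pairs X) p (packs ((\<lambda>a. {{x, a}}) ` (X - {x})) D) \<le> q1 ^ D"
    proof (rule prb_packs[where j = 1 and M = "real m"])
      show "real (card ((\<lambda>a. {{x, a}}) ` (X - {x}))) \<le> real m"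
        using card_image_le[of "X - {x}" "\<lambda>a. {{x, a}}"] X x by simp
    qed (use x q1 pos in \<open>auto simp: pairs_iff\<close>)
  qed (use X q0 in auto)
  have E2: "prb (pairs X) p ?E2 \<le> real m ^ t * q2 ^ N2"
  proof (rule prb_Bex_le[OF fin(1)])
    fix A assume A: "A \<in> ?At"
    show "prb (pairs X) p (packs (stars X A 2) N2) \<le> q2 ^ N2"
    proof (rule prb_packs[where j = 2 and M = "real m * real t ^ 2"])
      show "real (card (stars X A 2)) \<le> real m * real t ^ 2"
        using card_stars[OF X(1), of A 2] A X(2) by (simp flip: of_nat_power of_nat_mult)
    qed (use star_pairs[of _ X A 2] A q2 pos in auto)
  qed (use cnt q0 in auto)
  have E3: "prb (pairs X) p ?E3 \<le> real m ^ t * q3 ^ N3"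
  proof (rule prb_Bex_le[OF fin(1)])
    fix A assume A: "A \<in> ?At"
    show "prb (pairs X) p (packs (stars X A 3) N3) \<le> q3 ^ N3"
    proof (rule prb_packs[where j = 3 and M = "real m * real t ^ 3"])
      show "real (card (stars X A 3)) \<le> real m * real t ^ 3"
        using card_stars[OF X(1), of A 3] A X(2) by (simp flip: of_nat_power of_nat_mult)
    qed (use star_pairs[of _ X A 3] A q3 pos in auto)
  qed (use cnt q0 in auto)
  have E4: "prb (pairs X) p ?E4 \<le> real m ^ s * q4 ^ N"
  proof (rule prb_Bex_le[OF fin(2)])
    fix S assume S: "S \<in> ?As"
    show "prb (pairs X) p (packs (triangles_at X S) N) \<le> q4 ^ N"
    proof (rule prb_packs[where j = 3 and M = "real s ^ 2 * real m"])
      show "real (card (triangles_at X S)) \<le> real s ^ 2 * real m"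
        using card_triangles_at[OF X(1), of S] S X(2) by (simp flip: of_nat_power of_nat_mult)
    qed (use triangle_pairs[of _ X S] S q4 pos in auto)
  qed (use cnt q0 in auto)
  have "prb (pairs X) p (\<lambda>G. \<not> sparse_graph X t (8 * N2 + 18 * D * N3) s N G)
     \<le> prb (pairs X) p (\<lambda>G. ((?E1 G \<or> ?E2 G) \<or> ?E3 G) \<or> ?E4 G)"
  proof (rule prb_mono)
    fix G assume G: "G \<subseteq> pairs X" and bad: "\<not> sparse_graph X t (8 * N2 + 18 * D * N3) s N G"
    show "((?E1 G \<or> ?E2 G) \<or> ?E3 G) \<or> ?E4 G"
    proof (rule ccontr)
      assume *: "\<not> (((?E1 G \<or> ?E2 G) \<or> ?E3 G) \<or> ?E4 G)"
      have "card {(a, b). a \<in> A \<and> b \<in> A \<and> joined G a b} \<le> 8 * N2 + 18 * D * N3"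
        if "A \<subseteq> X" "card A \<le> t" for A
        using * X by (intro card_joined_le_of_packs[OF X(1) G that]) auto
      thus False using bad * unfolding sparse_graph_def by blast
    qed
  qed
  also have "\<dots> \<le> prb (pairs X) p ?E1 + prb (pairs X) p ?E2 + prb (pairs X) p ?E3 + prb (pairs X) p ?E4"
    by (intro order_trans[OF prb_disj] add_mono order_refl)
  also have "\<dots> \<le> real m * q1 ^ D + real m ^ t * q2 ^ N2 + real m ^ t * q3 ^ N3 + real m ^ s * q4 ^ N"
    by (intro add_mono E1 E2 E3 E4)
  finally show ?thesis .
qed

section \<open>Pairs surviving in one colour\<close>

text \<open>Projections by \<open>g\<close> of the pairs that \<open>G\<close> leaves open to the
  other colour; such a pair becomes an edge when its projection is an edge of the other axis graph
  after deletion.\<close>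

definition allowed :: "('b \<Rightarrow> 'a) \<Rightarrow> ('b \<Rightarrow> 'a) \<Rightarrow> 'a set set \<Rightarrow> 'b set \<Rightarrow> 'a set set" where
  "allowed f g G I = {{g u, g w} | u w. u \<in> I \<and> w \<in> I \<and> f u \<noteq> f w \<and> \<not> joined G (f u) (f w)}"

lemma card_doubleton_le: "card {a, b} \<le> 2"
  by (cases "a = b") simp_all

lemma allowed_subset:
  assumes "g ` I \<subseteq> X" "inj_on g I"
  shows "allowed f g G I \<subseteq> pairs X"
proof
  fix e assume "e \<in> allowed f g G I"
  then obtain u w where uw: "e = {g u, g w}" "u \<in> I" "w \<in> I" "u \<noteq> w"
    unfolding allowed_def by blast
  moreover have "g u \<noteq> g w" using inj_onD[OF assms(2) _ uw(2,3)] uw(4) by blast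
  ultimately show "e \<in> pairs X" using assms(1) by (auto simp: pairs_iff)
qed

text \<open>Brings a count of pairs of points into the form of \<open>weighted_pairs_le\<close>,
  with the fibre sizes of \<open>f\<close> as weights.\<close>

lemma card_pairs_in_fibres:
  assumes I: "finite I" and X: "finite X" "f ` I \<subseteq> X"
  shows "real (card {(u, w). u \<in> I \<and> w \<in> I \<and> R (f u) (f w)})
    = (\<Sum>a\<in>X. \<Sum>b\<in>X. of_bool (R a b) * real (card {u\<in>I. f u = a}) * real (card {u\<in>I. f u = b}))"
proof -
  have grp: "(\<Sum>u\<in>I. h (f u)) = (\<Sum>a\<in>X. real (card {u\<in>I. f u = a}) * h a)" for h :: "_ \<Rightarrow> real"
  proof -
    have "(\<Sum>u\<in>I. h (f u)) = (\<Sum>a\<in>X. \<Sum>u | u \<in> I \<and> f u = a. h (f u))"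
      by (rule sum.group[OF I X, symmetric])
    also have "\<dots> = (\<Sum>a\<in>X. real (card {u\<in>I. f u = a}) * h a)"
      by (intro sum.cong refl) simp
    finally show ?thesis .
  qed
  have "{(u, w). u \<in> I \<and> w \<in> I \<and> R (f u) (f w)} = (SIGMA u:I. I \<inter> {w. R (f u) (f w)})" by auto
  hence "real (card {(u, w). u \<in> I \<and> w \<in> I \<and> R (f u) (f w)}) = (\<Sum>u\<in>I. \<Sum>w\<in>I. of_bool (R (f u) (f w)))"
    using I by simp
  also have "\<dots> = (\<Sum>a\<in>X. real (card {u\<in>I. f u = a}) * (\<Sum>w\<in>I. of_bool (R a (f w))))"
    by (rule grp)
  also have "\<dots> = (\<Sum>a\<in>X. real (card {u\<in>I. f u = a}) * (\<Sum>b\<in>X. real (card {u\<in>I. f u = b}) * of_bool (R a b)))"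
    by (subst grp) simp
  also have "\<dots> = (\<Sum>a\<in>X. \<Sum>b\<in>X. of_bool (R a b) * real (card {u\<in>I. f u = a}) * real (card {u\<in>I. f u = b}))"
    by (simp add: sum_distrib_left mult_ac)
  finally show ?thesis .
qed

text \<open>Of the s^2 ordered pairs at most s F have equal \<open>f\<close>-coordinates, and by
  \<open>weighted_pairs_le\<close> at most F^2 (q + 2 t) have joined ones. \<open>num\<close> leaves
  s^2/2 ordered pairs, and as \<open>g\<close> is injective on \<open>I\<close>, each projected edge
  comes from at most two of them.\<close>

lemma card_allowed:
  assumes X: "finite X" "f ` I \<subseteq> X" and I: "finite I" "card I = s" and inj: "inj_on g I"
    and fib: "\<And>x. card {u\<in>I. f u = x} \<le> F" and sF: "s \<le> t * F"
    and Q: "\<And>A. A \<subseteq> X \<Longrightarrow> card A \<le> t \<Longrightarrow> card {(a, b). a \<in> A \<and> b \<in> A \<and> joined G a b} \<le> q"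
    and num: "real s * real F + real F ^ 2 * (real q + 2 * real t) \<le> real s ^ 2 / 2"
  shows "real s ^ 2 / 4 \<le> real (card (allowed f g G I))"
proof -
  define OP where "OP = {(u, w). u \<in> I \<and> w \<in> I \<and> f u \<noteq> f w \<and> \<not> joined G (f u) (f w)}"
  define SP where "SP = (SIGMA u:I. {w\<in>I. f w = f u})"
  define JP where "JP = {(u, w). u \<in> I \<and> w \<in> I \<and> joined G (f u) (f w)}"
  have fins: "finite OP" "finite SP" "finite JP"
    by (rule finite_subset[of _ "I \<times> I"]; use I in \<open>auto simp: OP_def SP_def JP_def\<close>)+
  have "I \<times> I \<subseteq> OP \<union> SP \<union> JP" by (auto simp: OP_def SP_def JP_def)
  hence "card (I \<times> I) \<le> card (OP \<union> SP \<union> JP)" using fins by (intro card_mono) auto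
  also have "\<dots> \<le> card OP + card SP + card JP"
    by (intro order_trans[OF card_Un_le] add_mono order_refl)
  finally have "card I * card I \<le> card OP + card SP + card JP" by (simp add: card_cartesian_product)
  hence "real (card I * card I) \<le> real (card OP + card SP + card JP)" by (rule of_nat_mono)
  hence 1: "real s ^ 2 \<le> real (card OP) + real (card SP) + real (card JP)"
    using I by (simp add: power2_eq_square)
  have "card SP = (\<Sum>u\<in>I. card {w\<in>I. f w = f u})" unfolding SP_def using I by simp
  also have "\<dots> \<le> (\<Sum>u\<in>I. F)" by (intro sum_mono fib)
  finally have "card SP \<le> s * F" using I by simp
  hence 2: "real (card SP) \<le> real s * real F" by (metis of_nat_le_iff of_nat_mult)
  have 3: "real (card JP) \<le> real F ^ 2 * (real q + 2 * real t)"
  proof -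
    have "real (card JP) = (\<Sum>a\<in>X. \<Sum>b\<in>X. of_bool (joined G a b) * real (card {u\<in>I. f u = a}) * real (card {u\<in>I. f u = b}))"
      unfolding JP_def by (rule card_pairs_in_fibres[OF I(1) X])
    also have "\<dots> \<le> real F ^ 2 * (real q + 2 * real t)"
    proof (rule weighted_pairs_le[OF X(1)])
      have "(\<Sum>x\<in>X. card {u\<in>I. f u = x}) = s"
        using sum.group[OF I(1) X, of "\<lambda>_. 1::nat"] I by simp
      thus "(\<Sum>x\<in>X. card {u\<in>I. f u = x}) \<le> t * F" using sF by simp
    qed (use fib Q in \<open>auto simp: joined_def\<close>)
    finally show ?thesis .
  qed
  have 4: "card OP \<le> card (allowed f g G I) * 2"
  proof -
    let ?fib = "\<lambda>e. {(u, w). u \<in> I \<and> w \<in> I \<and> {g u, g w} = e}"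
    have fin: "finite (allowed f g G I)"
    proof (rule finite_subset)
      show "allowed f g G I \<subseteq> (\<lambda>x. {g (fst x), g (snd x)}) ` (I \<times> I)" by (force simp: allowed_def)
    qed (use I in simp)
    have "OP \<subseteq> (\<Union>e\<in>allowed f g G I. ?fib e)"
    proof (rule subrelI)
      fix u w assume "(u, w) \<in> OP"
      hence uw: "u \<in> I" "w \<in> I" "f u \<noteq> f w" "\<not> joined G (f u) (f w)" by (auto simp: OP_def)
      hence "{g u, g w} \<in> allowed f g G I" unfolding allowed_def by blast
      thus "(u, w) \<in> (\<Union>e\<in>allowed f g G I. ?fib e)" by (rule UN_I) (use uw in simp)
    qed
    moreover have fe: "finite (?fib e)" for e by (rule finite_subset[of _ "I \<times> I"]) (use I in auto)
    ultimately have "card OP \<le> card (\<Union>e\<in>allowed f g G I. ?fib e)"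
      using fin by (intro card_mono) auto
    also have "\<dots> \<le> (\<Sum>e\<in>allowed f g G I. card (?fib e))" by (rule card_UN_le[OF fin])
    also have "\<dots> \<le> (\<Sum>e\<in>allowed f g G I. 2)"
    proof (rule sum_mono)
      fix e assume "e \<in> allowed f g G I"
      then obtain u0 w0 where uw: "e = {g u0, g w0}" "u0 \<in> I" "w0 \<in> I" unfolding allowed_def by blast
      have "?fib e \<subseteq> {(u0, w0), (w0, u0)}"
      proof (rule subrelI)
        fix u w assume "(u, w) \<in> ?fib e"
        hence "u \<in> I" "w \<in> I" "g u = g u0 \<and> g w = g w0 \<or> g u = g w0 \<and> g w = g u0"
          using uw(1) by (auto simp: doubleton_eq_iff)
        hence "u = u0 \<and> w = w0 \<or> u = w0 \<and> w = u0"
          using uw(2,3) inj by (meson inj_onD)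
        thus "(u, w) \<in> {(u0, w0), (w0, u0)}" by auto
      qed
      hence "card (?fib e) \<le> card {(u0, w0), (w0, u0)}" by (rule card_mono[rotated]) simp
      moreover have "card {(u0, w0), (w0, u0)} \<le> 2" by (rule card_doubleton_le)
      ultimately show "card (?fib e) \<le> 2" by (rule order_trans)
    qed
    finally show ?thesis by simp
  qed
  have "real (card OP) \<le> real (card (allowed f g G I) * 2)" using 4 by (rule of_nat_mono)
  thus ?thesis using 1 2 3 num by simp
qed

text \<open>In the application \<open>G\<close> is fixed and \<open>H\<close> is random. On a set where \<open>g\<close> is injective, the allowed
  pairs are then independent random edges.\<close>

definition few_edges :: "(nat \<Rightarrow> 'a) \<Rightarrow> (nat \<Rightarrow> 'a) \<Rightarrow> nat \<Rightarrow> nat \<Rightarrow> real \<Rightarrow> 'a set set \<Rightarrow> 'a set set \<Rightarrow> bool" where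
  "few_edges f g n s c G H \<longleftrightarrow>
    (\<exists>I\<subseteq>{..<n}. card I = s \<and> inj_on g I \<and> real (card (H \<inter> allowed f g G I)) \<le> c)"

text \<open>For one \<open>I\<close> at least s^2/4 independent random edges are allowed, so a
  quarter of their mean is at least p s^2/16 and \<open>prb_few\<close> applies. The factor n^s
  counts the sets \<open>I\<close>.\<close>

lemma prb_few_edges:
  assumes X: "finite X" "f ` {..<n} \<subseteq> X" "g ` {..<n} \<subseteq> X" and p: "0 \<le> p" "p \<le> 1"
    and fib: "\<And>x. card {u. u < n \<and> f u = x} \<le> F" and sF: "s \<le> t * F"
    and Q: "\<And>A. A \<subseteq> X \<Longrightarrow> card A \<le> t \<Longrightarrow> card {(a, b). a \<in> A \<and> b \<in> A \<and> joined G a b} \<le> q"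
    and num: "real s * real F + real F ^ 2 * (real q + 2 * real t) \<le> real s ^ 2 / 2"
  shows "prb (pairs X) p (few_edges f g n s (p * real s ^ 2 / 16) G) \<le> real n ^ s * exp (- p * real s ^ 2 / 16)"
proof -
  interpret prb_space "pairs X" p using finite_pairs[OF X(1)] p by unfold_locales
  let ?Is = "{I. I \<subseteq> {..<n} \<and> card I = s \<and> inj_on g I}"
  have fin: "finite ?Is" by (rule finite_subset[of _ "Pow {..<n}"]) auto
  have "prb (pairs X) p (few_edges f g n s (p * real s ^ 2 / 16) G)
     \<le> prb (pairs X) p (\<lambda>H. \<exists>I\<in>?Is. real (card (H \<inter> allowed f g G I)) \<le> p * real s ^ 2 / 16)"
    by (rule prb_mono) (auto simp: few_edges_def)
  also have "\<dots> \<le> real n ^ s * exp (- p * real s ^ 2 / 16)"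
  proof (rule prb_Bex_le[OF fin])
    fix I assume I: "I \<in> ?Is"
    have "I \<subseteq> {..<n}" using I by simp
    hence fI: "f ` I \<subseteq> X" "g ` I \<subseteq> X" "finite I"
      using X(2,3) by (auto simp: image_subset_iff intro: finite_subset)
    have sub: "allowed f g G I \<subseteq> pairs X" using fI I by (intro allowed_subset) auto
    have "real s ^ 2 / 4 \<le> real (card (allowed f g G I))"
    proof (rule card_allowed[OF X(1) fI(1) fI(3) _ _ _ sF Q num])
      fix x
      have "card {u\<in>I. f u = x} \<le> card {u. u < n \<and> f u = x}" using I by (intro card_mono) auto
      thus "card {u\<in>I. f u = x} \<le> F" using fib[of x] by simp
    qed (use I in auto)
    hence le: "p * real s ^ 2 / 16 \<le> p * real (card (allowed f g G I)) / 4"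
      using mult_left_mono[OF _ p(1), of "real s ^ 2 / 4"] by simp
    have "prb (pairs X) p (\<lambda>H. real (card (H \<inter> allowed f g G I)) \<le> p * real s ^ 2 / 16)
      \<le> prb (pairs X) p (\<lambda>H. real (card (H \<inter> allowed f g G I)) \<le> p * real (card (allowed f g G I)) / 4)"
      using le by (intro prb_mono) linarith
    also have "\<dots> \<le> exp (- p * real (card (allowed f g G I)) / 4)" by (rule prb_few[OF sub])
    also have "\<dots> \<le> exp (- p * real s ^ 2 / 16)" using le by simp
    finally show "prb (pairs X) p (\<lambda>H. real (card (H \<inter> allowed f g G I)) \<le> p * real s ^ 2 / 16)
       \<le> exp (- p * real s ^ 2 / 16)" .
  next
    have "card ?Is \<le> card {I. I \<subseteq> {..<n} \<and> card I = s}" by (intro card_mono) auto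
    also have "\<dots> \<le> n ^ s" using card_subsets_le[of "{..<n}" s] by simp
    finally show "real (card ?Is) \<le> real n ^ s" by (simp flip: of_nat_power)
  qed auto
  finally show ?thesis .
qed

section \<open>Two independent random graphs\<close>

text \<open>The two bad events are exposed in opposite orders: \<open>B G H\<close> with G fixed and
  H random, \<open>B' H G\<close> with H fixed and G random, each time only if the fixed graph
  satisfies \<open>S\<close>. The failures add up to 2 a + 2 b.\<close>

lemma exists_pair:
  assumes E: "finite E" and p: "0 \<le> p" "p \<le> 1"
    and S: "prb E p (\<lambda>G. \<not> S G) \<le> a"
    and B: "\<And>G. G \<subseteq> E \<Longrightarrow> S G \<Longrightarrow> prb E p (B G) \<le> b" "\<And>G. G \<subseteq> E \<Longrightarrow> S G \<Longrightarrow> prb E p (B' G) \<le> b"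
    and ab: "2 * a + 2 * b < 1" "0 \<le> b"
  shows "\<exists>G\<subseteq>E. \<exists>H\<subseteq>E. S G \<and> S H \<and> \<not> B G H \<and> \<not> B' H G"
proof -
  interpret prb_space E p using E p by unfold_locales
  define w where "w G = p ^ card G * (1 - p) ^ card (E - G)" for G
  have w0: "0 \<le> w G" for G using p by (simp add: w_def)
  have prb: "prb E p Q = (\<Sum>G\<in>Pow E. w G * of_bool (Q G))" for Q
  proof -
    have "prb E p Q = (\<Sum>G\<in>Pow E. if Q G then w G else 0)"
      unfolding prb_def w_def using E by (intro sum.mono_neutral_cong_left) auto
    thus ?thesis by (auto intro: sum.cong)
  qed
  have tot: "(\<Sum>G\<in>Pow E. w G) = 1" using prb_True unfolding prb by simp
  show ?thesis
  proof (rule ccontr)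
    assume not: "\<not> ?thesis"
    have no: "\<not> S G \<or> \<not> S H \<or> (S G \<and> B G H) \<or> (S H \<and> B' H G)" if "G \<in> Pow E" "H \<in> Pow E" for G H
      using that not by blast
    have "1 = (\<Sum>G\<in>Pow E. \<Sum>H\<in>Pow E. w G * w H)"
      using tot by (simp flip: sum_distrib_left sum_distrib_right)
    also have "\<dots> \<le> (\<Sum>G\<in>Pow E. \<Sum>H\<in>Pow E. (w G * of_bool (\<not> S G)) * w H + w G * (w H * of_bool (\<not> S H))
       + (w G * of_bool (S G)) * (w H * of_bool (B G H)) + (w G * of_bool (B' H G)) * (w H * of_bool (S H)))"
    proof (intro sum_mono)
      fix G H assume "G \<in> Pow E" "H \<in> Pow E"
      note no[OF this]
      moreover have "0 \<le> w G * w H" using w0 by simp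
      ultimately show "w G * w H \<le> (w G * of_bool (\<not> S G)) * w H + w G * (w H * of_bool (\<not> S H))
       + (w G * of_bool (S G)) * (w H * of_bool (B G H)) + (w G * of_bool (B' H G)) * (w H * of_bool (S H))"
        by (auto simp: of_bool_def)
    qed
    \<comment> \<open>In the last sum H becomes the outer variable, because \<open>B'\<close> is
      bounded for fixed H.\<close>
    also have "\<dots> = (\<Sum>G\<in>Pow E. \<Sum>H\<in>Pow E. (w G * of_bool (\<not> S G)) * w H)
       + (\<Sum>G\<in>Pow E. \<Sum>H\<in>Pow E. w G * (w H * of_bool (\<not> S H)))
       + (\<Sum>G\<in>Pow E. \<Sum>H\<in>Pow E. (w G * of_bool (S G)) * (w H * of_bool (B G H)))
       + (\<Sum>H\<in>Pow E. \<Sum>G\<in>Pow E. (w G * of_bool (B' H G)) * (w H * of_bool (S H)))"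
      unfolding sum.distrib by (subst (4) sum.swap) simp
    also have "\<dots> = prb E p (\<lambda>G. \<not> S G) + prb E p (\<lambda>G. \<not> S G)
       + (\<Sum>G\<in>Pow E. (w G * of_bool (S G)) * prb E p (B G))
       + (\<Sum>H\<in>Pow E. prb E p (B' H) * (w H * of_bool (S H)))"
      using tot unfolding prb by (simp add: sum_distrib_left[symmetric] sum_distrib_right[symmetric] del: sum_of_bool_mult_eq sum_mult_of_bool_eq)
    also have "(\<Sum>G\<in>Pow E. (w G * of_bool (S G)) * prb E p (B G)) \<le> (\<Sum>G\<in>Pow E. w G * b)"
    proof (rule sum_mono)
      fix G assume "G \<in> Pow E"
      thus "(w G * of_bool (S G)) * prb E p (B G) \<le> w G * b"
        using B(1)[of G] w0[of G] ab(2) by (cases "S G") (auto intro: mult_left_mono)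
    qed
    also have "(\<Sum>H\<in>Pow E. prb E p (B' H) * (w H * of_bool (S H))) \<le> (\<Sum>H\<in>Pow E. w H * b)"
    proof (rule sum_mono)
      fix G assume "G \<in> Pow E"
      thus "prb E p (B' G) * (w G * of_bool (S G)) \<le> w G * b"
        using B(2)[of G] w0[of G] ab(2) by (cases "S G") (auto intro: mult_left_mono simp: mult.commute[of _ "w G"])
    qed
    also have "(\<Sum>G\<in>Pow E. w G * b) = b" using tot by (simp flip: sum_distrib_right)
    finally show False using S ab(1) by simp
  qed
qed

section \<open>The two-coloured graph\<close>

definition coloured :: "(nat \<Rightarrow> 'a) \<Rightarrow> (nat \<Rightarrow> 'a) \<Rightarrow> nat \<Rightarrow> 'a set set \<Rightarrow> 'a set set \<Rightarrow> nat set set" where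
  "coloured f g n G G' = {{u, w} | u w. u < n \<and> w < n \<and> f u \<noteq> f w \<and> \<not> joined G (f u) (f w) \<and> {g u, g w} \<in> G'}"

lemma joined_sym: "joined G a b \<longleftrightarrow> joined G b a"
  by (auto simp: joined_def)

lemma coloured_iff:
  "{u, w} \<in> coloured f g n G G' \<longleftrightarrow>
    u < n \<and> w < n \<and> f u \<noteq> f w \<and> \<not> joined G (f u) (f w) \<and> {g u, g w} \<in> G'"
proof -
  define P where "P u w \<longleftrightarrow> u < n \<and> w < n \<and> f u \<noteq> f w \<and> \<not> joined G (f u) (f w) \<and> {g u, g w} \<in> G'" for u w
  have "P u w \<longleftrightarrow> P w u"
    unfolding P_def insert_commute[of "g w"] using joined_sym[of G "f u" "f w"] by auto
  moreover have "{u, w} \<in> coloured f g n G G' \<longleftrightarrow> P u w \<or> P w u"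
    unfolding coloured_def P_def[symmetric] by (auto simp: doubleton_eq_iff)
  ultimately show ?thesis unfolding P_def by blast
qed

lemma coloured_pairs: "coloured f g n G G' \<subseteq> pairs {..<n}"
  by (auto simp: coloured_def pairs_iff)

text \<open>An allowed edge of \<open>G2\<close> lifts along \<open>g\<close> to a coloured edge
  unless triangle deletion removed it, and projecting the lifts cannot increase their
  number.\<close>

lemma card_coloured:
  assumes G': "G' \<subseteq> G2" and fin: "finite G2" and I: "I \<subseteq> {..<n}"
    and del: "card {e\<in>G2 - G'. e \<subseteq> g ` I} \<le> 3 * N"
    and c: "c \<le> real (card (G2 \<inter> allowed f g G I))"
  shows "c - 3 * real N \<le> real (card {e\<in>coloured f g n G G'. e \<subseteq> I})"
proof -
  let ?H = "{e\<in>coloured f g n G G'. e \<subseteq> I}"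
  have finH: "finite ?H"
    by (rule finite_subset[OF _ finite_pairs[of "{..<n}"]]) (use coloured_pairs[of f g n G G'] in auto)
  have "G2 \<inter> allowed f g G I \<subseteq> (`) g ` ?H \<union> {e\<in>G2 - G'. e \<subseteq> g ` I}"
  proof
    fix e assume e: "e \<in> G2 \<inter> allowed f g G I"
    then obtain u w where uw: "e = {g u, g w}" "u \<in> I" "w \<in> I" "f u \<noteq> f w" "\<not> joined G (f u) (f w)"
      unfolding allowed_def by blast
    show "e \<in> (`) g ` ?H \<union> {e\<in>G2 - G'. e \<subseteq> g ` I}"
    proof (cases "e \<in> G'")
      case True
      hence "{u, w} \<in> ?H" using uw I by (auto simp: coloured_iff)
      moreover have "e = g ` {u, w}" using uw by simp
      ultimately show ?thesis by blast
    next
      case False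
      thus ?thesis using e uw by auto
    qed
  qed
  hence "card (G2 \<inter> allowed f g G I) \<le> card ((`) g ` ?H \<union> {e\<in>G2 - G'. e \<subseteq> g ` I})"
    using finH fin by (intro card_mono) auto
  also have "\<dots> \<le> card ((`) g ` ?H) + card {e\<in>G2 - G'. e \<subseteq> g ` I}" by (rule card_Un_le)
  also have "\<dots> \<le> card ?H + 3 * N" using del finH by (intro add_mono card_image_le)
  finally have "real (card (G2 \<inter> allowed f g G I)) \<le> real (card ?H + 3 * N)" by (rule of_nat_mono)
  thus ?thesis using c by simp
qed

text \<open>A third edge of the same colour would project to a triangle of \<open>G2'\<close>. A
  third edge of the other colour needs distinct \<open>g\<close>-coordinates without a common
  neighbour in \<open>G2\<close>, but \<open>g y\<close> is such a neighbour. The test refers to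
  \<open>G2\<close> before deletion, hence \<open>sub\<close>.\<close>

lemma coloured_two:
  assumes "{x, y} \<in> coloured f g n G1 G2'" "{y, z} \<in> coloured f g n G1 G2'"
    and tf: "no_triangle G2'" and sub: "G2' \<subseteq> G2"
  shows "{x, z} \<notin> coloured f g n G1 G2'" "{x, z} \<notin> coloured g f n G2 G1'"
proof -
  have e: "{g x, g y} \<in> G2'" "{g y, g z} \<in> G2'" using assms(1,2) by (auto simp: coloured_iff)
  show "{x, z} \<notin> coloured f g n G1 G2'" using tf e unfolding no_triangle_def coloured_iff by blast
  have "{g y, g x} \<in> G2" using e(1) sub by (auto simp: insert_commute)
  moreover have "{g y, g z} \<in> G2" using e(2) sub by blast
  ultimately have "g x \<noteq> g z \<Longrightarrow> joined G2 (g x) (g z)" unfolding joined_def by blast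
  thus "{x, z} \<notin> coloured g f n G2 G1'" by (auto simp: coloured_iff)
qed

text \<open>A k-set has s points with distinct coordinates on one of the axes. By
  \<open>card_coloured\<close> these alone span enough edges of that colour, with 3 N as the cost of
  deletion.\<close>

lemma two_colour_graph:
  assumes X: "finite X" and G: "G1 \<subseteq> pairs X" "G2 \<subseteq> pairs X"
    and f: "f1 ` {..<n} \<subseteq> X" "f2 ` {..<n} \<subseteq> X"
    and S: "sparse_graph X t q s N G1" "sparse_graph X t q s N G2"
    and nf: "\<not> few_edges f1 f2 n s c G1 G2" "\<not> few_edges f2 f1 n s c G2 G1"
    and proj: "\<And>I. I \<subseteq> {..<n} \<Longrightarrow> card I = k \<Longrightarrow> s \<le> card (f1 ` I) \<or> s \<le> card (f2 ` I)"
  shows "\<exists>H\<subseteq>pairs {..<n}. no_triangle H \<and>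
    (\<forall>I\<subseteq>{..<n}. card I = k \<longrightarrow> c - 3 * real N \<le> real (card {e\<in>H. e \<subseteq> I}))"
proof -
  have T: "\<not> packs (triangles_at X A) N G1" "\<not> packs (triangles_at X A) N G2"
    if "A \<subseteq> X" "card A = s" for A
    using S that unfolding sparse_graph_def by blast+
  obtain G1' where G1': "G1' \<subseteq> G1" "no_triangle G1'"
    "\<forall>A\<subseteq>X. card A = s \<longrightarrow> card {e\<in>G1 - G1'. e \<subseteq> A} \<le> 3 * N"
    using triangle_deletion[OF X G(1) T(1)] by blast
  obtain G2' where G2': "G2' \<subseteq> G2" "no_triangle G2'"
    "\<forall>A\<subseteq>X. card A = s \<longrightarrow> card {e\<in>G2 - G2'. e \<subseteq> A} \<le> 3 * N"
    using triangle_deletion[OF X G(2) T(2)] by blast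
  define H1 where "H1 = coloured f2 f1 n G2 G1'"
  define H2 where "H2 = coloured f1 f2 n G1 G2'"
  have H2': "{x, z} \<notin> H1 \<and> {x, z} \<notin> H2" if "{x, y} \<in> H2" "{y, z} \<in> H2" for x y z
    using coloured_two[OF that[unfolded H2_def] G2'(2,1)] unfolding H1_def H2_def by blast
  have H1': "{x, z} \<notin> H1 \<and> {x, z} \<notin> H2" if "{x, y} \<in> H1" "{y, z} \<in> H1" for x y z
    using coloured_two[OF that[unfolded H1_def] G1'(2,1)] unfolding H1_def H2_def by blast
  have tf: "no_triangle (H1 \<union> H2)"
    unfolding no_triangle_def
  proof (intro allI impI notI)
    fix x y z assume e: "{x, y} \<in> H1 \<union> H2" "{y, z} \<in> H1 \<union> H2"
    assume xz: "{x, z} \<in> H1 \<union> H2"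
    have comm: "{z, x} = {x, z}" "{y, x} = {x, y}" "{z, y} = {y, z}" by (simp_all add: insert_commute)
    have H: False if "i = H1 \<or> i = H2" "{x, y} \<in> i \<and> {y, z} \<in> i \<or> {x, y} \<in> i \<and> {x, z} \<in> i \<or> {x, z} \<in> i \<and> {y, z} \<in> i" for i
      using that(2)
    proof (elim disjE conjE)
      assume "{x, y} \<in> i" "{y, z} \<in> i"
      thus False using H1'[of x y z] H2'[of x y z] that(1) xz by blast
    next
      assume "{x, y} \<in> i" "{x, z} \<in> i"
      thus False using H1'[of y x z] H2'[of y x z] that(1) e unfolding comm by blast
    next
      assume "{x, z} \<in> i" "{y, z} \<in> i"
      thus False using H1'[of x z y] H2'[of x z y] that(1) e unfolding comm by blast
    qed
    from H[of H1] H[of H2] e xz show False by (simp only: Un_iff simp_thms) metis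
  qed
  have cnt: "c - 3 * real N \<le> real (card {e\<in>H1 \<union> H2. e \<subseteq> I})" if I: "I \<subseteq> {..<n}" "card I = k" for I
  proof -
    have finH: "finite (H1 \<union> H2)"
      unfolding H1_def H2_def using coloured_pairs finite_pairs[of "{..<n}"] finite_subset
      by (metis finite_Un finite_lessThan)
    have pick: "\<exists>J\<subseteq>I. card J = s \<and> inj_on g J" if s: "s \<le> card (g ` I)" for g :: "nat \<Rightarrow> _"
    proof -
      obtain A where A: "A \<subseteq> g ` I" "card A = s" using s by (meson obtain_subset_with_card_n)
      obtain J where "J \<subseteq> I" "inj_on g J" "A = g ` J" using subset_image_inj[of A g I] A(1) by blast
      thus ?thesis using A(2) by (auto simp: card_image)
    qed
    from proj[OF I] show ?thesis
    proof
      assume "s \<le> card (f1 ` I)"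
      then obtain J where J: "J \<subseteq> I" "card J = s" "inj_on f1 J" using pick by blast
      have "J \<subseteq> {..<n}" using J(1) I(1) by blast
      hence JX: "f1 ` J \<subseteq> X" "card (f1 ` J) = s" "J \<subseteq> {..<n}"
        using J f by (auto simp: card_image image_subset_iff)
      have "c \<le> real (card (G1 \<inter> allowed f2 f1 G2 J))"
        using nf(2) J(2,3) JX(3) unfolding few_edges_def by force
      hence "c - 3 * real N \<le> real (card {e\<in>H1. e \<subseteq> J})" unfolding H1_def
        by (intro card_coloured[OF G1'(1) finite_subset[OF G(1) finite_pairs[OF X]] JX(3) G1'(3)[rule_format, OF JX(1,2)]])
      also have "\<dots> \<le> real (card {e\<in>H1 \<union> H2. e \<subseteq> I})"
        using finH J(1) by (intro of_nat_mono card_mono) auto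
      finally show ?thesis .
    next
      assume "s \<le> card (f2 ` I)"
      then obtain J where J: "J \<subseteq> I" "card J = s" "inj_on f2 J" using pick by blast
      have "J \<subseteq> {..<n}" using J(1) I(1) by blast
      hence JX: "f2 ` J \<subseteq> X" "card (f2 ` J) = s" "J \<subseteq> {..<n}"
        using J f by (auto simp: card_image image_subset_iff)
      have "c \<le> real (card (G2 \<inter> allowed f1 f2 G1 J))"
        using nf(1) J(2,3) JX(3) unfolding few_edges_def by force
      hence "c - 3 * real N \<le> real (card {e\<in>H2. e \<subseteq> J})" unfolding H2_def
        by (intro card_coloured[OF G2'(1) finite_subset[OF G(2) finite_pairs[OF X]] JX(3) G2'(3)[rule_format, OF JX(1,2)]])
      also have "\<dots> \<le> real (card {e\<in>H1 \<union> H2. e \<subseteq> I})"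
        using finH J(1) by (intro of_nat_mono card_mono) auto
      finally show ?thesis .
    qed
  qed
  have "H1 \<union> H2 \<subseteq> pairs {..<n}" unfolding H1_def H2_def using coloured_pairs by blast
  thus ?thesis using tf cnt by (intro exI[of _ "H1 \<union> H2"]) simp
qed

section \<open>Random points in the grid\<close>

text \<open>Elements packed as singletons: the bound for disjoint families doubles as an upper tail
  bound for a cardinality.\<close>

lemma (in prb_space) prb_many:
  assumes S: "S \<subseteq> E" and k: "k > 0" and q: "exp 1 * real (card S) * p \<le> q * real k"
  shows "prb E p (\<lambda>P. k \<le> card (P \<inter> S)) \<le> q ^ k"
proof -
  have finS: "finite S" using S finE finite_subset by blast
  have "prb E p (\<lambda>P. k \<le> card (P \<inter> S)) \<le> prb E p (packs ((\<lambda>z. {z}) ` S) k)"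
  proof (rule prb_mono)
    fix P assume "k \<le> card (P \<inter> S)"
    then obtain B where B: "B \<subseteq> P \<inter> S" "card B = k" by (meson obtain_subset_with_card_n)
    have "card ((\<lambda>z. {z}) ` B) = k" using B by (simp add: card_image)
    moreover have "finite B" using B finS finite_subset by blast
    moreover have "disjoint ((\<lambda>z. {z}) ` B)" by (auto simp: disjoint_def)
    ultimately show "packs ((\<lambda>z. {z}) ` S) k P"
      unfolding packs_def using B(1) by (intro exI[of _ "(\<lambda>z. {z}) ` B"]) auto
  qed
  also have "\<dots> \<le> q ^ k"
    by (rule prb_packs[where j = 1 and M = "real (card S)"]) (use S q k in \<open>auto simp: card_image\<close>)
  finally show ?thesis .
qed

text \<open>The points form a random subset of the grid instead of n independent draws, so they are
  distinct; the lower tail provides more than n of them and n are kept. A k-set with fewer than s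
  coordinates on both axes would lie in a product of two s-sets, which holds fewer than k
  points.\<close>

lemma exists_points:
  fixes n m s k F :: nat and p qF qk :: real
  assumes p: "0 \<le> p" "p \<le> 1" and n: "4 * real n \<le> p * real m ^ 2" and pos: "F > 0" "k > 0" "s \<le> m"
    and q0: "0 \<le> qF" "0 \<le> qk"
    and qF: "exp 1 * real m * p \<le> qF * real F" and qk: "exp 1 * real s ^ 2 * p \<le> qk * real k"
    and small: "exp (- real n) + 2 * real m * qF ^ F + real m ^ (2 * s) * qk ^ k < 1"
  shows "\<exists>f1 f2 :: nat \<Rightarrow> nat. f1 ` {..<n} \<subseteq> {..<m} \<and> f2 ` {..<n} \<subseteq> {..<m} \<and>
    (\<forall>x. card {u. u < n \<and> f1 u = x} \<le> F) \<and> (\<forall>x. card {u. u < n \<and> f2 u = x} \<le> F) \<and>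
    (\<forall>I\<subseteq>{..<n}. card I = k \<longrightarrow> s \<le> card (f1 ` I) \<or> s \<le> card (f2 ` I))"
proof -
  let ?E = "{..<m} \<times> {..<m}"
  let ?As = "{A. A \<subseteq> {..<m} \<and> card A = s}"
  interpret prb_space ?E p using p by unfold_locales auto
  let ?E1 = "\<lambda>P. real (card (P \<inter> ?E)) \<le> p * real (card ?E) / 4"
  let ?E2 = "\<lambda>P. \<exists>x\<in>{..<m}. F \<le> card (P \<inter> ({x} \<times> {..<m}))"
  let ?E3 = "\<lambda>P. \<exists>x\<in>{..<m}. F \<le> card (P \<inter> ({..<m} \<times> {x}))"
  let ?E4 = "\<lambda>P. \<exists>AB\<in>?As \<times> ?As. k \<le> card (P \<inter> (fst AB \<times> snd AB))"
  have "prb ?E p ?E1 \<le> exp (- p * real (card ?E) / 4)" by (rule prb_few) simp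
  also have "\<dots> \<le> exp (- real n)" using n by (simp add: card_cartesian_product power2_eq_square)
  finally have E1: "prb ?E p ?E1 \<le> exp (- real n)" .
  have E2: "prb ?E p ?E2 \<le> real m * qF ^ F"
    by (rule prb_Bex_le; (rule prb_many)?) (use q0 qF pos in \<open>auto simp: card_cartesian_product\<close>)
  have E3: "prb ?E p ?E3 \<le> real m * qF ^ F"
    by (rule prb_Bex_le; (rule prb_many)?) (use q0 qF pos in \<open>auto simp: card_cartesian_product\<close>)
  have E4: "prb ?E p ?E4 \<le> real m ^ (2 * s) * qk ^ k"
  proof (rule prb_Bex_le)
    fix AB assume AB: "AB \<in> ?As \<times> ?As"
    show "prb ?E p (\<lambda>P. k \<le> card (P \<inter> (fst AB \<times> snd AB))) \<le> qk ^ k"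
      by (rule prb_many) (use AB qk pos in \<open>auto simp: card_cartesian_product power2_eq_square\<close>)
  next
    have "card (?As \<times> ?As) \<le> m ^ s * m ^ s"
      unfolding card_cartesian_product using card_subsets_le[of "{..<m}" s] by (intro mult_mono) auto
    also have "\<dots> = m ^ (2 * s)" by (simp add: mult_2 power_add)
    finally have "real (card (?As \<times> ?As)) \<le> real (m ^ (2 * s))" by (rule of_nat_mono)
    thus "real (card (?As \<times> ?As)) \<le> real m ^ (2 * s)" by simp
  qed (use q0 in auto)
  have "\<exists>P\<subseteq>?E. \<not> (((?E1 P \<or> ?E2 P) \<or> ?E3 P) \<or> ?E4 P)"
  proof (rule ccontr)
    assume "\<not> ?thesis"
    hence "1 \<le> prb ?E p (\<lambda>P. ((?E1 P \<or> ?E2 P) \<or> ?E3 P) \<or> ?E4 P)"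
      unfolding prb_True[symmetric] by (intro prb_mono) blast
    also have "\<dots> \<le> prb ?E p ?E1 + prb ?E p ?E2 + prb ?E p ?E3 + prb ?E p ?E4"
      by (intro order_trans[OF prb_disj] add_mono order_refl)
    finally show False using E1 E2 E3 E4 small by simp
  qed
  then obtain P where P: "P \<subseteq> ?E" "\<not> ?E1 P" "\<not> ?E2 P" "\<not> ?E3 P" "\<not> ?E4 P" by blast
  have finP: "finite P" using P(1) finite_subset by blast
  have "real n < real (card (P \<inter> ?E))"
    using P(2) n by (simp add: card_cartesian_product power2_eq_square)
  hence "n \<le> card P" using P(1) by (simp add: Int_absorb2)
  then obtain V where V: "V \<subseteq> P" "card V = n" by (meson obtain_subset_with_card_n)
  have "finite V" using V(1) finP finite_subset by blast
  then obtain h where h: "bij_betw h {..<n} V"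
    using V(2) ex_bij_betw_nat_finite[of V] by (auto simp: atLeast0LessThan)
  have hP: "h u \<in> P" if "u < n" for u using h that V(1) by (auto simp: bij_betw_def)
  have hE: "fst (h u) < m" "snd (h u) < m" if "u < n" for u using hP[OF that] P(1) by auto
  have inj: "inj_on h A" if "A \<subseteq> {..<n}" for A using h that inj_on_subset by (auto simp: bij_betw_def)
  have cardle: "card A \<le> card (P \<inter> S)" if "A \<subseteq> {..<n}" "\<And>u. u \<in> A \<Longrightarrow> h u \<in> S" for A S
  proof -
    have "card A = card (h ` A)" using inj[OF that(1)] by (simp add: card_image)
    also have "\<dots> \<le> card (P \<inter> S)" using that hP finP by (intro card_mono) auto
    finally show ?thesis .
  qed
  show ?thesis
  proof (rule exI[of _ "fst \<circ> h"], rule exI[of _ "snd \<circ> h"], intro conjI allI impI)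
    show "(fst \<circ> h) ` {..<n} \<subseteq> {..<m}" "(snd \<circ> h) ` {..<n} \<subseteq> {..<m}" using hE by auto
    show "card {u. u < n \<and> (fst \<circ> h) u = x} \<le> F" for x :: nat
    proof (cases "x < m")
      case True
      have "card {u. u < n \<and> (fst \<circ> h) u = x} \<le> card (P \<inter> ({x} \<times> {..<m}))"
        by (rule cardle) (auto simp: mem_Times_iff hE)
      thus ?thesis using P(3) True by force
    next
      case False
      hence "{u. u < n \<and> (fst \<circ> h) u = x} = {}" using hE by auto
      thus ?thesis by (metis card.empty le0)
    qed
    show "card {u. u < n \<and> (snd \<circ> h) u = x} \<le> F" for x
    proof (cases "x < m")
      case True
      have "card {u. u < n \<and> (snd \<circ> h) u = x} \<le> card (P \<inter> ({..<m} \<times> {x}))"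
        by (rule cardle) (auto simp: mem_Times_iff hE)
      thus ?thesis using P(4) True by force
    next
      case False
      hence "{u. u < n \<and> (snd \<circ> h) u = x} = {}" using hE by auto
      thus ?thesis by (metis card.empty le0)
    qed
    fix I assume I: "I \<subseteq> {..<n}" "card I = k"
    have finI: "finite I" using I(1) finite_subset by blast
    show "s \<le> card ((fst \<circ> h) ` I) \<or> s \<le> card ((snd \<circ> h) ` I)"
    proof (rule ccontr)
      assume *: "\<not> ?thesis"
      have ext: "\<exists>A'. A \<subseteq> A' \<and> A' \<in> ?As" if A: "A \<subseteq> {..<m}" "card A \<le> s" for A
      proof -
        have finA: "finite A" using A(1) finite_subset by blast
        have "s - card A \<le> card ({..<m} - A)" using pos(3) A(1) finA by (subst card_Diff_subset) auto
        then obtain B where B: "B \<subseteq> {..<m} - A" "card B = s - card A" by (meson obtain_subset_with_card_n)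
        have "finite B" using B(1) finite_subset by blast
        hence "card (A \<union> B) = s" using B A finA by (subst card_Un_disjoint) auto
        thus ?thesis using B A by (intro exI[of _ "A \<union> B"]) auto
      qed
      have "(fst \<circ> h) ` I \<subseteq> {..<m}" "(snd \<circ> h) ` I \<subseteq> {..<m}" using I hE by auto
      moreover have "card ((fst \<circ> h) ` I) \<le> s" "card ((snd \<circ> h) ` I) \<le> s" using * by linarith+
      ultimately obtain A B where AB: "(fst \<circ> h) ` I \<subseteq> A" "A \<in> ?As" "(snd \<circ> h) ` I \<subseteq> B" "B \<in> ?As"
        using ext[of "(fst \<circ> h) ` I"] ext[of "(snd \<circ> h) ` I"] by blast
      have "card I \<le> card (P \<inter> (A \<times> B))"
      proof (rule cardle[OF I(1)])
        fix u assume "u \<in> I"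
        hence "fst (h u) \<in> A" "snd (h u) \<in> B" using AB(1,3) by auto
        thus "h u \<in> A \<times> B" by (simp add: mem_Times_iff)
      qed
      moreover have "(A, B) \<in> ?As \<times> ?As" using AB(2,4) by simp
      ultimately have "card (P \<inter> (A \<times> B)) < k" using P(5) by (auto simp: not_le)
      thus False using \<open>card I \<le> card (P \<inter> (A \<times> B))\<close> I(2) by simp
    qed
  qed
qed

section \<open>Union bounds for the whole construction\<close>

text \<open>Since q = n^(-1/20), 40 j factors contribute n^(-2 j): one n^(-j) pays for the m^j
  choices and the other is left over.\<close>

lemma power_exp_le:
  assumes "0 < m" "m \<le> n" "q = exp (- (ln (real n) / 20))" "40 * j \<le> N" "0 < j"
  shows "real m ^ j * q ^ N \<le> 1 / real n"
proof -
  define L where "L = ln (real n)"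
  have L: "0 \<le> L" "exp L = real n" using assms by (auto simp: L_def)
  have "real m ^ j * q ^ N \<le> exp L ^ j * q ^ N"
    using assms L by (intro mult_right_mono power_mono) auto
  also have "\<dots> = exp (real j * L - real N * L / 20)"
    unfolding assms(3) L_def[symmetric] by (simp flip: exp_of_nat_mult exp_add)
  also have "\<dots> \<le> exp (- L)"
  proof -
    have "(40 * real j) * L \<le> real N * L" "1 * L \<le> real j * L"
      using assms(4,5) L(1) by (intro mult_right_mono; linarith)+
    thus ?thesis by simp
  qed
  also have "\<dots> = 1 / real n" using L by (simp add: exp_minus inverse_eq_divide)
  finally show ?thesis .
qed

text \<open>Degrees and fibre sizes need a union bound over m objects only, so q = 1/e with 2 ln n
  factors suffices.\<close>

lemma mult_power_exp_le:
  assumes "0 < m" "m \<le> n" "2 * ln (real n) \<le> real D"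
  shows "real m * exp (- 1) ^ D \<le> 1 / real n"
proof -
  define L where "L = ln (real n)"
  have L: "0 \<le> L" "exp L = real n" using assms by (auto simp: L_def)
  have "real m * exp (- 1) ^ D \<le> exp L * exp (- 1) ^ D"
    using assms L by (intro mult_right_mono) auto
  also have "\<dots> = exp (L - real D)" by (simp flip: exp_of_nat_mult exp_add)
  also have "\<dots> \<le> exp (- L)" using assms(3) by (simp add: L_def)
  also have "\<dots> = 1 / real n" using L by (simp add: exp_minus inverse_eq_divide)
  finally show ?thesis .
qed

text \<open>\<open>hF\<close> and \<open>hk\<close> serve the points, \<open>h1\<close> to
  \<open>h4\<close> the axis graphs, \<open>h5\<close> the event \<open>few_edges\<close>,
  \<open>num\<close> the count in \<open>card_allowed\<close>. The set size is \<open>80 * s\<close>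
  because m^(2 s) pairs of s-sets must be beaten at a rate of 40 points per unit of the
  exponent.\<close>

lemma two_bites:
  fixes n m s F t D N2 N3 N :: nat and p p0 :: real
  defines "L \<equiv> ln (real n)"
  assumes n: "100 \<le> n" and m: "0 < m" "m \<le> n" and pos: "0 < s" "0 < t" and le: "s \<le> m" "t \<le> m" "s \<le> t * F"
    and p: "0 \<le> p" "p \<le> 1" "0 \<le> p0" "p0 \<le> 1" and V: "4 * real n \<le> p0 * real m ^ 2"
    and hF: "exp 1 * real m * p0 \<le> exp (- 1) * real F" "2 * L \<le> real F"
    and hk: "exp 1 * real s ^ 2 * p0 \<le> exp (- (L / 20)) * real (80 * s)"
    and h1: "exp 1 * real m * p \<le> exp (- 1) * real D" "2 * L \<le> real D"
    and h2: "exp 1 * (real m * real t ^ 2) * p ^ 2 \<le> exp (- (L / 20)) * real N2" "40 * t \<le> N2"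
    and h3: "exp 1 * (real m * real t ^ 3) * p ^ 3 \<le> exp (- (L / 20)) * real N3" "40 * t \<le> N3"
    and h4: "exp 1 * (real s ^ 2 * real m) * p ^ 3 \<le> exp (- (L / 20)) * real N" "40 * s \<le> N"
    and h5: "32 * real s * L \<le> p * real s ^ 2"
    and num: "real s * real F + real F ^ 2 * (real (8 * N2 + 18 * D * N3) + 2 * real t) \<le> real s ^ 2 / 2"
  shows "\<exists>H\<subseteq>pairs {..<n}. no_triangle H \<and>
    (\<forall>I\<subseteq>{..<n}. card I = 80 * s \<longrightarrow> p * real s ^ 2 / 16 - 3 * real N \<le> real (card {e\<in>H. e \<subseteq> I}))"
proof -
  have L: "0 < L" "exp L = real n" using n by (auto simp: L_def)
  have Fpos: "F > 0" "D > 0" using hF(2) h1(2) L(1) by (auto intro!: Nat.gr0I)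
  have n1: "1 / real n \<le> 1 / 100" using n by (intro divide_left_mono) auto
  have "exp (- real n) + 2 * real m * exp (- 1) ^ F + real m ^ (2 * s) * exp (- (L / 20)) ^ (80 * s) < 1"
  proof -
    have "exp (- real n) \<le> exp (- 1)" using n by simp
    also have "\<dots> \<le> 1 / 2" using exp_ge_add_one_self[of 1] by (simp add: exp_minus field_simps)
    finally have "exp (- real n) \<le> 1 / 2" .
    moreover have "real m * exp (- 1) ^ F \<le> 1 / real n"
      using mult_power_exp_le[OF m] hF(2) by (simp add: L_def)
    moreover have "real m ^ (2 * s) * exp (- (L / 20)) ^ (80 * s) \<le> 1 / real n"
      using pos by (intro power_exp_le[OF m]) (auto simp: L_def)
    ultimately show ?thesis using n1 by linarith
  qed
  from exists_points[OF p(3,4) V Fpos(1) _ le(1) exp_ge_zero exp_ge_zero hF(1) hk this] pos(1)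
  obtain f1 f2 :: "nat \<Rightarrow> nat" where f: "f1 ` {..<n} \<subseteq> {..<m}" "f2 ` {..<n} \<subseteq> {..<m}"
    and fib: "\<And>x. card {u. u < n \<and> f1 u = x} \<le> F" "\<And>x. card {u. u < n \<and> f2 u = x} \<le> F"
    and proj: "\<And>I. I \<subseteq> {..<n} \<Longrightarrow> card I = 80 * s \<Longrightarrow> s \<le> card (f1 ` I) \<or> s \<le> card (f2 ` I)"
    by auto
  let ?X = "{..<m}" and ?q = "8 * N2 + 18 * D * N3"
  let ?S = "sparse_graph ?X t ?q s N"
  let ?B = "\<lambda>f g. few_edges f g n s (p * real s ^ 2 / 16)"
  have S: "prb (pairs ?X) p (\<lambda>G. \<not> ?S G) \<le> 4 / real n"
  proof -
    have "prb (pairs ?X) p (\<lambda>G. \<not> ?S G)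
      \<le> real m * exp (- 1) ^ D + real m ^ t * exp (- (L / 20)) ^ N2 + real m ^ t * exp (- (L / 20)) ^ N3
        + real m ^ s * exp (- (L / 20)) ^ N"
      using pos h2(2) h3(2) h4(2) Fpos
      by (intro prb_not_sparse p h1 h2 h3 h4 le) auto
    also have "\<dots> \<le> 1 / real n + 1 / real n + 1 / real n + 1 / real n"
      using pos h1(2) h2(2) h3(2) h4(2)
      by (intro add_mono power_exp_le[OF m] mult_power_exp_le[OF m]) (auto simp: L_def)
    finally show ?thesis by simp
  qed
  have Bb: "real n ^ s * exp (- p * real s ^ 2 / 16) \<le> 1 / real n"
  proof -
    have "real n ^ s * exp (- p * real s ^ 2 / 16) = exp (real s * L - p * real s ^ 2 / 16)"
      unfolding L(2)[symmetric] by (simp flip: exp_of_nat_mult exp_add)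
    also have "\<dots> \<le> exp (- L)"
    proof -
      have "1 * L \<le> real s * L" using pos L by (intro mult_right_mono) auto
      thus ?thesis using h5 by simp
    qed
    also have "\<dots> = 1 / real n" using L by (simp add: exp_minus inverse_eq_divide)
    finally show ?thesis .
  qed
  have B: "prb (pairs ?X) p (?B f g G) \<le> 1 / real n"
    if "?S G" "f ` {..<n} \<subseteq> ?X" "g ` {..<n} \<subseteq> ?X" "\<And>x. card {u. u < n \<and> f u = x} \<le> F" for f g G
  proof -
    have "prb (pairs ?X) p (?B f g G) \<le> real n ^ s * exp (- p * real s ^ 2 / 16)"
      using that(1) unfolding sparse_graph_def
      by (intro prb_few_edges[OF _ that(2,3) p(1,2) that(4) le(3) _ num]) auto
    thus ?thesis using Bb by simp
  qed
  have "2 * (4 / real n) + 2 * (1 / real n) < 1" using n by (simp add: field_simps)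
  from exists_pair[where S = ?S and B = "?B f1 f2" and B' = "?B f2 f1", OF finite_pairs[OF finite_lessThan] p(1,2) S B[OF _ f fib(1)] B[OF _ f(2,1) fib(2)] this]
  obtain G1 G2 where G: "G1 \<subseteq> pairs ?X" "G2 \<subseteq> pairs ?X" "?S G1" "?S G2"
    "\<not> ?B f1 f2 G1 G2" "\<not> ?B f2 f1 G2 G1" by auto
  show ?thesis
    by (rule two_colour_graph[OF _ G(1,2) f G(3-6) proj]) auto
qed

section \<open>Choice of parameters\<close>

text \<open>With \<open>m = n powr (1 - \<epsilon>)\<close> the construction needs \<open>\<epsilon> < 1/4\<close>, so that few points fall into a
  subgrid with sides of order \<open>sqrt (n ln n)\<close>, and \<open>\<epsilon> > 1/6\<close>, so that a set \<open>A\<close> of \<open>t\<close> vertices is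
  expected to span fewer than \<open>t\<close> 3-stars. Here \<open>\<epsilon> = 1/5\<close>; the functions \<open>r, p, x, y\<close> stand for
  \<open>sqrt (n ln n)\<close>, the edge density, \<open>m\<close> and \<open>n / m\<close>.\<close>

lemma eventually_parameters:
  defines "r \<equiv> \<lambda>n. sqrt (real n * ln (real n))" and "p \<equiv> \<lambda>n. sqrt (ln (real n) / real n)"
    and "x \<equiv> \<lambda>n. real n powr (4/5)" and "y \<equiv> \<lambda>n. real n powr (1/5)"
  shows "\<forall>\<^sub>F n in sequentially. 100 \<le> n \<and> 1 \<le> ln (real n) \<and> ln (real n) \<le> real n \<and>
      2 * 100000000 * r n + 2 \<le> x n \<and> 2 * x n \<le> real n \<and> 4 * real n \<le> x n ^ 2 \<and> 2 * ln (real n) \<le> y n \<and>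
      2 * ln (real n) \<le> x n * p n \<and> 64000 * 37 * y n \<le> 100000000 * r n \<and>
      exp 1 * 3200 * x n * (ln (real n) / real n) \<le> real n powr (- 1 / 20) \<and>
      exp 1 * (2 * x n) * (3 * 100000000 * r n / y n) ^ 2 * p n ^ 3 \<le> real n powr (- 1 / 20) * 40 \<and>
      exp 1 * (2 * 100000000 * r n) * (4 * real n / x n ^ 2) \<le> real n powr (- 1 / 20) * 80"
  unfolding r_def p_def x_def y_def
  by (intro eventually_conj; real_asymp)

lemma exp_two_le: "exp (2::real) \<le> 9"
proof -
  have "exp (2::real) = exp 1 * exp 1" by (simp flip: exp_add)
  also have "\<dots> \<le> 3 * 3" using exp_le by (intro mult_mono) auto
  finally show ?thesis by simp
qed

text \<open>With k = 80 s the lower bound is 3 k ln n edges, enough for the random orientation to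
  beat n^k orderings.\<close>

lemma dense_graphs:
  "\<forall>\<^sub>F n in sequentially. \<exists>s H. 0 < s \<and> real s \<le> 2 * 100000000 * sqrt (real n * ln (real n)) \<and>
    H \<subseteq> pairs {..<n} \<and> no_triangle H \<and>
    (\<forall>I\<subseteq>{..<n}. card I = 80 * s \<longrightarrow> 240 * real s * ln (real n) \<le> real (card {e\<in>H. e \<subseteq> I}))"
  using eventually_parameters
proof (rule eventually_mono, elim conjE)
  fix n :: nat
  define L where "L = ln (real n)"
  define r where "r = sqrt (real n * L)"
  define p where "p = sqrt (L / real n)"
  define x where "x = real n powr (4/5)"
  define y where "y = real n powr (1/5)"
  define \<epsilon> where "\<epsilon> = exp (- (L / 20))"
  assume n: "100 \<le> n" and "1 \<le> ln (real n)" "ln (real n) \<le> real n"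
    "2 * 100000000 * sqrt (real n * ln (real n)) + 2 \<le> real n powr (4/5)" "2 * real n powr (4/5) \<le> real n"
    "4 * real n \<le> (real n powr (4/5)) ^ 2" "2 * ln (real n) \<le> real n powr (1/5)"
    "2 * ln (real n) \<le> real n powr (4/5) * sqrt (ln (real n) / real n)"
    "64000 * 37 * real n powr (1/5) \<le> 100000000 * sqrt (real n * ln (real n))"
    "exp 1 * 3200 * real n powr (4/5) * (ln (real n) / real n) \<le> real n powr (- 1 / 20)"
    "exp 1 * (2 * real n powr (4/5)) * (3 * 100000000 * sqrt (real n * ln (real n)) / real n powr (1/5)) ^ 2 *
       sqrt (ln (real n) / real n) ^ 3 \<le> real n powr (- 1 / 20) * 40"
    "exp 1 * (2 * 100000000 * sqrt (real n * ln (real n))) * (4 * real n / (real n powr (4/5)) ^ 2) \<le> real n powr (- 1 / 20) * 80"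
  moreover have "real n powr (- 1 / 20) = \<epsilon>" using n by (simp add: powr_def \<epsilon>_def L_def)
  ultimately have L1: "1 \<le> L" and Ln: "L \<le> real n" and sx: "2 * 100000000 * r + 2 \<le> x" and xn: "2 * x \<le> real n"
    and p0: "4 * real n \<le> x ^ 2" and Ly: "2 * L \<le> y" and Lxp: "2 * L \<le> x * p" and ty: "64000 * 37 * y \<le> 100000000 * r"
    and e2: "exp 1 * 3200 * x * (L / real n) \<le> \<epsilon>"
    and e3: "exp 1 * (2 * x) * (3 * 100000000 * r / y) ^ 2 * p ^ 3 \<le> \<epsilon> * 40"
    and ek: "exp 1 * (2 * 100000000 * r) * (4 * real n / x ^ 2) \<le> \<epsilon> * 80"
    by (simp_all add: L_def r_def p_def x_def y_def)
  have n0: "0 < real n" using n by simp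
  have xy: "x * y = real n" using n0 by (simp add: x_def y_def flip: powr_add)
  have x0: "0 < x" and y0: "0 < y" using n0 by (simp_all add: x_def y_def)
  have p2: "p ^ 2 = L / real n" using L1 n0 by (simp add: p_def)
  have pr: "p * r = L" using L1 n0 by (simp add: p_def r_def flip: real_sqrt_mult)
  have np: "real n * p = r"
  proof -
    have "real n * p = sqrt (real n ^ 2) * p" by simp
    also have "\<dots> = sqrt (real n ^ 2 * (L / real n))" unfolding p_def real_sqrt_mult[symmetric] ..
    also have "real n ^ 2 * (L / real n) = real n * L" using n0 by (simp add: power2_eq_square)
    finally show ?thesis by (simp add: r_def)
  qed
  have pp: "0 < p" "p \<le> 1" using L1 Ln n0 by (simp_all add: p_def)
  have r1: "1 \<le> r" using mult_mono[of 1 "real n" 1 L] n L1 by (simp add: r_def)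
  have \<epsilon>0: "0 < \<epsilon>" by (simp add: \<epsilon>_def)
  have y2: "2 \<le> y" using Ly L1 by linarith

  \<comment> \<open>\<open>F\<close> and \<open>D\<close> exceed the means 4 n / m and m p by a
    factor e^2, as q = 1/e in \<open>prb_packs\<close> demands. \<open>t\<close> is the number of
    full fibres that can hold s points. \<open>N2\<close> and \<open>N\<close> are small fractions
    of t^2 and p s^2, and \<open>N3\<close> is the least value that \<open>power_exp_le\<close>
    permits.\<close>
  define m where "m = nat \<lceil>x\<rceil>"
  define s where "s = nat \<lceil>100000000 * r\<rceil>"
  define F where "F = nat \<lceil>4 * exp 2 * real n / real m\<rceil>"
  define D where "D = nat \<lceil>exp 2 * real m * p\<rceil>"
  define t where "t = nat \<lceil>real s / real F\<rceil>"
  define N2 where "N2 = nat \<lceil>real t ^ 2 / 1600\<rceil>"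
  define N3 where "N3 = 40 * t"
  define N where "N = nat \<lceil>p * real s ^ 2 / 200\<rceil>"

  have ceil: "z \<le> real (nat \<lceil>z\<rceil>) \<and> real (nat \<lceil>z\<rceil>) \<le> z + 1" if "0 \<le> z" for z :: real
    using that by linarith
  have "x \<le> real m" "real m \<le> x + 1" using ceil[of x, folded m_def] x0 by linarith+
  moreover have "1 \<le> x" using sx r1 by linarith
  ultimately have m: "x \<le> real m" "real m \<le> 2 * x" "0 < real m" by linarith+
  have s: "100000000 * r \<le> real s" "real s \<le> 2 * 100000000 * r" "100000000 \<le> real s"
    using ceil[of "100000000 * r", folded s_def] r1 by linarith+
  have F: "4 * exp 2 * real n / real m \<le> real F" "real F \<le> 4 * exp 2 * real n / real m + 1"
    using ceil[of "4 * exp 2 * real n / real m", folded F_def] m n0 by simp_all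
  \<comment> \<open>37 = 4 * 9 + 1, from e^2 \<le> 9 and rounding up; likewise 19 = 9 * 2 + 1 for
    \<open>D\<close> below.\<close>
  have Fy: "y \<le> real F" "real F \<le> 37 * y"
  proof -
    have "y = real n / x" using xy x0 by (simp add: field_simps)
    also have "\<dots> = 2 * real n / (2 * x)" by simp
    also have "\<dots> \<le> 4 * exp 2 * real n / real m"
      using m x0 n0 exp_ge_add_one_self[of "2::real"] by (intro frac_le mult_right_mono) auto
    finally show "y \<le> real F" using F(1) by simp
    have "4 * exp 2 * real n / real m \<le> 36 * real n / x"
      using m x0 n0 exp_two_le by (intro frac_le mult_right_mono) auto
    also have "\<dots> = 36 * y" using xy x0 by (simp add: field_simps)
    finally show "real F \<le> 37 * y" using F(2) y2 by simp
  qed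
  have D: "exp 2 * real m * p \<le> real D" "real D \<le> exp 2 * real m * p + 1"
    using ceil[of "exp 2 * real m * p", folded D_def] m pp by simp_all
  have Dx: "x * p \<le> real D" "real D \<le> 19 * (x * p)"
  proof -
    have "1 * x * p \<le> exp 2 * real m * p"
      using m x0 pp by (intro mult_right_mono mult_mono) auto
    thus "x * p \<le> real D" using D(1) by simp
    have "exp 2 * real m * p \<le> 9 * (2 * x) * p"
      using m x0 pp exp_two_le by (intro mult_right_mono mult_mono) auto
    thus "real D \<le> 19 * (x * p)" using D(2) Lxp L1 by simp
  qed
  have F0: "0 < real F" using Fy(1) y0 by simp
  have t: "real s / real F \<le> real t" "real t \<le> real s / real F + 1"
    using ceil[of "real s / real F", folded t_def] by simp_all
  have tbig: "64000 \<le> real t"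
  proof -
    have "64000 * (37 * y) \<le> real s" using ty s(1) by simp
    hence "64000 * real F \<le> real s" using Fy(2) by linarith
    hence "64000 \<le> real s / real F" using F0 by (simp add: field_simps)
    thus ?thesis using t(1) by linarith
  qed
  \<comment> \<open>72000 = 100 * 18 * 40 keeps the 3-star term \<open>18 * D * N3\<close> below
    t^2/100. The product F D is at most 37 * 19 = 703 times n p = r, whatever m is; 72000 * 703 is
    about 5 * 10^7, which explains the factor 10^8 in \<open>s\<close>.\<close>
  have FD: "72000 * real D \<le> real t"
  proof -
    have "real F * real D \<le> (37 * y) * (19 * (x * p))"
      using Fy Dx y0 by (intro mult_mono) auto
    also have "\<dots> = 703 * ((x * y) * p)" by simp
    also have "\<dots> = 703 * r" unfolding xy np ..
    finally have "72000 * (real F * real D) \<le> real s" using s(1) r1 by simp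
    hence "72000 * real D \<le> real s / real F" using F0 by (simp add: field_simps)
    thus ?thesis using t(1) by simp
  qed
  have sF: "20 * real F \<le> real s" using Fy(2) ty s(1) y0 by simp
  have stF: "real s \<le> real t * real F" using t(1) F0 by (simp add: field_simps)
  have tF: "real t * real F \<le> 21/20 * real s"
  proof -
    have "real t * real F \<le> (real s / real F + 1) * real F" using t(2) F0 by (intro mult_right_mono) auto
    also have "\<dots> = real s + real F" using F0 by (simp add: field_simps)
    finally show ?thesis using sF by simp
  qed
  have N2: "real t ^ 2 / 1600 \<le> real N2" "real N2 \<le> real t ^ 2 / 1600 + 1"
    using ceil[of "real t ^ 2 / 1600", folded N2_def] by simp_all
  have N: "p * real s ^ 2 / 200 \<le> real N" "real N \<le> p * real s ^ 2 / 200 + 1"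
    using ceil[of "p * real s ^ 2 / 200", folded N_def] pp by simp_all
  have ps: "100000000 * L \<le> p * real s"
  proof -
    have "100000000 * L = p * (100000000 * r)" using pr by simp
    also have "\<dots> \<le> p * real s" using s(1) pp by (intro mult_left_mono) auto
    finally show ?thesis .
  qed
  have pss: "100000000 * L * real s \<le> p * real s ^ 2"
    using mult_right_mono[OF ps, of "real s"] by (simp add: power2_eq_square)
  have Lm: "2 * x * (L / real n) = 2 * x * p ^ 2" by (simp add: p2)

  have "\<exists>H\<subseteq>pairs {..<n}. no_triangle H \<and>
    (\<forall>I\<subseteq>{..<n}. card I = 80 * s \<longrightarrow> p * real s ^ 2 / 16 - 3 * real N \<le> real (card {e\<in>H. e \<subseteq> I}))"
  proof (rule two_bites[where m = m and F = F and t = t and D = D and ?N2.0 = N2 and ?N3.0 = N3 and ?p0.0 = "4 * real n / real m ^ 2"])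
    show "100 \<le> n" by (rule n)
    show "0 < m" "m \<le> n" "0 < s" "0 < t" using m s xn tbig by simp_all
    show "s \<le> m" using m(1) s(2) sx by linarith
    have "real t \<le> real s + 1"
    proof -
      have "real s / real F \<le> real s / 1" using Fy(1) y2 by (intro divide_left_mono) auto
      thus ?thesis using t(2) by simp
    qed
    thus "t \<le> m" using m(1) s(2) sx by linarith
    show "s \<le> t * F" using stF by (simp flip: of_nat_mult)
    show "0 \<le> p" "p \<le> 1" using pp by simp_all
    show "0 \<le> 4 * real n / real m ^ 2" by simp
    have "x ^ 2 \<le> real m ^ 2" using m x0 by (intro power_mono) auto
    hence "4 * real n \<le> real m ^ 2" using p0 by linarith
    thus "4 * real n / real m ^ 2 \<le> 1" using m by (simp add: divide_le_eq)
    show "4 * real n \<le> 4 * real n / real m ^ 2 * real m ^ 2" using m by simp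
    have ee: "exp (2::real) = exp 1 * exp 1" by (simp flip: exp_add)
    show "exp 1 * real m * (4 * real n / real m ^ 2) \<le> exp (- 1) * real F"
      using F(1) m by (simp add: exp_minus ee field_simps power2_eq_square)
    show "2 * ln (real n) \<le> real F" using Ly Fy(1) by (simp add: L_def)
    show "exp 1 * real s ^ 2 * (4 * real n / real m ^ 2) \<le> exp (- (ln (real n) / 20)) * real (80 * s)"
    proof -
      have "exp 1 * real s * (4 * real n / real m ^ 2) \<le> exp 1 * (2 * 100000000 * r) * (4 * real n / x ^ 2)"
        using s(2) \<open>x ^ 2 \<le> real m ^ 2\<close> x0 m r1 n0
        by (intro mult_mono divide_left_mono mult_pos_pos) auto
      hence "exp 1 * real s * (4 * real n / real m ^ 2) * real s \<le> \<epsilon> * 80 * real s"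
        using ek by (intro mult_right_mono) auto
      thus ?thesis by (simp add: \<epsilon>_def L_def power2_eq_square mult_ac)
    qed
    show "exp 1 * real m * p \<le> exp (- 1) * real D"
      using D(1) by (simp add: exp_minus ee field_simps)
    show "2 * ln (real n) \<le> real D" using Lxp Dx(1) by (simp add: L_def)
    show "exp 1 * (real m * real t ^ 2) * p ^ 2 \<le> exp (- (ln (real n) / 20)) * real N2"
    proof -
      have "exp 1 * (real m * real t ^ 2) * p ^ 2 \<le> exp 1 * (2 * x * real t ^ 2) * p ^ 2"
        using m by (intro mult_right_mono mult_left_mono) auto
      also have "\<dots> = (exp 1 * 3200 * x * (L / real n)) * (real t ^ 2 / 1600)" by (simp add: p2)
      also have "\<dots> \<le> \<epsilon> * real N2" using e2 N2(1) \<epsilon>0 by (intro mult_mono) auto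
      finally show ?thesis by (simp add: \<epsilon>_def L_def)
    qed
    have "64000 * real t \<le> real t ^ 2" using mult_right_mono[OF tbig, of "real t"] by (simp add: power2_eq_square)
    note tsq = this
    hence "real (40 * t) \<le> real N2" using N2(1) by simp
    thus "40 * t \<le> N2" by (simp only: of_nat_le_iff)
    show "exp 1 * (real m * real t ^ 3) * p ^ 3 \<le> exp (- (ln (real n) / 20)) * real N3"
    proof -
      have "real t \<le> 3 * 100000000 * r / y"
      proof -
        define z where "z = 100000000 * r / y"
        have "2 * 100000000 * r / y = 2 * z" "3 * 100000000 * r / y = 3 * z" by (simp_all add: z_def)
        moreover have "real s / real F \<le> 2 * 100000000 * r / y" using s(2) Fy(1) y0 r1 by (intro frac_le) auto
        moreover have "1 \<le> z" using ty y0 by (simp add: z_def field_simps)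
        ultimately show ?thesis using t(2) by linarith
      qed
      hence "real t ^ 2 \<le> (3 * 100000000 * r / y) ^ 2" by (intro power_mono) auto
      hence "exp 1 * real m * real t ^ 2 * p ^ 3 \<le> exp 1 * (2 * x) * (3 * 100000000 * r / y) ^ 2 * p ^ 3"
        using m x0 pp by (intro mult_right_mono mult_mono mult_left_mono) auto
      hence "exp 1 * real m * real t ^ 2 * p ^ 3 * real t \<le> \<epsilon> * 40 * real t"
        by (intro mult_right_mono[OF order_trans[OF _ e3]]) simp_all
      thus ?thesis by (simp add: \<epsilon>_def L_def N3_def power2_eq_square power3_eq_cube mult_ac)
    qed
    show "40 * t \<le> N3" by (simp add: N3_def)
    show "exp 1 * (real s ^ 2 * real m) * p ^ 3 \<le> exp (- (ln (real n) / 20)) * real N"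
    proof -
      have "exp 1 * (real s ^ 2 * real m) * p ^ 3 \<le> exp 1 * (real s ^ 2 * (2 * x)) * p ^ 3"
        using m pp by (intro mult_right_mono mult_left_mono) auto
      also have "\<dots> = (exp 1 * 400 * x * (L / real n)) * (p * real s ^ 2 / 200)"
        unfolding p2[symmetric] by (simp add: power2_eq_square power3_eq_cube)
      also have "\<dots> \<le> \<epsilon> * real N"
      proof (intro mult_mono)
        have "exp 1 * 400 * x * (L / real n) \<le> exp 1 * 3200 * x * (L / real n)"
          using x0 L1 by (intro mult_right_mono) auto
        thus "exp 1 * 400 * x * (L / real n) \<le> \<epsilon>" using e2 by linarith
      qed (use N(1) \<epsilon>0 pp in auto)
      finally show ?thesis by (simp add: \<epsilon>_def L_def)
    qed
    have "8000 * real s \<le> 100000000 * L * real s" using L1 by (intro mult_right_mono) auto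
    hence "real (40 * s) \<le> real N" using pss N(1) by simp
    thus "40 * s \<le> N" by (simp only: of_nat_le_iff)
    have "32 * real s * L \<le> 100000000 * L * real s" using L1 by simp
    hence "32 * real s * L \<le> p * real s ^ 2" using pss by linarith
    thus "32 * real s * ln (real n) \<le> p * real s ^ 2" by (simp only: L_def)
    show "real s * real F + real F ^ 2 * (real (8 * N2 + 18 * D * N3) + 2 * real t) \<le> real s ^ 2 / 2"
    proof -
      have "72000 * real D * real t \<le> real t * real t" using FD by (intro mult_right_mono) auto
      hence "72000 * (real D * real t) \<le> real t ^ 2" unfolding power2_eq_square by linarith
      moreover have "real (8 * N2 + 18 * D * N3) = 8 * real N2 + 720 * (real D * real t)"
        by (simp add: N3_def)
      \<comment> \<open>At most t^2/200 + 8 from the 2-stars, t^2/100 from the 3-stars, and 2 t from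
        the diagonal.\<close>
      ultimately have "real (8 * N2 + 18 * D * N3) + 2 * real t \<le> real t ^ 2 / 20"
        using N2(2) tsq tbig by linarith
      hence "real F ^ 2 * (real (8 * N2 + 18 * D * N3) + 2 * real t) \<le> real F ^ 2 * (real t ^ 2 / 20)"
        by (intro mult_left_mono) auto
      also have "\<dots> = (real t * real F) ^ 2 / 20" by (simp add: power_mult_distrib)
      also have "\<dots> \<le> (21/20 * real s) ^ 2 / 20" using tF by (intro divide_right_mono power_mono) auto
      also have "\<dots> \<le> real s ^ 2 / 10" by (simp add: power2_eq_square)
      finally have "real F ^ 2 * (real (8 * N2 + 18 * D * N3) + 2 * real t) \<le> real s ^ 2 / 10" .
      moreover have "real s * real F \<le> real s * (real s / 20)" using sF by (intro mult_left_mono) auto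
      hence "real s * real F \<le> real s ^ 2 / 20" by (simp add: power2_eq_square)
      ultimately show ?thesis using zero_le_power2[of "real s"] by linarith
    qed
  qed
  then obtain H where H: "H \<subseteq> pairs {..<n}" "no_triangle H"
    "\<And>I. I \<subseteq> {..<n} \<Longrightarrow> card I = 80 * s \<Longrightarrow> p * real s ^ 2 / 16 - 3 * real N \<le> real (card {e\<in>H. e \<subseteq> I})"
    by blast
  have fin: "240 * real s * ln (real n) \<le> p * real s ^ 2 / 16 - 3 * real N"
  proof -
    define u where "u = L * real s"
    define v where "v = p * real s ^ 2"
    have "1 \<le> u" using mult_mono[of 1 L 1 "real s"] L1 s(3) by (simp add: u_def)
    moreover have "100000000 * u \<le> v" using pss by (simp add: u_def v_def)
    moreover have "real N \<le> v / 200 + 1" using N(2) by (simp add: v_def)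
    \<comment> \<open>1/16 exceeds 3/200, so deletion leaves a constant fraction of p s^2.\<close>
    ultimately have "240 * u \<le> v / 16 - 3 * real N" by linarith
    thus ?thesis by (simp add: u_def v_def L_def mult_ac)
  qed
  show "\<exists>s H. 0 < s \<and> real s \<le> 2 * 100000000 * sqrt (real n * ln (real n)) \<and>
    H \<subseteq> pairs {..<n} \<and> no_triangle H \<and>
    (\<forall>I\<subseteq>{..<n}. card I = 80 * s \<longrightarrow> 240 * real s * ln (real n) \<le> real (card {e\<in>H. e \<subseteq> I}))"
  proof (intro exI conjI allI impI)
    show "0 < s" using s(3) by simp
    show "real s \<le> 2 * 100000000 * sqrt (real n * ln (real n))" using s(2) by (simp add: r_def L_def)
    show "240 * real s * ln (real n) \<le> real (card {e\<in>H. e \<subseteq> I})" if "I \<subseteq> {..<n}" "card I = 80 * s" for I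
      using H(3)[OF that] fin by linarith
  qed (fact H)+
qed

section \<open>Random orientations\<close>

lemma (in prb_space) prb_trace:
  assumes "S \<subseteq> E" "p = 1 / 2"
  shows "prb E p (\<lambda>G. G \<inter> S = T) \<le> (1 / 2) ^ card S"
proof -
  let ?a = "\<lambda>e. of_bool (e \<in> S \<longrightarrow> e \<in> T) :: real" and ?b = "\<lambda>e. of_bool (e \<in> S \<longrightarrow> e \<notin> T) :: real"
  have "prb E p (\<lambda>G. G \<inter> S = T) \<le> (\<Sum>G | G \<subseteq> E \<and> G \<inter> S = T.
      p ^ card G * (1 - p) ^ card (E - G) * (\<Prod>e\<in>E. if e \<in> G then ?a e else ?b e))"
    unfolding prb_def
  proof (rule sum_mono)
    fix G assume "G \<in> {G. G \<subseteq> E \<and> G \<inter> S = T}"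
    hence "(\<Prod>e\<in>E. if e \<in> G then ?a e else ?b e) = 1" by (intro prod.neutral) auto
    thus "p ^ card G * (1 - p) ^ card (E - G) \<le> p ^ card G * (1 - p) ^ card (E - G) *
       (\<Prod>e\<in>E. if e \<in> G then ?a e else ?b e)" by simp
  qed
  also have "\<dots> \<le> (\<Sum>G\<in>Pow E. p ^ card G * (1 - p) ^ card (E - G) * (\<Prod>e\<in>E. if e \<in> G then ?a e else ?b e))"
    using finE p01 by (intro sum_mono2 mult_nonneg_nonneg prod_nonneg) auto
  also have "\<dots> = (\<Prod>e\<in>E. p * ?a e + (1 - p) * ?b e)" by (rule prb_weight_sum[OF finE])
  also have "\<dots> = (\<Prod>e\<in>E. if e \<in> S then 1 / 2 else 1)"
    using assms(2) by (intro prod.cong) auto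
  also have "\<dots> = (1 / 2) ^ card S" using assms finE by (simp add: prod.If_cases Int_absorb1)
  finally show ?thesis .
qed

text \<open>\<open>U\<close> selects the edges directed towards the larger endpoint: subsets of
  \<open>H\<close> correspond to its orientations, and a uniformly random subset to a uniformly
  random orientation.\<close>

definition orient :: "nat set set \<Rightarrow> nat set set \<Rightarrow> (nat \<times> nat) set" where
  "orient H U = {(u, w). {u, w} \<in> H \<and> (u < w \<longleftrightarrow> {u, w} \<in> U)}"

text \<open>A list without backward arcs forces the direction of every edge inside it: the edge
  between positions i < j points from i to j.\<close>

lemma orient_sorted_trace:
  assumes H: "H \<subseteq> pairs X" and xs: "distinct xs"
    and U: "sorted_wrt (\<lambda>u w. (w, u) \<notin> orient H U) xs"
    and U': "sorted_wrt (\<lambda>u w. (w, u) \<notin> orient H U') xs"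
    and e: "e \<in> H" "e \<subseteq> set xs"
  shows "e \<in> U \<longleftrightarrow> e \<in> U'"
proof -
  have "card e = 2" using e(1) H by (auto simp: pairs_def)
  then obtain a b where ab: "e = {a, b}" "a \<noteq> b" by (auto simp: card_2_iff)
  then obtain i j where "i < length xs" "j < length xs" "a = xs ! i" "b = xs ! j"
    using e(2) by (auto simp: in_set_conv_nth)
  hence "\<exists>i j. i < j \<and> j < length xs \<and> e = {xs ! i, xs ! j}"
    using ab by (metis doubleton_eq_iff nat_neq_iff)
  then obtain i j where ij: "i < j" "j < length xs" "e = {xs ! i, xs ! j}" by blast
  have ne: "xs ! i \<noteq> xs ! j" using xs ij by (simp add: nth_eq_iff_index_eq)
  have comm: "{xs ! j, xs ! i} = e" using ij by auto
  have key: "e \<in> W \<longleftrightarrow> xs ! i < xs ! j" if "sorted_wrt (\<lambda>u w. (w, u) \<notin> orient H W) xs" for W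
  proof -
    have "(xs ! j, xs ! i) \<notin> orient H W" using sorted_wrt_nth_less[OF that ij(1,2)] .
    thus ?thesis using e(1) ne unfolding orient_def comm[symmetric] by (auto simp: comm)
  qed
  show ?thesis using key[OF U] key[OF U'] by simp
qed

text \<open>For each of at most n^k lists, at most one trace of \<open>U\<close> on its at least M
  edges avoids backward arcs, so the list is bad with probability at most 2^(-M).\<close>

lemma unordered_orientation:
  assumes H: "H \<subseteq> pairs {..<n}"
    and M: "\<And>I. I \<subseteq> {..<n} \<Longrightarrow> card I = k \<Longrightarrow> M \<le> card {e\<in>H. e \<subseteq> I}"
    and small: "real n ^ k * (1 / 2) ^ M < 1"
  shows "\<exists>U. \<forall>xs. distinct xs \<longrightarrow> set xs \<subseteq> {..<n} \<longrightarrow> length xs = k \<longrightarrow>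
    \<not> sorted_wrt (\<lambda>u w. (w, u) \<notin> orient H U) xs"
proof -
  have finH: "finite H" using H finite_pairs[of "{..<n}"] finite_subset by blast
  interpret prb_space H "1/2" using finH by unfold_locales auto
  let ?xs = "{xs. set xs \<subseteq> {..<n} \<and> length xs = k}"
  let ?bad = "\<lambda>xs U. distinct xs \<and> sorted_wrt (\<lambda>u w. (w, u) \<notin> orient H U) xs"
  have "prb H (1/2) (\<lambda>U. \<exists>xs\<in>?xs. ?bad xs U) \<le> real n ^ k * (1 / 2) ^ M"
  proof (rule prb_Bex_le)
    show "finite ?xs" by (rule finite_lists_length_eq) simp
    show "real (card ?xs) \<le> real n ^ k" by (simp add: card_lists_length_eq)
    fix xs assume xs: "xs \<in> ?xs"
    show "prb H (1/2) (?bad xs) \<le> (1 / 2) ^ M"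
    proof (cases "\<exists>U. ?bad xs U")
      case False
      hence "{U. U \<subseteq> H \<and> ?bad xs U} = {}" by blast
      thus ?thesis unfolding prb_def by (simp only: sum.empty) simp
    next
      case True
      then obtain U0 where U0: "?bad xs U0" by blast
      let ?S = "{e\<in>H. e \<subseteq> set xs}"
      have "prb H (1/2) (?bad xs) \<le> prb H (1/2) (\<lambda>U. U \<inter> ?S = U0 \<inter> ?S)"
      proof (rule prb_mono)
        fix U assume "?bad xs U"
        thus "U \<inter> ?S = U0 \<inter> ?S" using orient_sorted_trace[OF H _ _ conjunct2[OF U0]] by blast
      qed
      also have "\<dots> \<le> (1 / 2) ^ card ?S" by (rule prb_trace) auto
      also have "\<dots> \<le> (1 / 2) ^ M"
        using M[of "set xs"] xs U0 by (intro power_decreasing) (auto simp: distinct_card)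
      finally show ?thesis .
    qed
  qed auto
  hence lt: "prb H (1/2) (\<lambda>U. \<exists>xs\<in>?xs. ?bad xs U) < 1" using small by linarith
  have "\<exists>U. \<not> (\<exists>xs\<in>?xs. ?bad xs U)"
  proof (rule ccontr)
    assume "\<not> ?thesis"
    hence "prb H (1/2) (\<lambda>_. True) \<le> prb H (1/2) (\<lambda>U. \<exists>xs\<in>?xs. ?bad xs U)"
      by (intro prb_mono) blast
    thus False using lt unfolding prb_True by linarith
  qed
  thus ?thesis by auto
qed

section \<open>Acyclic sets and topological orders\<close>

lemma acyclic_imp_sorted_list:
  assumes "finite I" "acyclic (r \<inter> I \<times> I)"
  shows "\<exists>xs. distinct xs \<and> set xs = I \<and> sorted_wrt (\<lambda>u w. (w, u) \<notin> r) xs"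
  using assms
proof (induction I rule: finite_psubset_induct)
  case (psubset I)
  show ?case
  proof (cases "I = {}")
    case False
    have "finite (r \<inter> I \<times> I)" using psubset.hyps by simp
    hence wf: "wf (r \<inter> I \<times> I)" using psubset.prems by (rule finite_acyclic_wf)
    obtain x where x: "x \<in> I" "\<And>y. (y, x) \<in> r \<inter> I \<times> I \<Longrightarrow> y \<notin> I"
      using wfE_min[OF wf] False by (metis ex_in_conv)
    have "acyclic (r \<inter> (I - {x}) \<times> (I - {x}))"
      by (rule acyclic_subset[OF psubset.prems]) auto
    then obtain xs where xs: "distinct xs" "set xs = I - {x}" "sorted_wrt (\<lambda>u w. (w, u) \<notin> r) xs"
      using psubset.IH[of "I - {x}"] x(1) by blast
    have "(y, x) \<notin> r" if "y \<in> I" for y using x that by blast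
    hence "sorted_wrt (\<lambda>u w. (w, u) \<notin> r) (x # xs)" using xs(2,3) by simp
    moreover have "distinct (x # xs)" "set (x # xs) = I" using xs(1,2) x(1) by auto
    ultimately show ?thesis by blast
  qed auto
qed

text \<open>A cycle of the arc relation is a nonempty closed walk in the induced digraph, and a
  closed walk contains a cycle without repeated vertices.\<close>

lemma acyclic_set_imp_acyclic:
  assumes D: "pair_digraph D" and S: "acyclic_set D S" and I: "I \<subseteq> S"
  shows "acyclic (parcs D \<inter> I \<times> I)"
proof -
  interpret pair_digraph D by (rule D)
  let ?G = "with_proj D \<restriction> S"
  have SV: "S \<subseteq> pverts D" and nc: "\<not> (\<exists>p. pre_digraph.cycle ?G p)"
    using S by (auto simp: acyclic_set_def)
  interpret G: wf_digraph ?G by (rule wellformed_induce_subgraph)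
  have sub: "parcs D \<inter> I \<times> I \<subseteq> arcs_ends ?G"
    using I by (auto simp: arcs_ends_def arc_to_ends_def)
  show ?thesis
  proof (rule acyclicI, intro allI notI)
    fix x assume "(x, x) \<in> (parcs D \<inter> I \<times> I)\<^sup>+"
    hence "(x, x) \<in> (arcs_ends ?G)\<^sup>+" using trancl_mono[OF _ sub] by blast
    then obtain p where "G.awalk x p x" "p \<noteq> []" using G.reachable1_awalk[of x x] by auto
    hence "G.closed_w p" by (auto simp: G.closed_w_def)
    thus False using G.closed_w_imp_cycle nc by blast
  qed
qed

lemma no_arcs_imp_acyclic_set:
  assumes "S \<subseteq> pverts D" "\<And>u w. u \<in> S \<Longrightarrow> w \<in> S \<Longrightarrow> (u, w) \<notin> parcs D"
  shows "acyclic_set D S"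
proof -
  have "set p \<subseteq> arcs (with_proj D \<restriction> S) \<Longrightarrow> p = []" for p
    using assms(2) by (cases p) auto
  thus ?thesis using assms(1)
    by (auto simp: acyclic_set_def pre_digraph.cycle_def pre_digraph.awalk_def)
qed

lemma orient_graph:
  assumes H: "H \<subseteq> pairs {..<n}" and tf: "no_triangle H"
  shows "\<lparr>pverts = {..<n}, parcs = orient H U\<rparr> \<in> oriented_triangle_free_graphs n"
proof -
  let ?D = "\<lparr>pverts = {..<n}, parcs = orient H U\<rparr>"
  have sub: "u < n \<and> w < n \<and> u \<noteq> w \<and> {u, w} \<in> H" if "(u, w) \<in> orient H U" for u w
  proof -
    have "{u, w} \<in> H" using that by (simp add: orient_def)
    moreover from this have "{u, w} \<in> pairs {..<n}" using H by blast
    ultimately show ?thesis by (simp add: pairs_iff)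
  qed
  have "finite (orient H U)"
    by (rule finite_subset[of _ "{..<n} \<times> {..<n}"]) (use sub in auto)
  hence "pair_digraph ?D" using sub by unfold_locales (auto dest: sub)
  moreover have "(w, u) \<notin> orient H U" if "(u, w) \<in> orient H U" for u w
    using that sub[OF that] by (auto simp: orient_def insert_commute)
  moreover have "{u, w} \<in> H" if "(u, w) \<in> parcs (mk_symmetric (with_proj ?D))" for u w
    using that sub[of u w] sub[of w u] by (auto simp: parcs_mk_symmetric insert_commute)
  hence "triangle_free (mk_symmetric (with_proj ?D))"
    using tf unfolding triangle_free_def no_triangle_def by (metis insert_commute)
  ultimately show ?thesis
    by (simp add: oriented_triangle_free_graphs_def oriented_triangle_free_def oriented_graph_iff)
qed

lemma small_acyclic_number_graphs:
  "\<exists>C>0. \<forall>\<^sub>F n in sequentially. \<exists>D\<in>oriented_triangle_free_graphs n.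
     real (acyclic_number D) \<le> C * sqrt (real n * ln (real n))"
proof (intro exI[of _ "80 * (2 * 100000000) :: real"] conjI)
  show "\<forall>\<^sub>F n in sequentially. \<exists>D\<in>oriented_triangle_free_graphs n.
     real (acyclic_number D) \<le> 80 * (2 * 100000000) * sqrt (real n * ln (real n))"
    using dense_graphs eventually_ge_at_top[of 2]
  proof eventually_elim
    case (elim n)
    then obtain s H where s: "0 < s" "real s \<le> 2 * 100000000 * sqrt (real n * ln (real n))"
      and H: "H \<subseteq> pairs {..<n}" "no_triangle H"
      and dense: "\<And>I. I \<subseteq> {..<n} \<Longrightarrow> card I = 80 * s \<Longrightarrow> 240 * real s * ln (real n) \<le> real (card {e\<in>H. e \<subseteq> I})"
      by blast
    define L where "L = ln (real n)"
    have L: "0 < L" "exp L = real n" using elim(2) by (simp_all add: L_def)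
    define M where "M = nat \<lceil>240 * real s * L\<rceil>"
    have M: "240 * real s * L \<le> real M" unfolding M_def by linarith
    have Mle: "M \<le> card {e\<in>H. e \<subseteq> I}" if "I \<subseteq> {..<n}" "card I = 80 * s" for I
      using dense[OF that] unfolding M_def L_def by linarith
    \<comment> \<open>With k = 80 s, the exponent k ln n - M ln 2 is negative because M is at least
      3 k ln n and ln 2 is at least 1/2.\<close>
    have "real n ^ (80 * s) * (1 / 2) ^ M = exp (real (80 * s) * L) * exp (real M * ln (1/2))"
      unfolding exp_of_nat_mult L(2) by simp
    also have "\<dots> = exp (real (80 * s) * L - real M * ln 2)" by (simp add: ln_div flip: exp_add)
    also have "\<dots> < 1"
    proof -
      have "240 * real s * L * (1/2) \<le> real M * ln 2"
        using M half_le_ln2 L(1) by (intro mult_mono) auto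
      moreover have "0 < real s * L" using s L by simp
      ultimately have "80 * (real s * L) < real M * ln 2" by (simp only: mult.assoc)
      thus ?thesis by (simp add: mult.assoc)
    qed
    finally obtain U where U: "\<And>xs. distinct xs \<Longrightarrow> set xs \<subseteq> {..<n} \<Longrightarrow> length xs = 80 * s \<Longrightarrow>
        \<not> sorted_wrt (\<lambda>u w. (w, u) \<notin> orient H U) xs"
      using unordered_orientation[OF H(1) Mle] by blast
    let ?D = "\<lparr>pverts = {..<n}, parcs = orient H U\<rparr>"
    have D: "?D \<in> oriented_triangle_free_graphs n" by (rule orient_graph[OF H])
    hence pd: "pair_digraph ?D"
      by (simp add: oriented_triangle_free_graphs_def oriented_triangle_free_def oriented_graph_iff)
    have "card S \<le> 80 * s" if S: "acyclic_set ?D S" for S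
    proof (rule ccontr)
      assume "\<not> card S \<le> 80 * s"
      then obtain I where I: "I \<subseteq> S" "card I = 80 * s" by (metis nat_le_linear obtain_subset_with_card_n)
      have In: "I \<subseteq> {..<n}" using S I(1) by (auto simp: acyclic_set_def)
      hence "finite I" by (rule finite_subset) simp
      moreover have "acyclic (orient H U \<inter> I \<times> I)" using acyclic_set_imp_acyclic[OF pd S I(1)] by simp
      ultimately obtain xs where xs: "distinct xs" "set xs = I" "sorted_wrt (\<lambda>u w. (w, u) \<notin> orient H U) xs"
        using acyclic_imp_sorted_list by blast
      moreover have "length xs = 80 * s" using xs I(2) distinct_card by fastforce
      ultimately show False using U[of xs] In by simp
    qed
    hence "acyclic_number ?D \<le> 80 * s"
      unfolding acyclic_number_def using acyclic_number_set[of ?D] by (intro Max.boundedI) auto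
    hence "real (acyclic_number ?D) \<le> real (80 * s)" by (rule of_nat_mono)
    hence "real (acyclic_number ?D) \<le> 80 * (2 * 100000000) * sqrt (real n * ln (real n))" using s(2) by simp
    thus ?case using D by blast
  qed
qed simp

section \<open>Conclusion\<close>

text \<open>\<open>n\<close> is kept apart from \<open>card V\<close> so that greedy colouring can
  use one fixed logarithm for all remaining sets. A vertex of degree above D has a large independent
  neighbourhood. Otherwise D bounds the degrees, and card V \<ge> n^(1/3) yields ln D \<ge> ln n /
  6, whence 48 = 8 * 6.\<close>

lemma triangle_free_indep_sqrt:
  fixes n :: nat
  assumes V: "finite V" and E: "triangle_free_rel E"
    and n: "1 \<le> ln (real n)" and r: "real n powr (1/3) \<le> real (card V)"
  shows "\<exists>S\<subseteq>V. indep E S \<and> sqrt (real (card V) * ln (real n)) / 48 \<le> real (card S)"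
proof -
  define r where "r = real (card V)"
  define L where "L = ln (real n)"
  define D where "D = sqrt (r * L)"
  have n0: "0 < real n" using n by (cases "n = 0") auto
  have L1: "1 \<le> L" using n by (simp add: L_def)
  have "real n powr (1/3) = exp (L / 3)" using n0 by (simp add: powr_def L_def)
  hence r': "exp (L / 3) \<le> r" using assms(4) by (simp add: r_def)
  have "1 \<le> exp (L / 3)" using L1 by simp
  hence r1: "1 \<le> r" using r' by linarith
  have "ln (exp (L / 3)) \<le> ln r" using r' by (intro ln_mono) auto
  hence "L / 3 \<le> ln r" by simp
  have D1: "1 \<le> D" using mult_mono[of 1 r 1 L] r1 L1 by (simp add: D_def)
  have DD: "D * D = r * L" using r1 L1 by (simp add: D_def)
  note sym = triangle_free_relD(1)[OF E] and tf = triangle_free_relD(3)[OF E]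
  show ?thesis
  proof (cases "\<exists>v\<in>V. D < real (card {u\<in>V. E v u})")
    case True
    then obtain v where v: "v \<in> V" "D < real (card {u\<in>V. E v u})" by blast
    have "indep E {u\<in>V. E v u}" using tf sym unfolding indep_def by blast
    moreover have "sqrt (real (card V) * ln (real n)) / 48 \<le> real (card {u\<in>V. E v u})"
      using v(2) D1 by (simp add: D_def r_def L_def)
    ultimately show ?thesis by (intro exI[of _ "{u\<in>V. E v u}"]) simp
  next
    case False
    obtain S where S: "S \<subseteq> V" "indep E S" "real (card V) * log 2 D / (8 * D) \<le> real (card S)"
      using triangle_free_large_indep[OF V E D1] False by (meson not_le)
    have "ln D = (ln r + ln L) / 2" using r1 L1 by (simp add: D_def ln_sqrt ln_mult)
    moreover have "0 \<le> ln L" using L1 by simp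
    ultimately have "L / 6 \<le> ln D" using \<open>L / 3 \<le> ln r\<close> by simp
    also have "ln D \<le> log 2 D"
    proof -
      have "ln D * ln 2 \<le> ln D * 1" using D1 ln_2_less_1 by (intro mult_left_mono) auto
      thus ?thesis by (simp add: log_def pos_le_divide_eq)
    qed
    finally have "r * (L / 6) / (8 * D) \<le> r * log 2 D / (8 * D)"
      using r1 D1 by (intro divide_right_mono mult_left_mono) auto
    moreover have "r * (L / 6) / (8 * D) = D / 48"
      using DD D1 by (simp add: field_simps)
    ultimately have "D / 48 \<le> real (card S)" using S(3)[folded r_def] by linarith
    hence "sqrt (real (card V) * ln (real n)) / 48 \<le> real (card S)" by (simp add: D_def r_def L_def)
    thus ?thesis using S(1,2) by blast
  qed
qed

section \<open>Greedy colouring\<close>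

text \<open>The concave square root lies below its tangent at r.\<close>

lemma sqrt_diff_le:
  assumes "0 < r" "0 \<le> a" "a \<le> r"
  shows "sqrt (r - a) \<le> sqrt r - a / (2 * sqrt r)"
proof (rule real_le_lsqrt)
  have rr: "sqrt r * sqrt r = r" using assms by simp
  have s0: "0 < sqrt r" using assms by simp
  have "a / (2 * sqrt r) \<le> r / sqrt r"
    using assms s0 by (intro frac_le) auto
  also have "r / sqrt r = sqrt r" using assms by (simp add: real_div_sqrt)
  finally show "0 \<le> sqrt r - a / (2 * sqrt r)" by simp
  have "(sqrt r - a / (2 * sqrt r)) ^ 2 = r - a + (a / (2 * sqrt r)) ^ 2"
    using s0 rr by (simp add: power2_diff)
  thus "r - a \<le> (sqrt r - a / (2 * sqrt r)) ^ 2" by simp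
qed

text \<open>Potential argument: by the tangent bound, removing an independent set of size sqrt (card
  V * ln n) / 48 lowers 96 sqrt (card V / ln n) by at least 1, hence 96 = 2 * 48. Once fewer than
  n^(1/3) vertices remain, they become singleton classes.\<close>

lemma triangle_free_colouring:
  fixes n :: nat
  assumes E: "triangle_free_rel E" and n: "1 \<le> ln (real n)"
    and V: "finite V"
  shows "\<exists>P. partition_on V P \<and> (\<forall>S\<in>P. indep E S) \<and>
    real (card P) \<le> real n powr (1/3) + 96 * sqrt (real (card V) / ln (real n))"
  using V
proof (induction V rule: finite_psubset_induct)
  case (psubset V)
  define L where "L = ln (real n)"
  have L1: "1 \<le> L" using n by (simp add: L_def)
  show ?case
  proof (cases "real n powr (1/3) \<le> real (card V)")
    case False
    let ?P = "(\<lambda>v. {v}) ` V"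
    have "partition_on V ?P" by (rule partition_onI) (auto simp: disjnt_def)
    moreover have "card ?P = card V" by (simp add: card_image)
    moreover have "\<forall>S\<in>?P. indep E S" using triangle_free_relD(2)[OF E] by (auto simp: indep_def)
    moreover have "0 \<le> 96 * sqrt (real (card V) / L)" using L1 by simp
    ultimately show ?thesis using False unfolding L_def by (intro exI[of _ ?P] conjI; (assumption | linarith)?)
  next
    case True
    obtain S where S: "S \<subseteq> V" "indep E S" "sqrt (real (card V) * L) / 48 \<le> real (card S)"
      using triangle_free_indep_sqrt[OF psubset.hyps E n True] unfolding L_def by blast
    have n0: "0 < real n" using n by (cases "n = 0") auto
    define r where "r = real (card V)"
    define a where "a = real (card S)"
    have r0: "0 < r" using True n0 powr_gt_zero[of "real n" "1/3"] unfolding r_def by linarith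
    have a: "sqrt (r * L) / 48 \<le> a" using S(3) by (simp add: a_def r_def)
    have a0: "0 < a" using a r0 L1 by (smt (verit) mult_pos_pos real_sqrt_gt_zero divide_pos_pos)
    have ar: "a \<le> r" using S(1) psubset.hyps by (simp add: a_def r_def card_mono)
    have Sne: "S \<noteq> {}" using a0 by (auto simp: a_def)
    hence "V - S \<subset> V" using S(1) by auto
    from psubset.IH[OF this] obtain P where P: "partition_on (V - S) P" "\<forall>S\<in>P. indep E S"
      "real (card P) \<le> real n powr (1/3) + 96 * sqrt (real (card (V - S)) / L)" unfolding L_def by blast
    have "partition_on V (insert S P)"
    proof (rule partition_onI)
      show "\<Union> (insert S P) = V" using P(1) S(1) by (auto simp: partition_on_def)
    next
      show "{} \<notin> insert S P" using P(1) Sne by (auto simp: partition_on_def)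
    next
      fix p p' assume "p \<in> insert S P" "p' \<in> insert S P" "p \<noteq> p'"
      thus "disjnt p p'" using P(1) by (auto simp: partition_on_def disjoint_def disjnt_def)
    qed
    moreover have "\<forall>S\<in>insert S P. indep E S" using P(2) S(2) by auto
    moreover have "real (card (insert S P)) \<le> real n powr (1/3) + 96 * sqrt (real (card V) / L)"
    proof -
      have "finite P" using P(1) psubset.hyps by (meson finite_Diff finite_elements)
      hence "real (card (insert S P)) \<le> real (card P) + 1" by (simp add: card_insert_if)
      moreover have "real (card (V - S)) = r - a"
      proof -
        have "finite S" using S(1) psubset.hyps by (rule finite_subset)
        thus ?thesis using S(1) psubset.hyps by (simp add: card_Diff_subset a_def r_def card_mono of_nat_diff)
      qed
      moreover have "96 * sqrt ((r - a) / L) + 1 \<le> 96 * sqrt (r / L)"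
      proof -
        have s: "0 < sqrt r" "0 < sqrt L" using r0 L1 by simp_all
        have "sqrt (r - a) \<le> sqrt r - a / (2 * sqrt r)" using r0 a0 ar by (intro sqrt_diff_le) auto
        moreover have "sqrt L / 96 \<le> a / (2 * sqrt r)"
          using a s by (simp add: real_sqrt_mult field_simps)
        ultimately have "sqrt (r - a) + sqrt L / 96 \<le> sqrt r" by linarith
        hence "(sqrt (r - a) + sqrt L / 96) / sqrt L \<le> sqrt r / sqrt L"
          using s by (intro divide_right_mono) auto
        thus ?thesis using s by (simp add: real_sqrt_divide add_divide_distrib)
      qed
      ultimately show ?thesis using P(3) by (simp add: r_def)
    qed
    ultimately show ?thesis unfolding L_def by blast
  qed
qed

section \<open>Passage from graphs to oriented graphs\<close>

definition adj :: "'a pair_pre_digraph \<Rightarrow> 'a \<Rightarrow> 'a \<Rightarrow> bool" where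
  "adj D u v \<longleftrightarrow> (u, v) \<in> parcs D \<or> (v, u) \<in> parcs D"

lemma adj_sym: "adj D u v \<Longrightarrow> adj D v u"
  by (auto simp: adj_def)

lemma oriented_triangle_freeD:
  assumes "D \<in> oriented_triangle_free_graphs n"
  shows "oriented_graph D" "finite (pverts D)" "card (pverts D) = n" "triangle_free_rel (adj D)"
proof -
  show og: "oriented_graph D" and "card (pverts D) = n"
    using assms by (auto simp: oriented_triangle_free_graphs_def oriented_triangle_free_def)
  show "finite (pverts D)" by (rule oriented_graph_finite_verts[OF og])
  have irr: "\<not> adj D u u" for u using og by (auto simp: adj_def oriented_graph_iff)
  have tf: "triangle_free (mk_symmetric (with_proj D))"
    using assms by (auto simp: oriented_triangle_free_graphs_def oriented_triangle_free_def)
  have sym_arc: "(u, v) \<in> parcs (mk_symmetric (with_proj D))" if "adj D u v" for u v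
    using that unfolding adj_def
  proof
    assume "(u, v) \<in> parcs D"
    thus ?thesis unfolding parcs_mk_symmetric with_proj_simps by (rule UN_I) simp
  next
    assume "(v, u) \<in> parcs D"
    thus ?thesis unfolding parcs_mk_symmetric with_proj_simps by (rule UN_I) simp
  qed
  have tf': "\<not> adj D u w" if "adj D u v" "adj D v w" for u v w
  proof
    assume "adj D u w"
    hence "adj D w u" by (rule adj_sym)
    show False
      by (rule notE[OF tf[unfolded triangle_free_def]], intro exI conjI)
        (fact sym_arc[OF that(1)] sym_arc[OF that(2)] sym_arc[OF \<open>adj D w u\<close>])+
  qed
  show "triangle_free_rel (adj D)"
    unfolding triangle_free_rel_def
    by (intro conjI allI impI) (erule adj_sym, rule irr, erule tf', assumption)
qed

lemma indep_acyclic_set: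
  assumes "S \<subseteq> pverts D" "indep (adj D) S"
  shows "acyclic_set D S"
  by (rule no_arcs_imp_acyclic_set) (use assms in \<open>auto simp: indep_def adj_def\<close>)

lemma card_le_acyclic_number:
  assumes "finite (pverts D)" "acyclic_set D S"
  shows "card S \<le> acyclic_number D"
  unfolding acyclic_number_def using acyclic_number_set(1)[OF assms(1)] assms(2) by (intro Max_ge) auto

lemma acyclic_number_ge:
  assumes "D \<in> oriented_triangle_free_graphs n" "1 \<le> ln (real n)"
  shows "1 / 48 * sqrt (real n * ln (real n)) \<le> real (acyclic_number D)"
proof -
  note D = oriented_triangle_freeD[OF assms(1)]
  have "1 \<le> real n" using assms(2) by (cases "n = 0") auto
  hence "real n powr (1/3) \<le> real n powr 1" by (intro powr_mono) auto
  hence "real n powr (1/3) \<le> real (card (pverts D))" using D(3) \<open>1 \<le> real n\<close> by simp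
  from triangle_free_indep_sqrt[OF D(2,4) assms(2) this]
  obtain S where S: "S \<subseteq> pverts D" "indep (adj D) S"
    "sqrt (real (card (pverts D)) * ln (real n)) / 48 \<le> real (card S)" by blast
  have "card S \<le> acyclic_number D"
    by (intro card_le_acyclic_number D(2) indep_acyclic_set S)
  hence "real (card S) \<le> real (acyclic_number D)" by (rule of_nat_mono)
  thus ?thesis using S(3) D(3) by simp
qed

lemma dichromatic_number_upper:
  assumes "D \<in> oriented_triangle_free_graphs n" "1 \<le> ln (real n)"
  shows "real (dichromatic_number D) \<le> real n powr (1/3) + 96 * sqrt (real n / ln (real n))"
proof -
  note D = oriented_triangle_freeD[OF assms(1)]
  obtain P where P: "partition_on (pverts D) P" "\<forall>S\<in>P. indep (adj D) S"
    "real (card P) \<le> real n powr (1/3) + 96 * sqrt (real (card (pverts D)) / ln (real n))"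
    using triangle_free_colouring[OF D(4) assms(2) D(2)] by blast
  have "\<forall>S\<in>P. acyclic_set D S" using P(1,2) by (auto intro!: indep_acyclic_set simp: partition_on_def)
  hence "dichromatic_number D \<le> card P"
    unfolding dichromatic_number_def using dichromatic_number_set(1)[OF D(1)] P(1) by (intro Min_le) auto
  hence "real (dichromatic_number D) \<le> real (card P)" by (rule of_nat_mono)
  thus ?thesis using P(3) D(3) by simp
qed

lemma card_le_dichromatic_mult_acyclic:
  assumes "oriented_graph D"
  shows "card (pverts D) \<le> dichromatic_number D * acyclic_number D"
proof -
  have fin: "finite (pverts D)" by (rule oriented_graph_finite_verts[OF assms])
  have "dichromatic_number D \<in> {card P | P. partition_on (pverts D) P \<and> (\<forall>S\<in>P. acyclic_set D S)}"
    unfolding dichromatic_number_def using dichromatic_number_set[OF assms] by (intro Min_in) auto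
  then obtain P where P: "dichromatic_number D = card P" "partition_on (pverts D) P" "\<forall>S\<in>P. acyclic_set D S"
    by blast
  have "card (pverts D) = card (\<Union>P)" using P(2) by (simp add: partition_on_def)
  also have "\<dots> \<le> (\<Sum>S\<in>P. card S)" by (rule card_Union_le_sum_card)
  also have "\<dots> \<le> (\<Sum>S\<in>P. acyclic_number D)" using P(3) by (intro sum_mono card_le_acyclic_number fin) auto
  finally show ?thesis using P(1) by simp
qed

theorem theorem1p2:
  shows "\<exists>c C :: real. c > 0 \<and> C > 0 \<and>
    (\<exists>N. \<forall>n\<ge>N.
      c * sqrt (real n * ln (real n)) \<le> real (min_acyclic_number n) \<and>
      real (min_acyclic_number n) \<le> C * sqrt (real n * ln (real n)) \<and>
      c * sqrt (real n / ln (real n)) \<le> real (max_dichromatic_number n) \<and>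
      real (max_dichromatic_number n) \<le> C * sqrt (real n / ln (real n)))"
proof -
  obtain C0 :: real where C0: "C0 > 0" and ev: "\<forall>\<^sub>F n in sequentially. \<exists>D\<in>oriented_triangle_free_graphs n.
     real (acyclic_number D) \<le> C0 * sqrt (real n * ln (real n))"
    using small_acyclic_number_graphs by blast
  define c where "c = min (1 / 48) (1 / C0)"
  define C where "C = max C0 97"
  have "\<forall>\<^sub>F n in sequentially. 1 \<le> ln (real n) \<and> real n powr (1/3) \<le> sqrt (real n / ln (real n))"
    by (intro eventually_conj; real_asymp)
  with ev have "\<forall>\<^sub>F n in sequentially.
      c * sqrt (real n * ln (real n)) \<le> real (min_acyclic_number n) \<and>
      real (min_acyclic_number n) \<le> C * sqrt (real n * ln (real n)) \<and>
      c * sqrt (real n / ln (real n)) \<le> real (max_dichromatic_number n) \<and>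
      real (max_dichromatic_number n) \<le> C * sqrt (real n / ln (real n))"
  proof eventually_elim
    case (elim n)
    then obtain D where D: "D \<in> oriented_triangle_free_graphs n"
      "real (acyclic_number D) \<le> C0 * sqrt (real n * ln (real n))" by blast
    have L: "1 \<le> ln (real n)" and n3: "real n powr (1/3) \<le> sqrt (real n / ln (real n))" using elim by auto
    have n0: "0 < real n" using L by (cases "n = 0") auto
    define a where "a = sqrt (real n * ln (real n))"
    define b where "b = sqrt (real n / ln (real n))"
    have ab: "a * b = real n" "0 < a" "0 < b"
    proof -
      define l where "l = ln (real n)"
      have l: "0 < l" using L by (simp add: l_def)
      have "a * b = sqrt ((real n * l) * (real n / l))" unfolding a_def b_def l_def real_sqrt_mult ..
      also have "(real n * l) * (real n / l) = real n ^ 2" using l by (simp add: power2_eq_square)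
      finally show "a * b = real n" by simp
      show "0 < a" "0 < b" using l n0 unfolding a_def b_def l_def[symmetric] by simp_all
    qed
    let ?G = "oriented_triangle_free_graphs n"
    have ne: "?G \<noteq> {}" by (rule oriented_triangle_free_graphs_nonempty)
    have "min_acyclic_number n \<in> acyclic_number ` ?G"
      unfolding min_acyclic_number_def using finite_acyclic_numbers ne by (intro Min_in) auto
    hence 1: "1 / 48 * a \<le> real (min_acyclic_number n)"
      using acyclic_number_ge[OF _ L] by (auto simp: a_def)
    have "min_acyclic_number n \<le> acyclic_number D"
      unfolding min_acyclic_number_def using finite_acyclic_numbers D(1) by (intro Min_le) auto
    hence 2: "real (min_acyclic_number n) \<le> C0 * a" using D(2) by (simp add: a_def)
    have "dichromatic_number D \<le> max_dichromatic_number n"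
      unfolding max_dichromatic_number_def using finite_dichromatic_numbers D(1) by (intro Max_ge) auto
    \<comment> \<open>The same digraph serves both bounds: its few-vertex acyclic classes must cover
      n = a * b vertices.\<close>
    have 3: "1 / C0 * b \<le> real (max_dichromatic_number n)"
    proof -
      have "real n \<le> real (dichromatic_number D * acyclic_number D)"
        using card_le_dichromatic_mult_acyclic[of D] oriented_triangle_freeD(1,3)[OF D(1)] by (intro of_nat_mono) simp
      also have "\<dots> \<le> real (max_dichromatic_number n) * (C0 * a)"
        using \<open>dichromatic_number D \<le> max_dichromatic_number n\<close> D(2) unfolding of_nat_mult a_def
        by (intro mult_mono) auto
      finally have "a * b \<le> a * (real (max_dichromatic_number n) * C0)" by (simp add: ab(1) mult_ac)
      hence "b \<le> real (max_dichromatic_number n) * C0" using ab(2) by simp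
      thus ?thesis using C0 by (simp add: field_simps)
    qed
    have "max_dichromatic_number n \<in> dichromatic_number ` ?G"
      unfolding max_dichromatic_number_def using finite_dichromatic_numbers ne by (intro Max_in) auto
    then obtain D' where "D' \<in> ?G" "max_dichromatic_number n = dichromatic_number D'" by blast
    \<comment> \<open>97 = 96 + 1: \<open>n3\<close> absorbs the term n^(1/3) of the singleton
      classes.\<close>
    hence 4: "real (max_dichromatic_number n) \<le> 97 * b"
      using dichromatic_number_upper[of D' n] L n3 by (simp add: b_def)
    have "c * a \<le> 1 / 48 * a" "c * b \<le> 1 / C0 * b" "C0 * a \<le> C * a" "97 * b \<le> C * b"
      unfolding c_def C_def using ab by (intro mult_right_mono; simp)+
    thus ?case using 1 2 3 4 unfolding a_def b_def by linarith
  qed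
  moreover have "c > 0" "C > 0" using C0 by (auto simp: c_def C_def)
  ultimately show ?thesis unfolding eventually_sequentially by blast
qed

end
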